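(* Let $\Sigma^n=\Sigma(P^n)$ be a smooth projective fan in $\mathbb{R}^n$ spanned by an $n$-crosspolytope $P^n$, let $\Sigma^n\to\Sigma^{n-1}\to\cdots\to\Sigma^1\to\{0\}$ be the associated sequence of quotient fans, and let $X^k$ be the toric variety associated to $\Sigma^k$ for $k\le n$. Then $\{X^k : k\le n\}$ is a Bott tower (of height $n$).
   Context: Bott towers. Let $N_0$ be a point with trivial line bundle $\xi_0$, and inductively let $N_k=\mathbb{C}P(\mathbb{C}\oplus\xi_{k-1})$ (the space of lines in the fibres of $\mathbb{C}\oplus\xi_{k-1}$), where $\mathbb{C}$ denotes the trivial line bundle and $\xi_{k-1}$ is an arbitrary holomorphic line bundle over $N_{k-1}$. A Bott tower of height $n$ is a collection $\{N_k:k\le n\}$ of complex manifolds constructed in this way (manifolds are considered up to isomorphism). Crosspolytopes. A $1$-crosspolytope is a line segment; if $P^k$ is a $k$-crosspolytope and $I_{k+1}$ is a line segment with $(\mathrm{relint}\,P^k)\cap(\mathrm{relint}\,I_{k+1})$ a single point (with $\mathrm{conv}(P^k\cup I_{k+1})$ of dimension $k+1$), then $P^{k+1}=\mathrm{conv}(P^k\cup I_{k+1})$ is a $(k+1)$-crosspolytope. An $n$-crosspolytope has $2n$ vertices $x_1,\ldots,x_n,\widehat{x}_1,\ldots,\widehat{x}_n$ such that $[x_i,\widehat{x}_i]$ is not an edge for any $i$. Fans. A fan is spanned by a polytope $P$ with $0$ in its interior if its cones are the cones over the proper faces of $P$ (together with $\{0\}$). A fan is smooth if each cone is generated by part of a lattice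 basis, and projective if its toric variety is projective. For $\Sigma^n=\Sigma(P^n)$ the vertices of $P^n$ are identified with the primitive lattice generators of the rays of $\Sigma^n$, so we also write $x_i,\widehat{x}_i$ for these generators. The sequence of quotient fans. Some pair of generators satisfies $x_i+\widehat{x}_i=0$; label so that $x_n+\widehat{x}_n=0$. Put $\sigma_n=\mathbb{R}_{\ge}x_n$, let $p_n:\mathbb{R}^n\to(\mathbb{R}x_n)^{\perp}$ be the orthogonal projection, and let $\Sigma^{n-1}:=\{p_n(\sigma):\sigma\in\Sigma^n,\ \sigma_n\text{ is a face of }\sigma\}$, i.e. the quotient fan $\Sigma^n/\sigma_n$, taken with respect to the image lattice $p_n(\mathbb{Z}^n)$. This is again a smooth projective fan spanned by an $(n-1)$-crosspolytope, and repeating the construction gives $\Sigma^{n-2},\ldots,\Sigma^1,\Sigma^0=\{0\}$ and projections $p_k:\Sigma^k\to\Sigma^{k-1}$. *)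

theory Defs
  imports "HOL-Analysis.Analysis"
begin

section \<open>Complex manifolds\<close>

text \<open>The dimensions of the manifolds in a tower vary with the index, so the model space
  \<open>\<complex>\<^sup>k\<close> is the set of sequences supported on \<open>{..<k}\<close>, with the topology induced by the product
  topology on \<open>nat \<Rightarrow> complex\<close>.\<close>

definition Cspace :: "nat \<Rightarrow> (nat \<Rightarrow> complex) set" where
  "Cspace k = {z. \<forall>i\<ge>k. z i = 0}"

text \<open>\<open>f\<close> has a complex-linear Frechet derivative \<open>h \<mapsto> \<Sum>i<k. D i * h i\<close> at every point of the
  open set \<open>U\<close>; errors are measured in the \<open>\<ell>\<^sup>1\<close> norm of \<open>\<complex>\<^sup>k\<close>.\<close>

definition holo_on :: "nat \<Rightarrow> (nat \<Rightarrow> complex) set \<Rightarrow> ((nat \<Rightarrow> complex) \<Rightarrow> complex) \<Rightarrow> bool" where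
  "holo_on k U f \<longleftrightarrow> openin (top_of_set (Cspace k)) U \<and>
    (\<forall>z\<in>U. \<exists>D :: nat \<Rightarrow> complex.
      ((\<lambda>w. (f w - f z - (\<Sum>i<k. D i * (w i - z i))) / complex_of_real (\<Sum>i<k. norm (w i - z i)))
        \<longlongrightarrow> 0) (at z within U))"

definition holo_map :: "nat \<Rightarrow> (nat \<Rightarrow> complex) set \<Rightarrow> nat \<Rightarrow>
    ((nat \<Rightarrow> complex) \<Rightarrow> nat \<Rightarrow> complex) \<Rightarrow> bool" where
  "holo_map k U l f \<longleftrightarrow> openin (top_of_set (Cspace k)) U \<and> f ` U \<subseteq> Cspace l \<and>
    (\<forall>j<l. holo_on k U (\<lambda>z. f z j))"

text \<open>A chart is a pair of its domain and its coordinate map; only the values of the coordinate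
  map on the domain matter.\<close>

record 'p cmanifold =
  mdim :: nat
  atlas :: "('p set \<times> ('p \<Rightarrow> nat \<Rightarrow> complex)) set"

definition points :: "'p cmanifold \<Rightarrow> 'p set" where
  "points M = (\<Union>(U, \<phi>)\<in>atlas M. U)"

definition mtopology :: "'p cmanifold \<Rightarrow> 'p topology" where
  "mtopology M = topology_generated_by {U \<inter> \<phi> -` W | U \<phi> W. (U, \<phi>) \<in> atlas M \<and> open W}"

definition complex_manifold :: "'p cmanifold \<Rightarrow> bool" where
  "complex_manifold M \<longleftrightarrow>
    (\<forall>(U, \<phi>)\<in>atlas M. inj_on \<phi> U \<and> openin (top_of_set (Cspace (mdim M))) (\<phi> ` U)) \<and>
    (\<forall>(U, \<phi>)\<in>atlas M. \<forall>(V, \<psi>)\<in>atlas M.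
       holo_map (mdim M) (\<phi> ` (U \<inter> V)) (mdim M) (\<psi> \<circ> inv_into U \<phi>)) \<and>
    Hausdorff_space (mtopology M) \<and> second_countable (mtopology M)"

definition holomorphic_fun :: "'p cmanifold \<Rightarrow> 'p set \<Rightarrow> ('p \<Rightarrow> complex) \<Rightarrow> bool" where
  "holomorphic_fun M W g \<longleftrightarrow>
    (\<forall>(U, \<phi>)\<in>atlas M. holo_on (mdim M) (\<phi> ` (U \<inter> W)) (g \<circ> inv_into U \<phi>))"

definition holomorphic_map :: "'p cmanifold \<Rightarrow> 'q cmanifold \<Rightarrow> ('p \<Rightarrow> 'q) \<Rightarrow> bool" where
  "holomorphic_map M N f \<longleftrightarrow> continuous_map (mtopology M) (mtopology N) f \<and>
    (\<forall>(U, \<phi>)\<in>atlas M. \<forall>(V, \<psi>)\<in>atlas N.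
       holo_map (mdim M) (\<phi> ` {x\<in>U. f x \<in> V}) (mdim N) (\<psi> \<circ> f \<circ> inv_into U \<phi>))"

definition biholomorphic :: "'p cmanifold \<Rightarrow> 'q cmanifold \<Rightarrow> bool" where
  "biholomorphic M N \<longleftrightarrow>
    (\<exists>f. bij_betw f (points M) (points N) \<and> holomorphic_map M N f \<and>
         holomorphic_map N M (inv_into (points M) f))"


section \<open>Holomorphic line bundles and the bundle of lines in \<open>\<complex> \<oplus> \<xi>\<close>\<close>

text \<open>A line bundle consists of a total space, a projection, the vector space operations on the
  fibres and a bundle atlas. A local trivialisation over \<open>W\<close> is given by its fibre coordinate
  \<open>\<tau>\<close>, that is, it is the map \<open>v \<mapsto> (lb_proj v, \<tau> v)\<close>.\<close>

record ('p, 'q) line_bundle =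
  lb_total :: "'q set"
  lb_proj :: "'q \<Rightarrow> 'p"
  lb_add :: "'q \<Rightarrow> 'q \<Rightarrow> 'q"
  lb_scale :: "complex \<Rightarrow> 'q \<Rightarrow> 'q"
  lb_triv :: "('p set \<times> ('q \<Rightarrow> complex)) set"

definition lb_fibre :: "('p, 'q) line_bundle \<Rightarrow> 'p \<Rightarrow> 'q set" where
  "lb_fibre \<xi> x = {v \<in> lb_total \<xi>. lb_proj \<xi> v = x}"

text \<open>The vector space axioms for the fibres are not listed: they are transported from
  \<open>\<complex>\<close> by the linear bijections \<open>\<tau>\<close>. Likewise, transition functions are automatically
  nowhere zero.\<close>

definition holomorphic_line_bundle :: "'p cmanifold \<Rightarrow> ('p, 'q) line_bundle \<Rightarrow> bool" where
  "holomorphic_line_bundle M \<xi> \<longleftrightarrow>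
    lb_proj \<xi> ` lb_total \<xi> \<subseteq> points M \<and>
    (\<Union>(W, \<tau>)\<in>lb_triv \<xi>. W) = points M \<and>
    (\<forall>(W, \<tau>)\<in>lb_triv \<xi>. openin (mtopology M) W \<and>
      (\<forall>x\<in>W. bij_betw \<tau> (lb_fibre \<xi> x) UNIV \<and>
        (\<forall>v\<in>lb_fibre \<xi> x. \<forall>w\<in>lb_fibre \<xi> x.
           lb_add \<xi> v w \<in> lb_fibre \<xi> x \<and> \<tau> (lb_add \<xi> v w) = \<tau> v + \<tau> w) \<and>
        (\<forall>c. \<forall>v\<in>lb_fibre \<xi> x.
           lb_scale \<xi> c v \<in> lb_fibre \<xi> x \<and> \<tau> (lb_scale \<xi> c v) = c * \<tau> v))) \<and>
    (\<forall>(W, \<tau>)\<in>lb_triv \<xi>. \<forall>(W', \<tau>')\<in>lb_triv \<xi>. \<exists>g.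
      holomorphic_fun M (W \<inter> W') g \<and>
      (\<forall>x\<in>W \<inter> W'. \<forall>v\<in>lb_fibre \<xi> x. \<tau>' v = g x * \<tau> v))"

text \<open>Triviality: some global fibre coordinate is compatible with the bundle atlas.\<close>

definition trivial_line_bundle :: "'p cmanifold \<Rightarrow> ('p, 'q) line_bundle \<Rightarrow> bool" where
  "trivial_line_bundle M \<xi> \<longleftrightarrow> holomorphic_line_bundle M \<xi> \<and>
    (\<exists>\<tau>. holomorphic_line_bundle M (\<xi>\<lparr>lb_triv := insert (points M, \<tau>) (lb_triv \<xi>)\<rparr>))"

text \<open>Lines through the origin in the fibre of \<open>\<complex> \<oplus> \<xi>\<close> over \<open>x\<close>; the zero vector of the fibre
  of \<open>\<xi>\<close> is \<open>lb_scale \<xi> 0 v\<close>, for any \<open>v\<close> in that fibre.\<close>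

definition fibre_lines :: "('p, 'q) line_bundle \<Rightarrow> 'p \<Rightarrow> (complex \<times> 'q) set set" where
  "fibre_lines \<xi> x =
    {range (\<lambda>c. (c * a, lb_scale \<xi> c v)) | a v.
      v \<in> lb_fibre \<xi> x \<and> (a \<noteq> 0 \<or> v \<noteq> lb_scale \<xi> 0 v)}"

definition line_base :: "('p, 'q) line_bundle \<Rightarrow> (complex \<times> 'q) set \<Rightarrow> 'p" where
  "line_base \<xi> l = (THE x. \<forall>(a, v)\<in>l. lb_proj \<xi> v = x)"

text \<open>Over a chart \<open>(U, \<phi>)\<close> of the base and a local trivialisation \<open>(W, \<tau>)\<close> the two standard
  affine charts of \<open>\<complex>P(\<complex> \<oplus> \<xi>)\<close> have as last coordinate \<open>\<tau> v / a\<close> (on lines spanned by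
  \<open>(a, v)\<close> with \<open>a \<noteq> 0\<close>) and \<open>a / \<tau> v\<close> (where \<open>\<tau> v \<noteq> 0\<close>).\<close>

definition projectivization ::
    "'p cmanifold \<Rightarrow> ('p, 'q) line_bundle \<Rightarrow> (complex \<times> 'q) set cmanifold" where
  "projectivization M \<xi> =
    \<lparr>mdim = Suc (mdim M),
     atlas =
       {({l. \<exists>x\<in>U \<inter> W. l \<in> fibre_lines \<xi> x \<and> (\<exists>v. (1, v) \<in> l)},
         \<lambda>l. (\<phi> (line_base \<xi> l))(mdim M := (THE t. \<exists>v. (1, v) \<in> l \<and> \<tau> v = t)))
        | U \<phi> W \<tau>. (U, \<phi>) \<in> atlas M \<and> (W, \<tau>) \<in> lb_triv \<xi>} \<union>
       {({l. \<exists>x\<in>U \<inter> W. l \<in> fibre_lines \<xi> x \<and> (\<exists>a v. (a, v) \<in> l \<and> \<tau> v = 1)},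
         \<lambda>l. (\<phi> (line_base \<xi> l))(mdim M := (THE t. \<exists>v. (t, v) \<in> l \<and> \<tau> v = 1)))
        | U \<phi> W \<tau>. (U, \<phi>) \<in> atlas M \<and> (W, \<tau>) \<in> lb_triv \<xi>}\<rparr>"

text \<open>The tower is taken up to isomorphism: \<open>N (Suc k)\<close> is biholomorphic to the bundle of lines
  constructed from \<open>N k\<close>. Every line bundle over \<open>N k\<close> is isomorphic to one
  whose total space is a set of pairs \<open>(x, c)\<close>, since each fibre is in bijection with \<open>\<complex>\<close>;
  so fixing the type of the total spaces loses no generality.\<close>

definition bott_tower :: "nat \<Rightarrow> (nat \<Rightarrow> 'p cmanifold) \<Rightarrow> bool" where
  "bott_tower n N \<longleftrightarrow>
    (\<forall>k\<le>n. complex_manifold (N k)) \<and>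
    mdim (N 0) = 0 \<and> (\<exists>p. points (N 0) = {p}) \<and>
    (\<exists>\<xi> :: nat \<Rightarrow> ('p, 'p \<times> complex) line_bundle.
      trivial_line_bundle (N 0) (\<xi> 0) \<and>
      (\<forall>k<n. holomorphic_line_bundle (N k) (\<xi> k) \<and>
             biholomorphic (N (Suc k)) (projectivization (N k) (\<xi> k))))"


section \<open>Crosspolytopes and fans\<close>

inductive crosspolytope :: "nat \<Rightarrow> 'a::euclidean_space set \<Rightarrow> bool" where
  segment: "a \<noteq> b \<Longrightarrow> crosspolytope 1 (closed_segment a b)"
| step: "crosspolytope k P \<Longrightarrow>
    \<exists>z. rel_interior P \<inter> rel_interior (closed_segment a b) = {z} \<Longrightarrow>
    aff_dim (convex hull (P \<union> closed_segment a b)) = int (Suc k) \<Longrightarrow>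
    crosspolytope (Suc k) (convex hull (P \<union> closed_segment a b))"

definition spanned_fan :: "'a::euclidean_space set \<Rightarrow> 'a set set" where
  "spanned_fan P = insert {0} {conic hull F | F. F face_of P \<and> F \<noteq> P \<and> F \<noteq> {}}"

text \<open>Lattices are subgroups \<open>L\<close> of a Euclidean space, of full rank in the subspace \<open>span L\<close>.\<close>

definition lattice_basis :: "'a::euclidean_space set \<Rightarrow> 'a set \<Rightarrow> bool" where
  "lattice_basis L B \<longleftrightarrow> independent B \<and>
    L = {\<Sum>b\<in>B. of_int (c b) *\<^sub>R b | c :: 'a \<Rightarrow> int. True}"

definition fan :: "'a::euclidean_space set \<Rightarrow> 'a set set \<Rightarrow> bool" where
  "fan L \<Sigma> \<longleftrightarrow> finite \<Sigma> \<and> \<Sigma> \<noteq> {} \<and>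
    (\<forall>\<sigma>\<in>\<Sigma>. (\<exists>S. finite S \<and> S \<subseteq> L \<and> \<sigma> = convex_cone hull S) \<and> \<sigma> \<inter> uminus ` \<sigma> = {0}) \<and>
    (\<forall>\<sigma>\<in>\<Sigma>. \<forall>\<tau>. \<tau> face_of \<sigma> \<and> \<tau> \<noteq> {} \<longrightarrow> \<tau> \<in> \<Sigma>) \<and>
    (\<forall>\<sigma>\<in>\<Sigma>. \<forall>\<tau>\<in>\<Sigma>. \<sigma> \<inter> \<tau> face_of \<sigma> \<and> \<sigma> \<inter> \<tau> face_of \<tau>)"

definition smooth_fan :: "'a::euclidean_space set \<Rightarrow> 'a set set \<Rightarrow> bool" where
  "smooth_fan L \<Sigma> \<longleftrightarrow>
    (\<forall>\<sigma>\<in>\<Sigma>. \<exists>B S. lattice_basis L B \<and> S \<subseteq> B \<and> \<sigma> = convex_cone hull S)"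

definition ray_generator :: "'a::euclidean_space set \<Rightarrow> 'a set set \<Rightarrow> 'a \<Rightarrow> bool" where
  "ray_generator L \<Sigma> x \<longleftrightarrow> x \<in> L \<and> x \<noteq> 0 \<and> conic hull {x} \<in> \<Sigma> \<and>
    (\<forall>y\<in>L \<inter> conic hull {x}. \<exists>m::nat. y = of_nat m *\<^sub>R x)"

definition perp_proj :: "'a::euclidean_space \<Rightarrow> 'a \<Rightarrow> 'a" where
  "perp_proj x v = v - ((v \<bullet> x) / (x \<bullet> x)) *\<^sub>R x"

text \<open>All fans of the sequence live in one ambient space: the \<open>k\<close>-th fan lies in the span of its
  lattice \<open>L k\<close>, and \<open>x k\<close>, \<open>- x k\<close> is the pair of opposite generators chosen in the \<open>k\<close>-th fan.
  A pair of generators with sum \<open>0\<close> is necessarily an antipodal pair of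
  the spanning crosspolytope, since the segment between the two vertices meets the interior.\<close>

definition quotient_fan_sequence ::
    "nat \<Rightarrow> (nat \<Rightarrow> 'a::euclidean_space set) \<Rightarrow> (nat \<Rightarrow> 'a set set) \<Rightarrow> (nat \<Rightarrow> 'a) \<Rightarrow> bool" where
  "quotient_fan_sequence n L \<Sigma> x \<longleftrightarrow>
    (\<forall>k<n. ray_generator (L (Suc k)) (\<Sigma> (Suc k)) (x (Suc k)) \<and>
           ray_generator (L (Suc k)) (\<Sigma> (Suc k)) (- x (Suc k)) \<and>
           \<Sigma> k = {perp_proj (x (Suc k)) ` \<sigma> | \<sigma>. \<sigma> \<in> \<Sigma> (Suc k) \<and> conic hull {x (Suc k)} face_of \<sigma>} \<and>
           L k = perp_proj (x (Suc k)) ` L (Suc k))"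


section \<open>Toric varieties\<close>

text \<open>The dual of \<open>span L\<close> is identified with \<open>span L\<close> by means of the inner product.\<close>

definition dual_lattice :: "'a::euclidean_space set \<Rightarrow> 'a set" where
  "dual_lattice L = {m \<in> span L. \<forall>v\<in>L. m \<bullet> v \<in> \<int>}"

definition dual_monoid :: "'a::euclidean_space set \<Rightarrow> 'a set \<Rightarrow> 'a set" where
  "dual_monoid L \<sigma> = {m \<in> dual_lattice L. \<forall>v\<in>\<sigma>. 0 \<le> m \<bullet> v}"

text \<open>The complex points of the affine toric variety \<open>Spec \<complex>[\<sigma>\<^sup>\<or> \<inter> M]\<close> are the monoid homomorphisms
  from \<open>\<sigma>\<^sup>\<or> \<inter> M\<close> to the multiplicative monoid of \<open>\<complex>\<close>.\<close>

definition affine_toric :: "'a::euclidean_space set \<Rightarrow> 'a set \<Rightarrow> ('a \<Rightarrow> complex) set" where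
  "affine_toric L \<sigma> = {\<gamma> \<in> extensional (dual_monoid L \<sigma>).
    \<gamma> 0 = 1 \<and> (\<forall>m\<in>dual_monoid L \<sigma>. \<forall>m'\<in>dual_monoid L \<sigma>. \<gamma> (m + m') = \<gamma> m * \<gamma> m')}"

text \<open>The affine pieces of \<open>\<sigma>\<close> and \<open>\<sigma>'\<close> are glued along that of \<open>\<sigma> \<inter> \<sigma>'\<close>.\<close>

definition toric_glue :: "'a::euclidean_space set \<Rightarrow> 'a set set \<Rightarrow>
    (('a set \<times> ('a \<Rightarrow> complex)) \<times> ('a set \<times> ('a \<Rightarrow> complex))) set" where
  "toric_glue L \<Sigma> = {((\<sigma>, \<gamma>), (\<sigma>', \<gamma>')). \<sigma> \<in> \<Sigma> \<and> \<sigma>' \<in> \<Sigma> \<and>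
    (\<exists>\<delta>\<in>affine_toric L (\<sigma> \<inter> \<sigma>').
       \<gamma> = restrict \<delta> (dual_monoid L \<sigma>) \<and> \<gamma>' = restrict \<delta> (dual_monoid L \<sigma>'))}"

type_synonym 'a toric_point = "('a set \<times> ('a \<Rightarrow> complex)) set"

definition toric_points :: "'a::euclidean_space set \<Rightarrow> 'a set set \<Rightarrow> 'a toric_point set" where
  "toric_points L \<Sigma> = (SIGMA \<sigma>:\<Sigma>. affine_toric L \<sigma>) // toric_glue L \<Sigma>"

definition toric_piece ::
    "'a::euclidean_space set \<Rightarrow> 'a set set \<Rightarrow> 'a set \<Rightarrow> 'a toric_point set" where
  "toric_piece L \<Sigma> \<sigma> = {p \<in> toric_points L \<Sigma>. \<exists>\<gamma>. (\<sigma>, \<gamma>) \<in> p}"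

text \<open>The value of the character \<open>\<chi>\<^sup>m\<close> at a point of the affine piece of \<open>\<sigma>\<close>.\<close>

definition toric_value :: "'a set \<Rightarrow> 'a toric_point \<Rightarrow> 'a \<Rightarrow> complex" where
  "toric_value \<sigma> p m = (THE \<gamma>. (\<sigma>, \<gamma>) \<in> p) m"

text \<open>The toric variety of a smooth fan as a complex manifold. If \<open>\<sigma>\<close> is generated by the first \<open>j\<close>
  elements of an ordered lattice basis \<open>u\<close> with dual basis \<open>m\<close>, then the characters of the \<open>m i\<close>
  identify the affine piece of \<open>\<sigma>\<close> with \<open>\<complex>\<^sup>j \<times> (\<complex>\<^sup>*)\<^bsup>d-j\<^esup>\<close>.\<close>

definition toric_manifold ::
    "'a::euclidean_space set \<Rightarrow> 'a set set \<Rightarrow> 'a toric_point cmanifold" where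
  "toric_manifold L \<Sigma> =
    \<lparr>mdim = dim L,
     atlas = {(toric_piece L \<Sigma> \<sigma>, \<lambda>p i. if i < dim L then toric_value \<sigma> p (m i) else 0)
       | \<sigma> m. \<sigma> \<in> \<Sigma> \<and> (\<exists>(u :: nat \<Rightarrow> 'a) j.
           inj_on u {..<dim L} \<and> lattice_basis L (u ` {..<dim L}) \<and>
           j \<le> dim L \<and> \<sigma> = convex_cone hull (u ` {..<j}) \<and>
           (\<forall>i<dim L. m i \<in> dual_lattice L \<and>
             (\<forall>i'<dim L. m i \<bullet> u i' = (if i = i' then 1 else 0))))}\<rparr>"


section \<open>Projectivity\<close>

text \<open>The Zariski topology and the regular functions of a variety are both encoded by a set of
  pairs \<open>(D, g)\<close>, where the sets \<open>D\<close> are basic open sets and \<open>g\<close> is one of the quotients that are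
  regular on \<open>D\<close>; regular functions are those which locally agree with such quotients.\<close>

definition zariski :: "('x set \<times> ('x \<Rightarrow> complex)) set \<Rightarrow> 'x topology" where
  "zariski B = topology_generated_by (fst ` B)"

definition regular_on ::
    "('x set \<times> ('x \<Rightarrow> complex)) set \<Rightarrow> 'x set \<Rightarrow> ('x \<Rightarrow> complex) \<Rightarrow> bool" where
  "regular_on B U f \<longleftrightarrow> (\<forall>p\<in>U. \<exists>(D, g)\<in>B. p \<in> D \<and> (\<forall>q\<in>U \<inter> D. f q = g q))"

definition variety_iso :: "('x set \<times> ('x \<Rightarrow> complex)) set \<Rightarrow>
    ('y set \<times> ('y \<Rightarrow> complex)) set \<Rightarrow> ('x \<Rightarrow> 'y) \<Rightarrow> bool" where
  "variety_iso B B' f \<longleftrightarrow> homeomorphic_map (zariski B) (zariski B') f \<and>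
    (\<forall>V g. openin (zariski B') V \<longrightarrow>
      (regular_on B' V g \<longleftrightarrow> regular_on B {p \<in> topspace (zariski B). f p \<in> V} (g \<circ> f)))"

definition toric_coord_ring :: "'a::euclidean_space set \<Rightarrow> 'a set \<Rightarrow> ('a toric_point \<Rightarrow> complex) set" where
  "toric_coord_ring L \<sigma> =
    {\<lambda>p. \<Sum>m\<in>A. c m * toric_value \<sigma> p m | A c. finite A \<and> A \<subseteq> dual_monoid L \<sigma>}"

definition toric_variety :: "'a::euclidean_space set \<Rightarrow> 'a set set \<Rightarrow>
    ('a toric_point set \<times> ('a toric_point \<Rightarrow> complex)) set" where
  "toric_variety L \<Sigma> = {({p \<in> toric_piece L \<Sigma> \<sigma>. b p \<noteq> 0}, \<lambda>p. a p / b p) | \<sigma> a b.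
    \<sigma> \<in> \<Sigma> \<and> a \<in> toric_coord_ring L \<sigma> \<and> b \<in> toric_coord_ring L \<sigma>}"

definition homogeneous_poly :: "nat \<Rightarrow> nat \<Rightarrow> ((nat \<Rightarrow> complex) \<Rightarrow> complex) set" where
  "homogeneous_poly r d = {\<lambda>z. \<Sum>\<alpha>\<in>A. c \<alpha> * (\<Prod>i\<le>r. z i ^ \<alpha> i) | (A :: (nat \<Rightarrow> nat) set) c.
    finite A \<and> (\<forall>\<alpha>\<in>A. (\<Sum>i\<le>r. \<alpha> i) = d)}"

text \<open>Points of projective \<open>r\<close>-space are lines through the origin in \<open>\<complex>\<^bsup>r+1\<^esup>\<close>.\<close>

definition proj_points :: "nat \<Rightarrow> (nat \<Rightarrow> complex) set set" where
  "proj_points r = {range (\<lambda>c i. c * z i) | z. z \<in> Cspace (Suc r) \<and> z \<noteq> (\<lambda>i. 0)}"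

definition proj_variety ::
    "nat \<Rightarrow> ((nat \<Rightarrow> complex) set set \<times> ((nat \<Rightarrow> complex) set \<Rightarrow> complex)) set" where
  "proj_variety r = {({l \<in> proj_points r. \<exists>z\<in>l. h z \<noteq> 0},
      \<lambda>l. THE t. \<exists>z\<in>l. h z \<noteq> 0 \<and> t = g z / h z) | d g h.
    g \<in> homogeneous_poly r d \<and> h \<in> homogeneous_poly r d}"

definition projective_fan :: "'a::euclidean_space set \<Rightarrow> 'a set set \<Rightarrow> bool" where
  "projective_fan L \<Sigma> \<longleftrightarrow>
    (\<exists>r Z f. closedin (zariski (proj_variety r)) Z \<and>
      variety_iso (toric_variety L \<Sigma>) ((\<lambda>(D, g). (D \<inter> Z, g)) ` proj_variety r) f)"

end

theory Submission
  imports Defs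
begin

text \<open>
  The fan is recorded by the simplicial complex of the generator sets of its cones; for a fan spanned
  by a crosspolytope any two vertices without common edge are suspension points of this complex, and
  this property passes to the quotient fans. If \<open>x\<close> and \<open>- x\<close> are generators of \<open>\<Sigma>\<^sup>k\<^sup>+\<^sup>1\<close>, then every
  maximal cone contains exactly one of them. For a maximal cone generated by \<open>S\<close> with \<open>x \<in> S\<close> let \<open>e\<^sub>S\<close> be
  the dual basis vector of \<open>x\<close>. The differences \<open>e\<^sub>T - e\<^sub>S\<close> are orthogonal to \<open>x\<close> and to the common
  generators of \<open>S\<close> and \<open>T\<close>, so their characters are units on the overlaps of the corresponding
  pieces of \<open>X\<^sup>k\<close> and form the cocycle of a line bundle \<open>\<xi>\<close>. The point of \<open>X\<^sup>k\<^sup>+\<^sup>1\<close> over \<open>b\<close> whose value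
  under the character of \<open>e\<^sub>S\<close> is \<open>t\<close> corresponds to the line spanned by \<open>(1, t)\<close> in the fibre of \<open>\<complex> \<oplus> \<xi>\<close>
  over \<open>b\<close>, and the chart on the piece of the opposite cone, containing \<open>- x\<close>, supplies the line with
  \<open>t = \<infinity>\<close>. All coordinate changes are Laurent monomials.
\<close>

subsection \<open>Holomorphic functions on open subsets of the model space\<close>

text \<open>Two features of the setting carry the proof. First, the quotient is taken by orthogonal
  projection, so the dual lattice of the base is literally the set of characters orthogonal to
  \<open>x\<close>: the projection of toric varieties is restriction of monoid homomorphisms, and
  base and total space are compared by the values of the same characters. Second, a smooth cone
  determines its primitive generators, so a fan may be replaced by its complex of generator sets,
  and faces, intersections and wall crossings become finite combinatorics. The line bundle needs a
  total space made of pairs \<open>(b, c)\<close>. It is built as a product, with a reference cone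
  chosen separately for each point \<open>b\<close>. This choice need not be continuous; the
  holomorphic structure sits in the trivialisations, which convert from the reference coordinate to
  that of a fixed cone. For the biholomorphism it is enough that each chart of the bundle of lines
  pulls back to a monomial chart. The complexes descend from the given fan to the point, whereas the
  exchange property, and with it the Hausdorff axiom, is lifted from the point back to the
  top.\<close>

definition cderiv ::
    "nat \<Rightarrow> (nat \<Rightarrow> complex) set \<Rightarrow> ((nat \<Rightarrow> complex) \<Rightarrow> complex) \<Rightarrow> (nat \<Rightarrow> complex) \<Rightarrow> (nat \<Rightarrow> complex) \<Rightarrow> bool"
  where "cderiv k U f D z \<longleftrightarrow>
    ((\<lambda>w. (f w - f z - (\<Sum>i<k. D i * (w i - z i))) / complex_of_real (\<Sum>i<k. norm (w i - z i)))
        \<longlongrightarrow> 0) (at z within U)"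

lemma holo_on_cderiv:
  "holo_on k U f \<longleftrightarrow> openin (top_of_set (Cspace k)) U \<and> (\<forall>z\<in>U. \<exists>D. cderiv k U f D z)"
  by (simp add: holo_on_def cderiv_def)

lemma tendsto_coordinate_within: "((\<lambda>w. w i) \<longlongrightarrow> z i) (at z within U)" for z :: "nat \<Rightarrow> complex"
proof -
  have "continuous_on UNIV (\<lambda>w :: nat \<Rightarrow> complex. w i)" by simp
  then show ?thesis
    unfolding continuous_on_def using tendsto_within_subset by blast
qed

text \<open>Points of the model space vanish from index \<open>k\<close> on, so the truncated sum of
  norms already separates them. This keeps the denominators in \<open>cderiv\<close> nonzero away
  from \<open>z\<close>.\<close>

lemma l1_pos:
  assumes "w \<in> Cspace k" "z \<in> Cspace k" "w \<noteq> z"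
  shows "0 < (\<Sum>i<k. norm (w i - z i))"
proof -
  obtain i where i: "w i \<noteq> z i" using assms(3) by auto
  have "i < k"
  proof (rule ccontr)
    assume "\<not> i < k"
    then show False using i assms(1,2) by (simp add: Cspace_def)
  qed
  then show ?thesis using i by (intro sum_pos2[of _ i]) auto
qed

lemma l1_tendsto_0: "((\<lambda>w. \<Sum>i<k. norm (w i - z i)) \<longlongrightarrow> 0) (at z within U)" for z :: "nat \<Rightarrow> complex"
proof -
  have "((\<lambda>w. \<Sum>i<k. norm (w i - z i)) \<longlongrightarrow> (\<Sum>i<k. norm (z i - z i))) (at z within U)"
    by (intro tendsto_sum tendsto_norm tendsto_diff tendsto_coordinate_within tendsto_const)
  then show ?thesis by simp
qed

text \<open>The remainder quotient is eventually below 1, and the linear part contributes at most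
  the sum of the coefficient norms. Boundedness lets a factor tending to 0 absorb a difference
  quotient in the product and inverse rules.\<close>

lemma cderiv_quotient_bounded:
  assumes "cderiv k U f D z"
  shows "\<forall>\<^sub>F w in at z within U.
    norm ((f w - f z) / complex_of_real (\<Sum>i<k. norm (w i - z i))) \<le> 1 + (\<Sum>i<k. norm (D i))"
proof -
  let ?N = "\<lambda>w. \<Sum>i<k. norm (w i - z i)"
  have "\<forall>\<^sub>F w in at z within U.
      norm ((f w - f z - (\<Sum>i<k. D i * (w i - z i))) / complex_of_real (?N w)) < 1"
    using order_tendstoD(2)[OF tendsto_norm_zero[OF assms[unfolded cderiv_def]] zero_less_one] .
  then show ?thesis
  proof (rule eventually_mono)
    fix w
    assume lt: "norm ((f w - f z - (\<Sum>i<k. D i * (w i - z i))) / complex_of_real (?N w)) < 1"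
    have N: "0 \<le> ?N w" by (simp add: sum_nonneg)
    have "norm (\<Sum>i<k. D i * (w i - z i)) \<le> (\<Sum>i<k. norm (D i) * norm (w i - z i))"
      by (rule order_trans[OF norm_sum]) (simp add: norm_mult)
    also have "\<dots> \<le> (\<Sum>i<k. norm (D i) * ?N w)"
      by (intro sum_mono mult_left_mono member_le_sum) auto
    finally have *: "norm (\<Sum>i<k. D i * (w i - z i)) \<le> (\<Sum>i<k. norm (D i)) * ?N w"
      by (simp add: sum_distrib_right)
    have D: "norm ((\<Sum>i<k. D i * (w i - z i)) / complex_of_real (?N w)) \<le> (\<Sum>i<k. norm (D i))"
    proof (cases "?N w = 0")
      case True
      then show ?thesis by (simp add: sum_nonneg)
    next
      case False
      then show ?thesis using * N by (simp add: norm_divide divide_le_eq del: of_real_sum)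
    qed
    have "(f w - f z) / complex_of_real (?N w) =
        (f w - f z - (\<Sum>i<k. D i * (w i - z i))) / complex_of_real (?N w) +
        (\<Sum>i<k. D i * (w i - z i)) / complex_of_real (?N w)"
      by (simp add: diff_divide_distrib)
    then show "norm ((f w - f z) / complex_of_real (?N w)) \<le> 1 + (\<Sum>i<k. norm (D i))"
      using norm_triangle_le[of "(f w - f z - (\<Sum>i<k. D i * (w i - z i))) / complex_of_real (?N w)"
          "(\<Sum>i<k. D i * (w i - z i)) / complex_of_real (?N w)"] lt D by simp
  qed
qed

text \<open>The increment is the norm times the difference quotient: a null factor times a bounded
  one.\<close>

lemma cderiv_tendsto:
  assumes f: "cderiv k U f D z" and U: "U \<subseteq> Cspace k" and z: "z \<in> U"
  shows "(f \<longlongrightarrow> f z) (at z within U)"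
proof -
  let ?N = "\<lambda>w. complex_of_real (\<Sum>i<k. norm (w i - z i))"
  have "(?N \<longlongrightarrow> of_real 0) (at z within U)"
    by (intro tendsto_of_real l1_tendsto_0)
  then have "((\<lambda>w. ?N w * ((f w - f z) / ?N w)) \<longlongrightarrow> 0) (at z within U)"
    using lim_null_mult_right_bounded[OF _ cderiv_quotient_bounded[OF f]]
    by (simp only: of_real_0)
  moreover have "\<forall>\<^sub>F w in at z within U. ?N w * ((f w - f z) / ?N w) = f w - f z"
    unfolding eventually_at_filter
  proof (intro always_eventually allI impI)
    fix w assume "w \<noteq> z" "w \<in> U"
    then have "?N w \<noteq> 0" using l1_pos[of w k z] U z by (metis of_real_eq_0_iff less_irrefl subsetD)
    then show "?N w * ((f w - f z) / ?N w) = f w - f z" by simp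
  qed
  ultimately have "((\<lambda>w. f w - f z) \<longlongrightarrow> 0) (at z within U)"
    by (rule Lim_transform_eventually)
  then show ?thesis by (simp add: LIM_zero_iff)
qed

lemma holo_on_continuous_on:
  assumes "holo_on k U f"
  shows "continuous_on U f"
  unfolding continuous_on_def
proof
  fix z assume z: "z \<in> U"
  obtain D where "cderiv k U f D z" using assms z unfolding holo_on_cderiv by blast
  then show "(f \<longlongrightarrow> f z) (at z within U)"
    using assms z by (auto simp: holo_on_def dest: openin_imp_subset intro: cderiv_tendsto)
qed

lemma holo_on_const:
  assumes "openin (top_of_set (Cspace k)) U"
  shows "holo_on k U (\<lambda>z. c)"
proof -
  have "cderiv k U (\<lambda>z. c) (\<lambda>i. 0) z" for z by (simp add: cderiv_def)
  then show ?thesis using assms unfolding holo_on_cderiv by blast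
qed

lemma holo_on_coordinate:
  assumes "openin (top_of_set (Cspace k)) U" "j < k"
  shows "holo_on k U (\<lambda>z. z j)"
proof -
  have "(\<Sum>i<k. (if i = j then 1 else 0) * (w i - z i)) = w j - z j" for w z :: "nat \<Rightarrow> complex"
    using assms(2) by (simp add: if_distrib[of "\<lambda>x. x * _"] sum.delta cong: if_cong)
  then have "cderiv k U (\<lambda>z. z j) (\<lambda>i. if i = j then 1 else 0) z" for z by (simp add: cderiv_def)
  then show ?thesis using assms(1) unfolding holo_on_cderiv by blast
qed

lemma holo_on_mult:
  assumes f: "holo_on k U f" and g: "holo_on k U g"
  shows "holo_on k U (\<lambda>z. f z * g z)"
  unfolding holo_on_cderiv
proof (intro conjI ballI)
  show U: "openin (top_of_set (Cspace k)) U" using f by (simp add: holo_on_def)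
  fix z assume z: "z \<in> U"
  obtain D E where D: "cderiv k U f D z" and E: "cderiv k U g E z"
    using f g z unfolding holo_on_cderiv by blast
  let ?N = "\<lambda>w. complex_of_real (\<Sum>i<k. norm (w i - z i))"
  let ?rf = "\<lambda>w. (f w - f z - (\<Sum>i<k. D i * (w i - z i))) / ?N w"
  let ?rg = "\<lambda>w. (g w - g z - (\<Sum>i<k. E i * (w i - z i))) / ?N w"
  have g0: "((\<lambda>w. g w - g z) \<longlongrightarrow> 0) (at z within U)"
    using cderiv_tendsto[OF E openin_imp_subset[OF U] z] by (simp add: LIM_zero_iff)
  \<comment> \<open>The increment of the product is \<open>g z\<close> times that of
    \<open>f\<close>, plus \<open>f z\<close> times that of \<open>g\<close>, plus the product of
    both increments, which after division is a null factor times a bounded quotient.\<close>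
  have "((\<lambda>w. g z * ?rf w + f z * ?rg w + (g w - g z) * ((f w - f z) / ?N w)) \<longlongrightarrow> g z * 0 + f z * 0 + 0)
      (at z within U)"
    using D E lim_null_mult_right_bounded[OF g0 cderiv_quotient_bounded[OF D]]
    unfolding cderiv_def by (intro tendsto_add tendsto_mult tendsto_const) auto
  moreover have "g z * ?rf w + f z * ?rg w + (g w - g z) * ((f w - f z) / ?N w) =
      (f w * g w - f z * g z - (\<Sum>i<k. (g z * D i + f z * E i) * (w i - z i))) / ?N w" for w
  proof -
    have "(\<Sum>i<k. (g z * D i + f z * E i) * (w i - z i)) =
        g z * (\<Sum>i<k. D i * (w i - z i)) + f z * (\<Sum>i<k. E i * (w i - z i))"
      by (simp add: sum_distrib_left sum.distrib[symmetric] algebra_simps)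
    then show ?thesis
      by (simp only: times_divide_eq_right add_divide_distrib[symmetric]) (simp add: algebra_simps)
  qed
  ultimately have "cderiv k U (\<lambda>z. f z * g z) (\<lambda>i. g z * D i + f z * E i) z"
    unfolding cderiv_def by simp
  then show "\<exists>D. cderiv k U (\<lambda>z. f z * g z) D z" by blast
qed

lemma holo_on_inverse:
  assumes f: "holo_on k U f" and nz: "\<And>z. z \<in> U \<Longrightarrow> f z \<noteq> 0"
  shows "holo_on k U (\<lambda>z. inverse (f z))"
  unfolding holo_on_cderiv
proof (intro conjI ballI)
  show U: "openin (top_of_set (Cspace k)) U" using f by (simp add: holo_on_def)
  fix z assume z: "z \<in> U"
  obtain D where D: "cderiv k U f D z"
    using f z unfolding holo_on_cderiv by blast
  let ?N = "\<lambda>w. complex_of_real (\<Sum>i<k. norm (w i - z i))"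
  let ?rf = "\<lambda>w. (f w - f z - (\<Sum>i<k. D i * (w i - z i))) / ?N w"
  have fz: "(f \<longlongrightarrow> f z) (at z within U)"
    by (rule cderiv_tendsto[OF D openin_imp_subset[OF U] z])
  have nz': "f z \<noteq> 0" by (rule nz[OF z])
  have "((\<lambda>w. (f w - f z) / (f w * (f z)\<^sup>2)) \<longlongrightarrow> (f z - f z) / (f z * (f z)\<^sup>2)) (at z within U)"
    using nz' by (intro tendsto_intros fz) auto
  then have 0: "((\<lambda>w. (f w - f z) / (f w * (f z)\<^sup>2)) \<longlongrightarrow> 0) (at z within U)" by simp
  \<comment> \<open>From 1/u - 1/v = -(u - v)/v^2 + (u - v)^2/(u v^2) with u = \<open>f w\<close>
    and v = \<open>f z\<close>; the last term is again null times bounded.\<close>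
  have "((\<lambda>w. - ?rf w / (f z)\<^sup>2 + (f w - f z) / (f w * (f z)\<^sup>2) * ((f w - f z) / ?N w)) \<longlongrightarrow> - 0 / (f z)\<^sup>2 + 0)
      (at z within U)"
    using D lim_null_mult_right_bounded[OF 0 cderiv_quotient_bounded[OF D]] nz'
    unfolding cderiv_def by (intro tendsto_add tendsto_divide tendsto_minus tendsto_const) auto
  moreover have "\<forall>\<^sub>F w in at z within U.
      - ?rf w / (f z)\<^sup>2 + (f w - f z) / (f w * (f z)\<^sup>2) * ((f w - f z) / ?N w) =
      (inverse (f w) - inverse (f z) - (\<Sum>i<k. (- D i / (f z)\<^sup>2) * (w i - z i))) / ?N w"
    unfolding eventually_at_filter
  proof (intro always_eventually allI impI)
    fix w assume "w \<noteq> z" "w \<in> U"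
    then have nw: "f w \<noteq> 0" using nz by auto
    let ?S = "\<Sum>i<k. D i * (w i - z i)"
    have frac: "- (x / N) / s + y * (d / N) = (- x / s + y * d) / N" for x N s y d :: complex
      by (simp add: add_divide_distrib diff_divide_distrib mult.commute)
    have *: "(\<Sum>i<k. (- D i / (f z)\<^sup>2) * (w i - z i)) = - ?S / (f z)\<^sup>2"
      by (simp add: sum_divide_distrib sum_negf)
    have "- ?rf w / (f z)\<^sup>2 + (f w - f z) / (f w * (f z)\<^sup>2) * ((f w - f z) / ?N w) =
      (- (f w - f z - ?S) / (f z)\<^sup>2 + (f w - f z) / (f w * (f z)\<^sup>2) * (f w - f z)) / ?N w"
      by (rule frac)
    also have "- (f w - f z - ?S) / (f z)\<^sup>2 + (f w - f z) / (f w * (f z)\<^sup>2) * (f w - f z)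
        = inverse (f w) - inverse (f z) - (- ?S / (f z)\<^sup>2)"
      using nz' nw by (simp add: field_simps power2_eq_square)
    finally show "- ?rf w / (f z)\<^sup>2 + (f w - f z) / (f w * (f z)\<^sup>2) * ((f w - f z) / ?N w) =
      (inverse (f w) - inverse (f z) - (\<Sum>i<k. (- D i / (f z)\<^sup>2) * (w i - z i))) / ?N w"
      unfolding * .
  qed
  ultimately have "cderiv k U (\<lambda>z. inverse (f z)) (\<lambda>i. - D i / (f z)\<^sup>2) z"
    unfolding cderiv_def by (auto intro: Lim_transform_eventually)
  then show "\<exists>D. cderiv k U (\<lambda>z. inverse (f z)) D z" by blast
qed

lemma holo_on_power:
  assumes "holo_on k U f"
  shows "holo_on k U (\<lambda>z. f z ^ n)"
proof (induction n)
  case 0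
  then show ?case using assms holo_on_const by (simp add: holo_on_def)
next
  case (Suc n)
  then show ?case using holo_on_mult[OF assms Suc] by simp
qed

lemma holo_on_power_int:
  assumes "holo_on k U f" and "\<And>z. n < 0 \<Longrightarrow> z \<in> U \<Longrightarrow> f z \<noteq> 0"
  shows "holo_on k U (\<lambda>z. f z powi n)"
proof (cases "n < 0")
  case True
  then show ?thesis
    using assms holo_on_power[OF holo_on_inverse[OF assms(1)], of "nat (- n)"] by (simp add: power_int_def)
next
  case False
  then show ?thesis using holo_on_power[OF assms(1), of "nat n"] by (simp add: power_int_def)
qed

lemma holo_on_prod:
  assumes "finite I" "openin (top_of_set (Cspace k)) U" "\<And>i. i \<in> I \<Longrightarrow> holo_on k U (f i)"
  shows "holo_on k U (\<lambda>z. \<Prod>i\<in>I. f i z)"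
  using assms by (induction I) (auto intro: holo_on_const holo_on_mult)

lemma holo_on_cong:
  assumes "holo_on k U f" "\<And>z. z \<in> U \<Longrightarrow> f z = g z"
  shows "holo_on k U g"
proof -
  have "cderiv k U g D z" if "cderiv k U f D z" "z \<in> U" for D z
    using that(1) unfolding cderiv_def
    by (rule Lim_transform_eventually) (auto simp: eventually_at_filter assms(2) that(2))
  then show ?thesis using assms(1) unfolding holo_on_cderiv by blast
qed

text \<open>Only a negative exponent forces a coordinate to be nonzero. Every character is such a
  monomial in toric coordinates, so this settles the holomorphy of all coordinate changes.\<close>

lemma holo_on_monomial:
  assumes "openin (top_of_set (Cspace k)) U"
    and "\<And>z i. z \<in> U \<Longrightarrow> i < k \<Longrightarrow> a i < 0 \<Longrightarrow> z i \<noteq> 0"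
  shows "holo_on k U (\<lambda>z. \<Prod>i<k. z i powi a i)"
  using assms by (intro holo_on_prod holo_on_power_int holo_on_coordinate) auto

text \<open>Images of toric charts have this form: some coordinates are free, the others
  nonzero.\<close>

lemma openin_Cspace_nonzero: "openin (top_of_set (Cspace k)) {z \<in> Cspace k. \<forall>i<k. P i \<longrightarrow> z i \<noteq> 0}"
proof -
  have "open (\<Inter>i\<in>{i. i < k \<and> P i}. {z :: nat \<Rightarrow> complex. z i \<noteq> 0})"
    by (intro open_INT ballI open_Collect_neq) (auto intro: continuous_intros)
  moreover have "{z \<in> Cspace k. \<forall>i<k. P i \<longrightarrow> z i \<noteq> 0} =
      Cspace k \<inter> (\<Inter>i\<in>{i. i < k \<and> P i}. {z. z i \<noteq> 0})"
    by auto
  ultimately show ?thesis by (simp add: openin_open_Int)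
qed

lemma holo_map_continuous_on:
  assumes "holo_map k U l f"
  shows "continuous_on U f"
proof (rule continuous_on_coordinatewise_then_product)
  fix j
  show "continuous_on U (\<lambda>z. f z j)"
  proof (cases "j < l")
    case True
    then show ?thesis using assms by (auto simp: holo_map_def intro: holo_on_continuous_on)
  next
    case False
    then have "f z j = 0" if "z \<in> U" for z
      using assms that by (auto simp: holo_map_def Cspace_def image_subset_iff)
    then show ?thesis by (simp add: continuous_on_cong[of U U _ "\<lambda>z. 0"])
  qed
qed

subsection \<open>Faces of crosspolytopes\<close>

text \<open>The functional is the component of \<open>a - z\<close> orthogonal to the directions of
  the affine hull.\<close>

lemma exists_orthogonal_separating:
  fixes a z :: "'a::euclidean_space"
  assumes "z \<in> affine hull P" "a \<notin> affine hull P"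
  obtains e where "\<And>p. p \<in> P \<Longrightarrow> e \<bullet> p = e \<bullet> z" "e \<bullet> a \<noteq> e \<bullet> z"
proof -
  let ?S = "(\<lambda>p. p - z) ` P"
  obtain y e where y: "y \<in> span ?S" and e: "\<And>w. w \<in> span ?S \<Longrightarrow> orthogonal e w" and aye: "a - z = y + e"
    using orthogonal_subspace_decomp_exists[of ?S "a - z"] by metis
  have "P \<noteq> {}" using assms(1) by auto
  have "affine hull P = (\<lambda>x. z + x) ` span ?S"
  proof -
    have "affine hull P = affine hull (insert z P)"
      using assms(1) by (simp add: hull_redundant)
    also have "\<dots> = {z + v | v. v \<in> span ((\<lambda>p. - z + p) ` (insert z P - {z}))}"
      using affine_hull_span2[of z "insert z P"] by (auto simp: image_iff)
    also have "span ((\<lambda>p. - z + p) ` (insert z P - {z})) = span ?S"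
    proof -
      have "insert 0 ((\<lambda>p. - z + p) ` (insert z P - {z})) = insert 0 ?S" by (auto simp: image_iff)
      then show ?thesis by (metis span_insert_0)
    qed
    finally show ?thesis by blast
  qed
  then have "a - z \<notin> span ?S" using assms(2) by (metis add_diff_cancel_left' imageI add.commute diff_add_cancel)
  then have "e \<noteq> 0" using y aye by auto
  have "e \<bullet> (a - z) = e \<bullet> e"
    using e[OF y] aye by (simp add: orthogonal_def inner_add_right)
  with \<open>e \<noteq> 0\<close> have "e \<bullet> a \<noteq> e \<bullet> z" by (metis inner_diff_right inner_eq_zero_iff right_minus_eq)
  moreover have "e \<bullet> p = e \<bullet> z" if "p \<in> P" for p
    using e[of "p - z"] that by (simp add: orthogonal_def inner_diff_right span_base)
  ultimately show thesis using that by blast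
qed

text \<open>The pairs \<open>v\<close>, \<open>\<iota> v\<close> are the pairs of vertices that are not joined by an edge.\<close>

definition crosspolytope_vertices ::
    "nat \<Rightarrow> 'a::euclidean_space set \<Rightarrow> 'a set \<Rightarrow> ('a \<Rightarrow> 'a) \<Rightarrow> bool" where
  "crosspolytope_vertices k P V \<iota> \<longleftrightarrow>
    finite V \<and> card V = 2 * k \<and> P = convex hull V \<and> aff_dim P = int k \<and>
    (\<forall>v\<in>V. \<iota> v \<in> V \<and> \<iota> v \<noteq> v \<and> \<iota> (\<iota> v) = v) \<and>
    (\<forall>A\<subseteq>V. (\<forall>v\<in>A. \<iota> v \<notin> A) \<longrightarrow> (\<exists>c d. (\<forall>v\<in>A. c \<bullet> v = d) \<and> (\<forall>v\<in>V - A. c \<bullet> v < d))) \<and>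
    (\<forall>F v. F face_of P \<longrightarrow> v \<in> V \<longrightarrow> v \<in> F \<longrightarrow> \<iota> v \<in> F \<longrightarrow> F = P)"

lemma crosspolytope_vertices_segment:
  fixes a b :: "'a::euclidean_space"
  assumes "a \<noteq> b"
  shows "crosspolytope_vertices 1 (closed_segment a b) {a, b} (\<lambda>v. if v = a then b else a)"
  unfolding crosspolytope_vertices_def
proof (intro conjI allI impI)
  show "closed_segment a b = convex hull {a, b}" by (rule segment_convex_hull)
  show "aff_dim (closed_segment a b) = int 1"
    using assms by (simp add: segment_convex_hull aff_dim_convex_hull aff_dim_2)
  fix A assume A: "A \<subseteq> {a, b}" "\<forall>v\<in>A. (if v = a then b else a) \<notin> A"
  have lt: "(v - w) \<bullet> w < (v - w) \<bullet> v" if "v \<noteq> w" for v w :: 'a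
    using that by (metis inner_diff_right inner_gt_zero_iff right_minus_eq diff_gt_0_iff_gt)
  from A assms consider "A = {}" | "A = {a}" | "A = {b}" by fastforce
  then show "\<exists>c d. (\<forall>v\<in>A. c \<bullet> v = d) \<and> (\<forall>v\<in>{a, b} - A. c \<bullet> v < d)"
  proof cases
    case 1
    then show ?thesis by (intro exI[of _ 0] exI[of _ 1]) auto
  next
    case 2
    then show ?thesis using lt[OF assms] by (intro exI[of _ "a - b"] exI[of _ "(a - b) \<bullet> a"]) auto
  next
    case 3
    then show ?thesis
      using lt[OF assms[symmetric]] by (intro exI[of _ "b - a"] exI[of _ "(b - a) \<bullet> b"]) auto
  qed
next
  fix F v
  assume F: "F face_of closed_segment a b" "v \<in> {a, b}" "v \<in> F" "(if v = a then b else a) \<in> F"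
  then have "a \<in> F" "b \<in> F" using assms by auto
  then show "F = closed_segment a b"
    using F(1) by (meson antisym closed_segment_subset face_of_imp_convex face_of_imp_subset)
qed (use assms in auto)

text \<open>The dimension count keeps \<open>a\<close> and \<open>b\<close> from both lying in the
  affine hull of \<open>P\<close>; as \<open>z\<close> lies in that hull and strictly between them,
  neither does. A face with an antipodal pair contains \<open>z\<close>: through \<open>P\<close> if
  the pair is old, through the segment if the pair is \<open>a\<close>, \<open>b\<close>. Since
  \<open>z\<close> is relatively interior to both \<open>P\<close> and the segment, the face then
  contains the other one too.\<close>

lemma crosspolytope_vertices_step:
  fixes a b :: "'a::euclidean_space"
  assumes cv: "crosspolytope_vertices k P V \<iota>"
    and z1: "z \<in> rel_interior P" and z2: "z \<in> rel_interior (closed_segment a b)"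
    and dim: "aff_dim (convex hull (P \<union> closed_segment a b)) = int (Suc k)"
  shows "crosspolytope_vertices (Suc k) (convex hull (P \<union> closed_segment a b)) (insert a (insert b V))
    (\<lambda>v. if v = a then b else if v = b then a else \<iota> v)"
proof -
  have fin: "finite V" and card: "card V = 2 * k" and PV: "P = convex hull V"
    and adim: "aff_dim P = int k"
    and ball: "\<forall>v\<in>V. \<iota> v \<in> V \<and> \<iota> v \<noteq> v \<and> \<iota> (\<iota> v) = v"
    and supp: "\<forall>A\<subseteq>V. (\<forall>v\<in>A. \<iota> v \<notin> A) \<longrightarrow> (\<exists>c d. (\<forall>v\<in>A. c \<bullet> v = d) \<and> (\<forall>v\<in>V - A. c \<bullet> v < d))"
    and faceP: "\<forall>F v. F face_of P \<longrightarrow> v \<in> V \<longrightarrow> v \<in> F \<longrightarrow> \<iota> v \<in> F \<longrightarrow> F = P"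
    using cv unfolding crosspolytope_vertices_def by - (elim conjE, assumption)+
  have \<iota>: "\<iota> v \<in> V \<and> \<iota> v \<noteq> v \<and> \<iota> (\<iota> v) = v" if "v \<in> V" for v
    using ball that by blast
  have zP: "z \<in> P" using z1 rel_interior_subset by blast
  then have zaff: "z \<in> affine hull P" by (rule hull_inc)
  have VP: "V \<subseteq> P" unfolding PV by (rule hull_subset)
  let ?P' = "convex hull (P \<union> closed_segment a b)"
  have P'V: "?P' = convex hull (insert a (insert b V))"
  proof -
    have "insert a (insert b V) = V \<union> {a, b}" by auto
    then show ?thesis unfolding PV segment_convex_hull 
      by (simp only: hull_Un_left[symmetric] hull_Un_right[symmetric])
  qed
  have notboth: "\<not> (a \<in> affine hull P \<and> b \<in> affine hull P)"
  proof
    assume *: "a \<in> affine hull P \<and> b \<in> affine hull P"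
    then have "P \<union> closed_segment a b \<subseteq> affine hull P"
      by (simp add: hull_subset closed_segment_subset affine_imp_convex)
    then have "aff_dim (P \<union> closed_segment a b) \<le> aff_dim P"
      by (metis aff_dim_subset aff_dim_affine_hull)
    then show False using dim adim by (simp add: aff_dim_convex_hull)
  qed
  have ab: "a \<noteq> b"
  proof
    assume "a = b"
    then have "a = z" using z2 by simp
    then show False using notboth zaff \<open>a = b\<close> by simp
  qed
  then have zseg: "z \<in> open_segment a b" using z2 by (simp add: rel_interior_closed_segment)
  then obtain t where t: "0 < t" "t < 1" and zt: "z = (1 - t) *\<^sub>R a + t *\<^sub>R b"
    by (auto simp: in_segment)
  \<comment> \<open>As \<open>s\<close> is nonzero, the equation for \<open>z\<close> can be solved
    for \<open>q\<close>, which becomes an affine combination of \<open>p\<close> and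
    \<open>z\<close>.\<close>
  have aux: "q \<in> affine hull P"
    if "p \<in> affine hull P" "z = (1 - s) *\<^sub>R p + s *\<^sub>R q" "s \<noteq> 0" for p q s
  proof -
    have "q = (1 - 1 / s) *\<^sub>R p + (1 / s) *\<^sub>R z"
      using that(3) unfolding that(2) by (simp add: algebra_simps)
    then show ?thesis using mem_affine[OF affine_affine_hull that(1) zaff, of "1 - 1 / s" "1 / s"] by simp
  qed
  have aP: "a \<notin> affine hull P" using notboth aux[of a t b] zt t by auto
  have bP: "b \<notin> affine hull P" using notboth aux[of b "1 - t" a] zt t by (auto simp: add.commute)
  have abV: "a \<notin> V" "b \<notin> V" using aP bP VP hull_subset[of P affine] by auto
  show ?thesis
    unfolding crosspolytope_vertices_def
  proof (intro conjI allI impI)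
    show "finite (insert a (insert b V))" using fin by simp
    show "card (insert a (insert b V)) = 2 * Suc k" using fin card ab abV by simp
    show "?P' = convex hull (insert a (insert b V))" by (rule P'V)
    show "aff_dim ?P' = int (Suc k)" by (rule dim)
    show "\<forall>v\<in>insert a (insert b V). (if v = a then b else if v = b then a else \<iota> v) \<in> insert a (insert b V) \<and>
        (if v = a then b else if v = b then a else \<iota> v) \<noteq> v \<and>
        (if (if v = a then b else if v = b then a else \<iota> v) = a then b
         else if (if v = a then b else if v = b then a else \<iota> v) = b then a
         else \<iota> (if v = a then b else if v = b then a else \<iota> v)) = v"
      using \<iota> ab abV by auto
  next
    fix A
    assume A: "A \<subseteq> insert a (insert b V)" "\<forall>v\<in>A. (if v = a then b else if v = b then a else \<iota> v) \<notin> A"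
    let ?A = "A \<inter> V"
    have A': "\<forall>v\<in>?A. \<iota> v \<notin> ?A" using A(2) abV by (metis IntE)
    have "\<exists>c d. (\<forall>v\<in>?A. c \<bullet> v = d) \<and> (\<forall>v\<in>V - ?A. c \<bullet> v < d)"
      by (rule supp[THEN spec, of ?A, THEN mp, OF Int_lower2, THEN mp, OF A'])
    then obtain c d where "\<forall>v\<in>?A. c \<bullet> v = d" "\<forall>v\<in>V - ?A. c \<bullet> v < d" by (elim exE conjE)
    then have c: "\<And>v. v \<in> ?A \<Longrightarrow> c \<bullet> v = d" "\<And>v. v \<in> V - ?A \<Longrightarrow> c \<bullet> v < d" by blast+
    have le: "c \<bullet> p \<le> d" if "p \<in> P" for p
    proof -
      have "V \<subseteq> {x. c \<bullet> x \<le> d}" using c by fastforce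
      then have "P \<subseteq> {x. c \<bullet> x \<le> d}" unfolding PV by (rule hull_minimal) (rule convex_halfspace_le)
      then show ?thesis using that by blast
    qed
    have "V \<noteq> {}" using zP PV by auto
    then obtain v where v: "v \<in> V - ?A" using A' \<iota> by blast
    \<comment> \<open>Equality would put the relatively interior point \<open>z\<close> on a face of
      \<open>P\<close>; that face would be all of \<open>P\<close> and contain the vertex
      \<open>v\<close> outside \<open>A\<close>.\<close>
    have cz: "c \<bullet> z < d"
    proof (rule ccontr)
      assume "\<not> c \<bullet> z < d"
      then have "z \<in> P \<inter> {x. c \<bullet> x = d}" using le[OF zP] zP by simp
      moreover have "P \<inter> {x. c \<bullet> x = d} face_of P"
        using le by (intro face_of_Int_supporting_hyperplane_le) (auto simp: PV)
      ultimately have "P \<inter> {x. c \<bullet> x = d} = P"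
        using z1 face_of_disjoint_rel_interior by blast
      then show False using v VP c(2)[OF v] by auto
    qed
    obtain e where e: "\<And>p. p \<in> P \<Longrightarrow> e \<bullet> p = e \<bullet> z" "e \<bullet> a \<noteq> e \<bullet> z"
      using exists_orthogonal_separating[OF zaff aP] by blast
    \<comment> \<open>An affine functional on \<open>P\<close> extends to one with any prescribed value at \<open>a\<close>; its value at \<open>b\<close> is
      then determined by the value at \<open>z\<close>.\<close>
    have ext: "\<exists>c' d'. (\<forall>p\<in>P. c' \<bullet> p - d' = c \<bullet> p - d) \<and> c' \<bullet> a - d' = r \<and>
        (1 - t) * r + t * (c' \<bullet> b - d') = c \<bullet> z - d" for r
    proof -
      define \<mu> where "\<mu> = (r - (c \<bullet> a - d)) / (e \<bullet> a - e \<bullet> z)"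
      define c' where "c' = c + \<mu> *\<^sub>R e"
      define d' where "d' = d + \<mu> * (e \<bullet> z)"
      have 1: "c' \<bullet> p - d' = c \<bullet> p - d" if "p \<in> P" for p
        using e(1)[OF that] by (simp add: c'_def d'_def inner_add_left)
      have "c' \<bullet> a - d' = c \<bullet> a - d + \<mu> * (e \<bullet> a - e \<bullet> z)"
        by (simp add: c'_def d'_def inner_add_left algebra_simps)
      then have 2: "c' \<bullet> a - d' = r" using e(2) by (simp add: \<mu>_def)
      have "c' \<bullet> z - d' = (1 - t) * (c' \<bullet> a - d') + t * (c' \<bullet> b - d')"
        unfolding zt by (simp add: inner_add_right algebra_simps)
      then show ?thesis using 1 2 zP by metis
    qed
    define s where "s = d - c \<bullet> z"
    have s: "s > 0" using cz by (simp add: s_def)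
    have "\<not> (a \<in> A \<and> b \<in> A)" using A(2) by metis
    then consider (a) "a \<in> A" "b \<notin> A" | (b) "a \<notin> A" "b \<in> A" | (n) "a \<notin> A" "b \<notin> A" by blast
    \<comment> \<open>\<open>r\<close> and \<open>rb\<close> are the values wanted at
      \<open>a\<close> and \<open>b\<close> for the functional minus its level: zero on
      \<open>A\<close>, negative otherwise, with weighted mean \<open>- s\<close> at
      \<open>z\<close>. They exist because \<open>A\<close> contains at most one of
      \<open>a\<close>, \<open>b\<close>.\<close>
    then obtain r rb where r: "(1 - t) * r + t * rb = - s"
      "if a \<in> A then r = 0 else r < 0" "if b \<in> A then rb = 0 else rb < 0"
    proof cases
      case a
      then show ?thesis using that[of 0 "- s / t"] s t by simp
    next
      case b
      then show ?thesis using that[of "- s / (1 - t)" 0] s t by simp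
    next
      case n
      then show ?thesis using that[of "- s" "- s"] s by (simp add: algebra_simps)
    qed
    obtain c' d' where c': "\<And>p. p \<in> P \<Longrightarrow> c' \<bullet> p - d' = c \<bullet> p - d" "c' \<bullet> a - d' = r"
      "(1 - t) * r + t * (c' \<bullet> b - d') = - s"
      using ext[of r] by (auto simp: s_def)
    have "t * (c' \<bullet> b - d') = t * rb" using c'(3) r(1) by linarith
    then have rb: "c' \<bullet> b - d' = rb" using t by (metis mult_left_cancel less_irrefl)
    have V': "c' \<bullet> v = d'" if "v \<in> ?A" for v
      using c'(1)[of v] c(1)[OF that] that VP by auto
    have V'': "c' \<bullet> v < d'" if "v \<in> V - ?A" for v
      using c'(1)[of v] c(2)[OF that] that VP by auto
    show "\<exists>c d. (\<forall>v\<in>A. c \<bullet> v = d) \<and> (\<forall>v\<in>insert a (insert b V) - A. c \<bullet> v < d)"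
    proof (intro exI[of _ c'] exI[of _ d'] conjI ballI)
      fix v assume "v \<in> A"
      then show "c' \<bullet> v = d'" using A(1) V'[of v] c'(2) rb r(2,3) by auto
    next
      fix v assume "v \<in> insert a (insert b V) - A"
      then show "c' \<bullet> v < d'" using V''[of v] c'(2) rb r(2,3) by auto
    qed
  next
    fix F v
    assume F: "F face_of ?P'" and v: "v \<in> insert a (insert b V)" "v \<in> F"
      "(if v = a then b else if v = b then a else \<iota> v) \<in> F"
    have cF: "convex F" using F by (rule face_of_imp_convex)
    have FP: "F \<inter> P face_of P"
    proof -
      have "P \<subseteq> ?P'" using hull_subset[of "P \<union> closed_segment a b" convex] by blast
      then have "F \<inter> P face_of ?P' \<inter> P" using F PV by (intro face_of_slice) auto
      then show ?thesis using \<open>P \<subseteq> ?P'\<close> by (simp add: inf.absorb2)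
    qed
    have "P \<subseteq> F \<and> a \<in> F \<and> b \<in> F"
    proof (cases "v \<in> V")
      case True
      then have "\<iota> v \<in> F" using v abV by (auto split: if_splits)
      then have "v \<in> F \<inter> P" "\<iota> v \<in> F \<inter> P" using v(2) \<iota>[OF True] True VP by auto
      then have "F \<inter> P = P" by (rule faceP[rule_format, OF FP True])
      then have "P \<subseteq> F" by blast
      moreover have "a \<in> F \<and> b \<in> F"
      proof (rule face_ofD[OF F zseg])
        show "a \<in> ?P'" "b \<in> ?P'" unfolding P'V by (simp_all add: hull_inc)
        show "z \<in> F" using zP \<open>P \<subseteq> F\<close> by blast
      qed
      ultimately show ?thesis by blast
    next
      case False
      then have *: "a \<in> F" "b \<in> F" using v ab by (auto split: if_splits)
      then have "closed_segment a b \<subseteq> F" using cF by (simp add: closed_segment_subset)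
      then have "z \<in> F" using zseg open_closed_segment by blast
      then have "F \<inter> P = P" using face_of_disjoint_rel_interior[OF FP] z1 zP by blast
      then show ?thesis using * by blast
    qed
    then have "insert a (insert b V) \<subseteq> F" using VP by blast
    then have "?P' \<subseteq> F" unfolding P'V using cF by (rule hull_minimal)
    then show "F = ?P'" using F face_of_imp_subset by blast
  qed
qed

lemma crosspolytope_has_vertices:
  assumes "crosspolytope k P"
  shows "\<exists>V \<iota>. crosspolytope_vertices k P V \<iota>"
  using assms
proof induction
  case (segment a b)
  then show ?case using crosspolytope_vertices_segment by blast
next
  case (step k P a b)
  then obtain V \<iota> z where "crosspolytope_vertices k P V \<iota>"
    "z \<in> rel_interior P" "z \<in> rel_interior (closed_segment a b)" by auto
  then show ?case using crosspolytope_vertices_step step.hyps by blast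
qed

subsection \<open>Simplicial cones and lattice bases\<close>

lemma convex_cone_hull_finite:
  assumes "finite A"
  shows "convex_cone hull A = {\<Sum>a\<in>A. c a *\<^sub>R a | c. \<forall>a\<in>A. 0 \<le> c a}" (is "_ = ?R")
proof
  have "convex_cone ?R"
    unfolding convex_cone_iff
  proof (intro conjI ballI allI impI)
    show "0 \<in> ?R" by (auto intro!: exI[of _ "\<lambda>_. 0"])
  next
    fix x y assume "x \<in> ?R" "y \<in> ?R"
    then obtain c d where "x = (\<Sum>a\<in>A. c a *\<^sub>R a)" "y = (\<Sum>a\<in>A. d a *\<^sub>R a)"
      "\<forall>a\<in>A. 0 \<le> c a" "\<forall>a\<in>A. 0 \<le> d a" by blast
    then show "x + y \<in> ?R"
      by (intro CollectI exI[of _ "\<lambda>a. c a + d a"]) (auto simp: scaleR_left_distrib sum.distrib)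
  next
    fix x and r :: real assume "x \<in> ?R" "0 \<le> r"
    then obtain c where "x = (\<Sum>a\<in>A. c a *\<^sub>R a)" "\<forall>a\<in>A. 0 \<le> c a" by blast
    then show "r *\<^sub>R x \<in> ?R" using \<open>0 \<le> r\<close>
      by (intro CollectI exI[of _ "\<lambda>a. r * c a"]) (auto simp: scaleR_sum_right)
  qed
  moreover have "A \<subseteq> ?R"
  proof
    fix a assume "a \<in> A"
    have "a = (\<Sum>b\<in>A. (if b = a then 1 else 0) *\<^sub>R b)"
      using assms \<open>a \<in> A\<close> by (simp add: if_distrib[of "\<lambda>x. x *\<^sub>R _"] cong: if_cong)
    then show "a \<in> ?R" by (intro CollectI exI[of _ "\<lambda>b. if b = a then 1 else 0"]) auto
  qed
  ultimately show "convex_cone hull A \<subseteq> ?R" by (simp add: hull_minimal)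
  show "?R \<subseteq> convex_cone hull A"
  proof
    fix x assume "x \<in> ?R"
    then obtain c where x: "x = (\<Sum>a\<in>A. c a *\<^sub>R a)" and c: "\<forall>a\<in>A. 0 \<le> c a" by blast
    have "(\<Sum>a\<in>B. c a *\<^sub>R a) \<in> convex_cone hull A" if "B \<subseteq> A" for B
      using finite_subset[OF that assms] that
      by (induction B) (auto simp: convex_cone_hull_contains_0 c hull_inc
          intro!: convex_cone_hull_add convex_cone_hull_mul)
    then show "x \<in> convex_cone hull A" using x by simp
  qed
qed

lemma inner_nonneg_cone:
  assumes "v \<in> convex_cone hull A" "\<And>a. a \<in> A \<Longrightarrow> 0 \<le> m \<bullet> a"
  shows "0 \<le> m \<bullet> v"
proof -
  have "convex_cone hull A \<subseteq> {x. 0 \<le> m \<bullet> x}"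
    using assms(2) convex_cone_halfspace_ge[of m] by (intro hull_minimal) auto
  then show ?thesis using assms(1) by blast
qed

text \<open>\<open>m\<close> supports the cone. Nonnegative terms whose sum is at most 0 are all
  zero, so no generator outside \<open>B\<close> takes part in the combination.\<close>

lemma in_cone_of_face:
  assumes fin: "finite A" and v: "v \<in> convex_cone hull A" and mv: "m \<bullet> v \<le> 0"
    and m: "\<And>a. a \<in> A \<Longrightarrow> 0 \<le> m \<bullet> a" "\<And>a. a \<in> A - B \<Longrightarrow> 0 < m \<bullet> a"
  shows "v \<in> convex_cone hull (A \<inter> B)"
proof -
  obtain c where v: "v = (\<Sum>a\<in>A. c a *\<^sub>R a)" and c: "\<forall>a\<in>A. 0 \<le> c a"
    using v convex_cone_hull_finite[OF fin] by blast
  have "(\<Sum>a\<in>A. c a * (m \<bullet> a)) = 0"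
  proof (rule antisym)
    show "(\<Sum>a\<in>A. c a * (m \<bullet> a)) \<le> 0" using mv by (simp add: v inner_sum_right)
    show "0 \<le> (\<Sum>a\<in>A. c a * (m \<bullet> a))" using c m(1) by (simp add: sum_nonneg)
  qed
  then have "\<forall>a\<in>A. c a * (m \<bullet> a) = 0"
    using fin c m(1) by (subst (asm) sum_nonneg_eq_0_iff) auto
  then have "c a = 0" if "a \<in> A - B" for a using m(2)[OF that] that by force
  then have "v = (\<Sum>a\<in>A \<inter> B. c a *\<^sub>R a)"
    unfolding v using fin by (intro sum.mono_neutral_right) auto
  then show ?thesis
    unfolding convex_cone_hull_finite[OF finite_Int[OF disjI1[OF fin]]] using c by auto
qed

text \<open>The dual vector is the component of \<open>a\<close> orthogonal to the span of the other
  elements, rescaled.\<close>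

lemma exists_dual_vector:
  fixes A :: "'a::euclidean_space set"
  assumes ind: "independent A" and a: "a \<in> A"
  obtains m where "m \<in> span A" "m \<bullet> a = 1" "\<And>b. b \<in> A - {a} \<Longrightarrow> m \<bullet> b = 0"
proof -
  obtain y e where y: "y \<in> span (A - {a})" and e: "\<And>w. w \<in> span (A - {a}) \<Longrightarrow> orthogonal e w"
    and aye: "a = y + e"
    using orthogonal_subspace_decomp_exists[of "A - {a}" a] by metis
  have "e \<noteq> 0" using ind a y aye by (auto simp: dependent_def)
  have ea: "e \<bullet> a = e \<bullet> e" using e[OF y] by (simp add: orthogonal_def aye inner_add_right)
  have "y \<in> span A" using y span_mono[of "A - {a}" A] by blast
  then have "a - y \<in> span A" using a by (simp add: span_base span_diff)
  then have "e \<in> span A" by (simp add: aye)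
  show thesis
  proof (rule that[of "(1 / (e \<bullet> e)) *\<^sub>R e"])
    show "(1 / (e \<bullet> e)) *\<^sub>R e \<in> span A" using \<open>e \<in> span A\<close> by (rule span_scale)
    show "(1 / (e \<bullet> e)) *\<^sub>R e \<bullet> a = 1" using \<open>e \<noteq> 0\<close> by (simp add: ea)
    show "(1 / (e \<bullet> e)) *\<^sub>R e \<bullet> b = 0" if "b \<in> A - {a}" for b
      using e[OF span_base[OF that]] by (simp add: orthogonal_def)
  qed
qed

lemma cone_subset_cone_independent:
  fixes A :: "'a::euclidean_space set"
  assumes "independent A" "B \<subseteq> A" "C \<subseteq> A" "convex_cone hull B \<subseteq> convex_cone hull C"
  shows "B \<subseteq> C"
proof
  fix b assume b: "b \<in> B"
  then have "b \<in> A" using assms(2) by blast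
  then obtain m where m: "m \<bullet> b = 1" "\<And>c. c \<in> A - {b} \<Longrightarrow> m \<bullet> c = 0"
    using exists_dual_vector[OF assms(1)] by metis
  show "b \<in> C"
  proof (rule ccontr)
    assume "b \<notin> C"
    then have "m \<bullet> c = 0" if "c \<in> C" for c
      using m(2)[of c] that assms(3) by blast
    then have "0 \<le> - m \<bullet> c" if "c \<in> C" for c
      using that by simp
    moreover have "b \<in> convex_cone hull C" by (metis b assms(4) hull_inc subsetD)
    ultimately have "0 \<le> - m \<bullet> b" using inner_nonneg_cone by blast
    then show False using m(1) by simp
  qed
qed

text \<open>The ray of \<open>w\<close> is extremal: the sum \<open>m\<close> of the dual vectors of
  the other generators vanishes on it and is positive elsewhere on the cone. When \<open>w\<close>
  is written in terms of \<open>T\<close>, only elements with value 0 under \<open>m\<close>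
  contribute, and these are multiples of \<open>w\<close>.\<close>

lemma cone_generator_of_ray:
  fixes S :: "'a::euclidean_space set"
  assumes ind: "independent S" and fin: "finite T" and eq: "convex_cone hull T = convex_cone hull S"
    and w: "w \<in> S"
  obtains a r where "a \<in> T" "a = r *\<^sub>R w" "0 < r"
proof -
  have finS: "finite S" by (rule finiteI_independent[OF ind])
  have "\<exists>m. m \<bullet> s = 1 \<and> (\<forall>b\<in>S - {s}. m \<bullet> b = 0)" if "s \<in> S" for s
    using exists_dual_vector[OF ind that] by metis
  then obtain m' where "\<forall>s\<in>S. m' s \<bullet> s = 1 \<and> (\<forall>b\<in>S - {s}. m' s \<bullet> b = 0)" by metis
  then have m': "m' s \<bullet> b = (if b = s then 1 else 0)" if "s \<in> S" "b \<in> S" for s b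
    using that by auto
  define m where "m = (\<Sum>s\<in>S - {w}. m' s)"
  have m: "m \<bullet> b = (if b = w then 0 else 1)" if "b \<in> S" for b
  proof -
    have "m \<bullet> b = (\<Sum>s\<in>S - {w}. if b = s then 1 else 0)"
      unfolding m_def inner_sum_left using that m' by (intro sum.cong) auto
    then show ?thesis using that finS by (simp add: sum.delta)
  qed
  have "w \<in> convex_cone hull T" by (metis w eq hull_inc)
  then obtain c where wc: "w = (\<Sum>a\<in>T. c a *\<^sub>R a)" and c: "\<forall>a\<in>T. 0 \<le> c a"
    unfolding convex_cone_hull_finite[OF fin] by blast
  have in_S: "a \<in> convex_cone hull S" if "a \<in> T" for a by (metis eq hull_inc that)
  have nonneg: "0 \<le> m \<bullet> a" if "a \<in> T" for a
    using inner_nonneg_cone[OF in_S[OF that]] m by simp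
  have "(\<Sum>a\<in>T. c a * (m \<bullet> a)) = m \<bullet> w" by (simp add: wc inner_sum_right)
  then have "(\<Sum>a\<in>T. c a * (m \<bullet> a)) = 0" using m[OF w] by simp
  then have zero: "\<forall>a\<in>T. c a * (m \<bullet> a) = 0"
    using fin c nonneg by (subst (asm) sum_nonneg_eq_0_iff) auto
  have "w \<noteq> 0" using w ind dependent_zero by blast
  then obtain a where a: "a \<in> T" "c a *\<^sub>R a \<noteq> 0" using wc by (metis (no_types, lifting) sum.neutral)
  then have "m \<bullet> a = 0" using zero by auto
  then have "a \<in> convex_cone hull (S \<inter> {w})"
    using in_S[OF a(1)] m by (intro in_cone_of_face[OF finS, of a m]) auto
  then obtain r where r: "a = r *\<^sub>R w" "0 \<le> r" using w by (auto simp: convex_cone_hull_finite)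
  then have "0 < r" using a(2) by (cases "r = 0") auto
  then show thesis using that a(1) r(1) by blast
qed

context
  fixes L B :: "'a::euclidean_space set"
  assumes lb: "lattice_basis L B"
begin

lemma lattice_basis_independent: "independent B" using lb by (simp add: lattice_basis_def)
lemma lattice_basis_finite: "finite B" by (rule finiteI_independent[OF lattice_basis_independent])
lemma lattice_basis_nonzero: "b \<in> B \<Longrightarrow> b \<noteq> 0"
  using lattice_basis_independent dependent_zero by blast

lemma lattice_basis_elem: "v \<in> L \<longleftrightarrow> (\<exists>c :: 'a \<Rightarrow> int. v = (\<Sum>b\<in>B. of_int (c b) *\<^sub>R b))"
  using lb by (auto simp: lattice_basis_def)

lemma lattice_basis_subset: "B \<subseteq> L"
proof
  fix a assume "a \<in> B"
  then have "a = (\<Sum>b\<in>B. of_int (if b = a then 1 else 0) *\<^sub>R b)"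
    using lattice_basis_finite
    by (simp add: if_distrib[of of_int] if_distrib[of "\<lambda>x. x *\<^sub>R _"] cong: if_cong)
  then show "a \<in> L" unfolding lattice_basis_elem by (intro exI[of _ "\<lambda>b. if b = a then 1 else 0"])
qed

lemma lattice_basis_span: "span L = span B"
proof (rule span_eq[THEN iffD2], intro conjI subsetI)
  fix v assume "v \<in> L"
  then show "v \<in> span B" unfolding lattice_basis_elem by (auto intro: span_sum span_scale span_base)
qed (use lattice_basis_subset span_superset in blast)

lemma lattice_basis_dim: "dim L = card B"
  by (metis dim_span lattice_basis_span dim_eq_card_independent lattice_basis_independent)

lemma lattice_basis_dual_lattice:
  "m \<in> dual_lattice L \<longleftrightarrow> m \<in> span L \<and> (\<forall>b\<in>B. m \<bullet> b \<in> \<int>)"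
proof -
  have "m \<bullet> v \<in> \<int>" if v: "v \<in> L" and m: "\<forall>b\<in>B. m \<bullet> b \<in> \<int>" for v
  proof -
    obtain c :: "'a \<Rightarrow> int" where "v = (\<Sum>b\<in>B. of_int (c b) *\<^sub>R b)"
      using v unfolding lattice_basis_elem by blast
    then show ?thesis using m by (auto simp: inner_sum_right intro!: Ints_sum Ints_mult)
  qed
  then show ?thesis using lattice_basis_subset by (auto simp: dual_lattice_def)
qed

lemma lattice_basis_dual_vector:
  assumes "b \<in> B"
  obtains m where "m \<in> dual_lattice L" "m \<bullet> b = 1" "\<And>b'. b' \<in> B - {b} \<Longrightarrow> m \<bullet> b' = 0"
proof -
  obtain m where m: "m \<in> span B" "m \<bullet> b = 1" "\<And>b'. b' \<in> B - {b} \<Longrightarrow> m \<bullet> b' = 0"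
    using exists_dual_vector[OF lattice_basis_independent assms] by metis
  have "m \<bullet> b' \<in> \<int>" if "b' \<in> B" for b' using m(2) m(3)[of b'] that by (cases "b' = b") auto
  then have "m \<in> dual_lattice L" using m(1) by (simp add: lattice_basis_dual_lattice lattice_basis_span)
  then show thesis using m that by blast
qed

end

text \<open>Evaluating the dual vectors of the two bases shows that both \<open>c\<close> and
  \<open>1 / c\<close> are integers.\<close>

lemma lattice_basis_ray_unique:
  assumes B: "lattice_basis L B" "b \<in> B" and B': "lattice_basis L B'" "b' \<in> B'"
    and c: "b' = c *\<^sub>R b" "0 < c"
  shows "b' = b"
proof -
  obtain m where m: "m \<in> dual_lattice L" "m \<bullet> b = 1" using lattice_basis_dual_vector[OF B] by metis
  obtain m' where m': "m' \<in> dual_lattice L" "m' \<bullet> b' = 1" using lattice_basis_dual_vector[OF B'] by metis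
  have "m \<bullet> b' \<in> \<int>" "m' \<bullet> b \<in> \<int>"
    using m(1) m'(1) lattice_basis_subset[OF B(1)] lattice_basis_subset[OF B'(1)] B(2) B'(2)
    by (auto simp: dual_lattice_def)
  then obtain p q :: int where pq: "m \<bullet> b' = of_int p" "m' \<bullet> b = of_int q" by (auto elim!: Ints_cases)
  have "c = of_int p" using pq(1) c m(2) by simp
  moreover have "c * of_int q = 1" using pq(2) c m'(2) by simp
  ultimately have "p * q = 1" "0 < p" using c(2) by (auto simp flip: of_int_mult)
  then have "p = 1" using zmult_eq_1_iff by fastforce
  then show ?thesis using c(1) \<open>c = of_int p\<close> by simp
qed

text \<open>Extremal rays are intrinsic to the cone and basis elements are primitive. Applied in
  both directions, this shows that a smooth cone determines its generators.\<close>

lemma lattice_cone_generators_subset: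
  assumes B: "lattice_basis L B" "S \<subseteq> B" and B': "lattice_basis L B'" "S' \<subseteq> B'"
    and eq: "convex_cone hull S' = convex_cone hull S"
  shows "S \<subseteq> S'"
proof
  fix w assume w: "w \<in> S"
  have "independent S" using lattice_basis_independent[OF B(1)] independent_mono B(2) by blast
  moreover have "finite S'" using lattice_basis_finite[OF B'(1)] finite_subset B'(2) by blast
  ultimately obtain a r where a: "a \<in> S'" "a = r *\<^sub>R w" "0 < r"
    using cone_generator_of_ray[OF _ _ eq w] by metis
  have "w \<in> B" "a \<in> B'" using w a(1) B(2) B'(2) by blast+
  then have "a = w" using lattice_basis_ray_unique[OF B(1) _ B'(1) _ a(2,3)] by blast
  then show "w \<in> S'" using a(1) by simp
qed

subsection \<open>Simplicial complexes of lattice generators\<close>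

text \<open>A simplex is the set of primitive generators of a cone. In
  \<open>extends_to_basis\<close> the basis is itself a simplex, so smoothness is combined with the
  fact that every cone lies in a full-dimensional one. \<open>cone_Int\<close> is the fan axiom on
  intersections.\<close>

locale simplicial_fan =
  fixes L :: "'a::euclidean_space set" and K :: "'a set set"
  assumes finite_complex: "finite K"
    and complex_nonempty: "K \<noteq> {}"
    and subset_complex: "A \<in> K \<Longrightarrow> B \<subseteq> A \<Longrightarrow> B \<in> K"
    and extends_to_basis: "A \<in> K \<Longrightarrow> \<exists>B\<in>K. A \<subseteq> B \<and> lattice_basis L B"
    and cone_Int: "A \<in> K \<Longrightarrow> B \<in> K \<Longrightarrow>
      convex_cone hull A \<inter> convex_cone hull B = convex_cone hull (A \<inter> B)"

text \<open>The complex is a suspension with respect to any two vertices that are not joined by an edge; this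
  is the form in which the combinatorics of the crosspolytope passes to the quotient fans.\<close>

locale crosspolytope_fan = simplicial_fan +
  assumes suspension: "{y} \<in> K \<Longrightarrow> {z} \<in> K \<Longrightarrow> {y, z} \<notin> K \<Longrightarrow> A \<in> K \<Longrightarrow> y \<notin> A \<Longrightarrow> z \<notin> A \<Longrightarrow>
      insert y A \<in> K"

text \<open>A vertex of the polytope only has the direction of a ray; this passes from vertices to
  lattice generators.\<close>

lemma convex_cone_hull_rescale:
  assumes "\<And>a. a \<in> A \<Longrightarrow> \<exists>c>0. g a = c *\<^sub>R a"
  shows "convex_cone hull (g ` A) = convex_cone hull A"
proof
  show "convex_cone hull (g ` A) \<subseteq> convex_cone hull A"
  proof (intro hull_minimal convex_cone_convex_cone_hull image_subsetI)
    fix a assume a: "a \<in> A"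
    then obtain c where c: "c > 0" "g a = c *\<^sub>R a" using assms by blast
    then show "g a \<in> convex_cone hull A"
      using convex_cone_hull_mul[OF hull_inc[OF a], of c] by simp
  qed
  show "convex_cone hull A \<subseteq> convex_cone hull (g ` A)"
  proof (intro hull_minimal convex_cone_convex_cone_hull subsetI)
    fix a assume a: "a \<in> A"
    then obtain c where c: "c > 0" "g a = c *\<^sub>R a" using assms by blast
    have "(1 / c) *\<^sub>R g a \<in> convex_cone hull (g ` A)"
      using a c(1) by (intro convex_cone_hull_mul hull_inc) simp_all
    then show "a \<in> convex_cone hull (g ` A)" using c by simp
  qed
qed

section \<open>The face fan of a crosspolytope with the origin in its interior\<close>

locale crosspolytope_around_zero =
  fixes P V :: "'a::euclidean_space set" and \<iota> :: "'a \<Rightarrow> 'a"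
  assumes vertices: "crosspolytope_vertices DIM('a) P V \<iota>"
    and zero: "0 \<in> interior P"
begin

text \<open>These are the vertex sets of the proper faces; the empty set stands for the cone
  \<open>{0}\<close>.\<close>

definition antipode_free :: "'a set \<Rightarrow> bool" where
  "antipode_free A \<longleftrightarrow> A \<subseteq> V \<and> (\<forall>v\<in>A. \<iota> v \<notin> A)"

lemma fin: "finite V" and card_V: "card V = 2 * DIM('a)" and PV: "P = convex hull V"
  and ball: "\<forall>v\<in>V. \<iota> v \<in> V \<and> \<iota> v \<noteq> v \<and> \<iota> (\<iota> v) = v"
  and supp: "\<forall>A\<subseteq>V. (\<forall>v\<in>A. \<iota> v \<notin> A) \<longrightarrow> (\<exists>c d. (\<forall>v\<in>A. c \<bullet> v = d) \<and> (\<forall>v\<in>V - A. c \<bullet> v < d))"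
  and faceP: "\<forall>F v. F face_of P \<longrightarrow> v \<in> V \<longrightarrow> v \<in> F \<longrightarrow> \<iota> v \<in> F \<longrightarrow> F = P"
  using vertices unfolding crosspolytope_vertices_def by - (elim conjE, assumption)+

lemma \<iota>: "v \<in> V \<Longrightarrow> \<iota> v \<in> V" "v \<in> V \<Longrightarrow> \<iota> v \<noteq> v" "v \<in> V \<Longrightarrow> \<iota> (\<iota> v) = v"
  using ball by auto

lemma V_nonempty: "V \<noteq> {}"
  using zero interior_subset[of P] by (auto simp: PV)

lemma antipode_free_subset: "antipode_free A \<Longrightarrow> B \<subseteq> A \<Longrightarrow> antipode_free B"
  unfolding antipode_free_def by blast

lemma antipode_free_finite: "antipode_free A \<Longrightarrow> finite A"
  using fin finite_subset unfolding antipode_free_def by blast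

text \<open>The origin is interior, so the supporting level is positive and can be normalised to 1.
  Independence, intersections and faces of the cones are all read off from these
  functionals.\<close>

lemma supporting_functional:
  assumes A: "antipode_free A"
  obtains c where "\<And>v. v \<in> A \<Longrightarrow> c \<bullet> v = 1" "\<And>v. v \<in> V - A \<Longrightarrow> c \<bullet> v < 1"
proof -
  have A': "A \<subseteq> V" "\<forall>v\<in>A. \<iota> v \<notin> A" using A by (simp_all add: antipode_free_def)
  have "\<exists>c d. (\<forall>v\<in>A. c \<bullet> v = d) \<and> (\<forall>v\<in>V - A. c \<bullet> v < d)"
    by (rule supp[THEN spec, of A, THEN mp, OF A'(1), THEN mp, OF A'(2)])
  then obtain c d where c: "\<forall>v\<in>A. c \<bullet> v = d" "\<forall>v\<in>V - A. c \<bullet> v < d" by (elim exE conjE)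
  \<comment> \<open>Such a vertex exists because \<open>A\<close> omits the antipodes of its own
    elements. It yields \<open>d > 0\<close> in the case \<open>c = 0\<close>.\<close>
  obtain v where v: "v \<in> V - A" using V_nonempty A \<iota>(1) unfolding antipode_free_def by blast
  have "c \<bullet> v \<le> d" if "v \<in> V" for v using c that by (cases "v \<in> A") (auto simp: less_imp_le)
  then have "V \<subseteq> {x. c \<bullet> x \<le> d}" by blast
  then have P: "P \<subseteq> {x. c \<bullet> x \<le> d}" unfolding PV by (rule hull_minimal) (rule convex_halfspace_le)
  have d: "d > 0"
  proof (cases "c = 0")
    case True
    then show ?thesis using c(2)[rule_format, OF v] by simp
  next
    case False
    obtain e where e: "e > 0" "ball 0 e \<subseteq> P" using zero by (auto simp: mem_interior)
    have "(e / 2 / norm c) *\<^sub>R c \<in> ball 0 e" using e(1) False by simp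
    then have "(e / 2 / norm c) *\<^sub>R c \<in> {x. c \<bullet> x \<le> d}" using P e(2) by blast
    then have "(e / 2 / norm c) * (c \<bullet> c) \<le> d" by simp
    moreover have "(e / 2 / norm c) * (c \<bullet> c) > 0" using e(1) False by simp
    ultimately show ?thesis by linarith
  qed
  show thesis
    by (rule that[of "(1 / d) *\<^sub>R c"]) (use c d in \<open>auto simp: field_simps\<close>)
qed

text \<open>The functionals for \<open>A\<close> and for \<open>A - {v}\<close> agree on
  \<open>A - {v}\<close>, hence on its span, but differ at \<open>v\<close>.\<close>

lemma antipode_free_independent:
  assumes A: "antipode_free A"
  shows "independent A"
  unfolding dependent_def
proof (intro notI, elim bexE)
  fix v assume v: "v \<in> A" "v \<in> span (A - {v})"
  obtain c where c: "\<And>v. v \<in> A \<Longrightarrow> c \<bullet> v = 1" using supporting_functional[OF A] by metis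
  obtain c' where c': "\<And>w. w \<in> A - {v} \<Longrightarrow> c' \<bullet> w = 1" "\<And>w. w \<in> V - (A - {v}) \<Longrightarrow> c' \<bullet> w < 1"
    using supporting_functional[OF antipode_free_subset[OF A, of "A - {v}"]] by blast
  have "A - {v} \<subseteq> {x. (c - c') \<bullet> x = 0}" using c c'(1) by (auto simp: inner_diff_left)
  then have "span (A - {v}) \<subseteq> {x. (c - c') \<bullet> x = 0}"
    by (rule span_minimal) (rule subspace_hyperplane)
  then have "(c - c') \<bullet> v = 0" using v(2) by blast
  moreover have "c' \<bullet> v < 1" using c'(2)[of v] v(1) A by (auto simp: antipode_free_def)
  ultimately show False using c[OF v(1)] by (simp add: inner_diff_left)
qed

text \<open>The difference of the two supporting functionals is nonpositive on the cone of
  \<open>A\<close>, nonnegative on that of \<open>B\<close> and positive on \<open>B - A\<close>, so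
  it separates the cones along their common face.\<close>

lemma cone_Int_antipode_free:
  assumes A: "antipode_free A" and B: "antipode_free B"
  shows "convex_cone hull A \<inter> convex_cone hull B = convex_cone hull (A \<inter> B)"
proof
  show "convex_cone hull (A \<inter> B) \<subseteq> convex_cone hull A \<inter> convex_cone hull B"
    by (simp add: hull_mono)
  show "convex_cone hull A \<inter> convex_cone hull B \<subseteq> convex_cone hull (A \<inter> B)"
  proof
    fix v assume v: "v \<in> convex_cone hull A \<inter> convex_cone hull B"
    obtain c where c: "\<And>v. v \<in> A \<Longrightarrow> c \<bullet> v = 1" "\<And>v. v \<in> V - A \<Longrightarrow> c \<bullet> v < 1"
      using supporting_functional[OF A] by metis
    obtain d where d: "\<And>v. v \<in> B \<Longrightarrow> d \<bullet> v = 1" "\<And>v. v \<in> V - B \<Longrightarrow> d \<bullet> v < 1"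
      using supporting_functional[OF B] by metis
    have AV: "A \<subseteq> V" "B \<subseteq> V" using A B by (auto simp: antipode_free_def)
    have 1: "0 \<le> (d - c) \<bullet> a" if "a \<in> B" for a
      using c(1)[of a] c(2)[of a] d(1)[OF that] AV(2) that by (cases "a \<in> A") (auto simp: inner_diff_left)
    have 2: "0 \<le> (c - d) \<bullet> a" if "a \<in> A" for a
      using d(1)[of a] d(2)[of a] c(1)[OF that] AV(1) that by (cases "a \<in> B") (auto simp: inner_diff_left)
    have "(d - c) \<bullet> v \<le> 0"
      using inner_nonneg_cone[of v A "c - d"] v 2 by (auto simp: inner_diff_left)
    moreover have "0 < (d - c) \<bullet> a" if "a \<in> B - A" for a
      using that c(2)[of a] d(1)[of a] AV by (auto simp: inner_diff_left)
    ultimately have "v \<in> convex_cone hull (B \<inter> A)"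
      using v 1 by (intro in_cone_of_face[OF antipode_free_finite[OF B], of v "d - c"]) auto
    then show "v \<in> convex_cone hull (A \<inter> B)" by (simp add: Int_commute)
  qed
qed

text \<open>A proper face contains no antipodal pair, which gives one inclusion. The normalised
  functional exhibits each antipode-free set as the vertex set of a face missing the origin, which
  gives the other.\<close>

lemma spanned_fan_eq: "spanned_fan P = (\<lambda>A. convex_cone hull A) ` {A. antipode_free A}"
proof (intro subset_antisym subsetI)
  fix \<sigma> assume "\<sigma> \<in> spanned_fan P"
  then consider "\<sigma> = {0}" | F where "\<sigma> = conic hull F" "F face_of P" "F \<noteq> P" "F \<noteq> {}"
    unfolding spanned_fan_def by blast
  then show "\<sigma> \<in> (\<lambda>A. convex_cone hull A) ` {A. antipode_free A}"
  proof cases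
    case 1
    then show ?thesis by (intro image_eqI[of _ _ "{}"]) (auto simp: antipode_free_def)
  next
    case 2
    obtain A where A: "A \<subseteq> V" "F = convex hull A"
      using face_of_convex_hull_subset[OF finite_imp_compact[OF fin], of F] 2(2) PV by metis
    have "antipode_free A"
      unfolding antipode_free_def
    proof (intro conjI ballI notI)
      fix v assume "v \<in> A" "\<iota> v \<in> A"
      then show False using faceP[rule_format, OF 2(2), of v] A 2(3) hull_inc[of _ A] by blast
    qed (rule A)
    moreover have "\<sigma> = convex_cone hull A"
      using 2(1,4) A(2) by (simp add: convex_cone_hull_separate_nonempty)
    ultimately show ?thesis by blast
  qed
next
  fix \<sigma> assume "\<sigma> \<in> (\<lambda>A. convex_cone hull A) ` {A. antipode_free A}"
  then obtain A where A: "antipode_free A" "\<sigma> = convex_cone hull A" by blast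
  show "\<sigma> \<in> spanned_fan P"
  proof (cases "A = {}")
    case True
    then show ?thesis using A by (simp add: spanned_fan_def)
  next
    case False
    obtain c where c: "\<And>v. v \<in> A \<Longrightarrow> c \<bullet> v = 1" "\<And>v. v \<in> V - A \<Longrightarrow> c \<bullet> v < 1"
      using supporting_functional[OF A(1)] by metis
    have aff: "affine hull A \<subseteq> {x. c \<bullet> x = 1}"
      using c(1) by (intro hull_minimal) (auto simp: affine_hyperplane)
    have "convex hull (V - A) \<subseteq> {x. c \<bullet> x < 1}"
      using c(2) by (intro hull_minimal) (auto simp: convex_halfspace_lt)
    then have "affine hull A \<inter> convex hull (V - A) = {}" using aff by fastforce
    then have "convex hull A face_of P"
      unfolding PV using A(1) by (intro face_of_convex_hulls fin) (auto simp: antipode_free_def)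
    moreover have "0 \<in> P" "0 \<notin> convex hull A"
      using zero interior_subset aff convex_hull_subset_affine_hull[of A] by auto
    ultimately show ?thesis
      using False A(2) by (auto simp: spanned_fan_def convex_cone_hull_separate_nonempty)
  qed
qed

text \<open>A maximal such set meets every antipodal pair, so it holds exactly half of the
  vertices.\<close>

lemma antipode_free_extends:
  assumes "antipode_free A"
  obtains B where "A \<subseteq> B" "antipode_free B" "card B = DIM('a)"
proof -
  have "finite {B. antipode_free B}"
    by (rule finite_subset[of _ "Pow V"]) (auto simp: antipode_free_def fin)
  then obtain B where B: "A \<subseteq> B" "antipode_free B" and max: "\<And>C. antipode_free C \<Longrightarrow> B \<subseteq> C \<Longrightarrow> B = C"
    using finite_has_maximal2[of "{B. antipode_free B}" A] assms by auto
  have BV: "B \<subseteq> V" and B\<iota>: "\<And>v. v \<in> B \<Longrightarrow> \<iota> v \<notin> B" using B(2) by (auto simp: antipode_free_def)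
  have "v \<in> B \<union> \<iota> ` B" if v: "v \<in> V" for v
  proof (rule ccontr)
    assume n: "v \<notin> B \<union> \<iota> ` B"
    have "\<iota> v \<notin> B" using n \<iota>(3)[OF v] by (metis UnI2 image_eqI)
    moreover have "\<iota> w \<noteq> v" if "w \<in> B" for w using n that by blast
    ultimately have "antipode_free (insert v B)"
      using BV B\<iota> v \<iota>(2)[OF v] unfolding antipode_free_def by auto
    then show False using max[of "insert v B"] n by blast
  qed
  then have V: "V = B \<union> \<iota> ` B" using BV \<iota>(1) by blast
  have inj: "inj_on \<iota> B" by (rule inj_onI) (metis BV \<iota>(3) subsetD)
  have finB: "finite B" by (rule antipode_free_finite[OF B(2)])
  have "card V = card B + card (\<iota> ` B)"
    unfolding V using finB B\<iota> by (intro card_Un_disjoint) auto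
  then have "card B = DIM('a)" using card_V card_image[OF inj] by simp
  then show thesis using that B by blast
qed

end

text \<open>\<open>g\<close> rescales each vertex of \<open>P\<close> to the lattice generator of
  its ray, which smoothness provides. The complex consists of the images under \<open>g\<close> of
  the antipode-free sets.\<close>

lemma crosspolytope_complex:
  fixes P :: "'a::euclidean_space set"
  assumes "crosspolytope DIM('a) P" and "0 \<in> interior P" and smooth: "smooth_fan L (spanned_fan P)"
  obtains K where "crosspolytope_fan L K" "spanned_fan P = (\<lambda>A. convex_cone hull A) ` K" "dim L = DIM('a)"
proof -
  obtain V \<iota> where V\<iota>: "crosspolytope_vertices DIM('a) P V \<iota>"
    using crosspolytope_has_vertices[OF assms(1)] by blast
  interpret crosspolytope_around_zero P V \<iota> by unfold_locales fact+
  have single: "antipode_free {v}" if "v \<in> V" for v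
    using that \<iota>(2)[OF that] by (auto simp: antipode_free_def)
  have nz: "v \<noteq> 0" if "v \<in> V" for v
    using antipode_free_independent[OF single[OF that]] by (auto simp: dependent_zero)
  have "\<exists>w. (\<exists>c>0. w = c *\<^sub>R v) \<and> (\<exists>B. lattice_basis L B \<and> w \<in> B)" if v: "v \<in> V" for v
  proof -
    have "convex_cone hull {v} \<in> spanned_fan P" using single[OF v] spanned_fan_eq by blast
    then obtain B S where BS: "lattice_basis L B" "S \<subseteq> B" "convex_cone hull {v} = convex_cone hull S"
      using smooth unfolding smooth_fan_def by blast
    have "v \<in> convex_cone hull S" by (metis BS(3) hull_inc insertI1)
    then have "S \<noteq> {}" using nz[OF v] by auto
    then obtain w where w: "w \<in> S" by blast
    then have "w \<in> convex_cone hull {v}" by (metis BS(3) hull_inc)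
    then obtain c where c: "w = c *\<^sub>R v" "0 \<le> c" by (auto simp: convex_cone_hull_finite)
    have "w \<noteq> 0" using lattice_basis_nonzero[OF BS(1)] w BS(2) by blast
    then have "c > 0" using c by (cases "c = 0") auto
    then show ?thesis using c BS w by blast
  qed
  then obtain g where g: "\<And>v. v \<in> V \<Longrightarrow> \<exists>c>0. g v = c *\<^sub>R v"
    "\<And>v. v \<in> V \<Longrightarrow> \<exists>B. lattice_basis L B \<and> g v \<in> B" by metis
  have cone_g: "convex_cone hull (g ` A) = convex_cone hull A" if "antipode_free A" for A
    using that g(1) by (intro convex_cone_hull_rescale) (auto simp: antipode_free_def)
  have gnz: "g v \<noteq> 0" if "v \<in> V" for v using g(1)[OF that] nz[OF that] by auto
  have inj: "inj_on g V"
  proof (rule inj_onI, rule ccontr)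
    fix v w assume vw: "v \<in> V" "w \<in> V" "g v = g w" "v \<noteq> w"
    have "g v \<in> convex_cone hull (g ` {v})" "g v \<in> convex_cone hull (g ` {w})"
      using vw(3) by (simp_all add: hull_inc)
    then have "g v \<in> convex_cone hull {v} \<inter> convex_cone hull {w}"
      using cone_g[OF single[OF vw(1)]] cone_g[OF single[OF vw(2)]] by simp
    then have "g v \<in> convex_cone hull ({v} \<inter> {w})"
      using cone_Int_antipode_free[OF single[OF vw(1)] single[OF vw(2)]] by simp
    then show False using gnz[OF vw(1)] vw(4) by simp
  qed
  have gInt: "g ` A \<inter> g ` B = g ` (A \<inter> B)" if "antipode_free A" "antipode_free B" for A B
    using that inj_on_image_Int[OF inj, of A B] by (auto simp: antipode_free_def)
  \<comment> \<open>The generators \<open>S\<close> supplied by smoothness of the cone of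
    \<open>A\<close> are primitive on its extremal rays, so they lie in the image of
    \<open>A\<close> under \<open>g\<close>. They span \<open>A\<close>, so counting makes them the
    whole image, and a lattice basis containing that many elements contains no others.\<close>
  have basis: "lattice_basis L (g ` A)" if A: "antipode_free A" "card A = DIM('a)" for A
  proof -
    have AV: "A \<subseteq> V" using A(1) by (simp add: antipode_free_def)
    have fin_gA: "finite (g ` A)" using antipode_free_finite[OF A(1)] by simp
    have card_gA: "card (g ` A) = DIM('a)" using card_image inj_on_subset[OF inj AV] A(2) by metis
    have "convex_cone hull A \<in> spanned_fan P" using A(1) spanned_fan_eq by blast
    then obtain B S where BS: "lattice_basis L B" "S \<subseteq> B" "convex_cone hull A = convex_cone hull S"
      using smooth unfolding smooth_fan_def by blast
    have gAS: "convex_cone hull (g ` A) = convex_cone hull S" using cone_g[OF A(1)] BS(3) by simp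
    have finS: "finite S" using BS lattice_basis_finite finite_subset by blast
    have indS: "independent S" using BS lattice_basis_independent independent_mono by blast
    have "S \<subseteq> g ` A"
    proof
      fix w assume w: "w \<in> S"
      obtain a r where a: "a \<in> g ` A" and r: "a = r *\<^sub>R w" "0 < r"
        using cone_generator_of_ray[OF indS fin_gA gAS w] by metis
      obtain B' where "lattice_basis L B'" "a \<in> B'" using a AV g(2) by blast
      then have "a = w" using lattice_basis_ray_unique[OF BS(1)] w BS(2) r by blast
      then show "w \<in> g ` A" using a by simp
    qed
    moreover have "A \<subseteq> span S"
    proof -
      have "convex_cone hull A \<subseteq> span S"
        unfolding BS(3) by (intro hull_minimal span_superset convex_cone_span)
      then show ?thesis using hull_subset[of A convex_cone] by blast
    qed
    then have "card A \<le> card S"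
      using independent_span_bound[OF finS antipode_free_independent[OF A(1)]] by blast
    ultimately have "S = g ` A" using card_gA A(2) fin_gA by (metis card_seteq)
    moreover have "card B \<le> card S"
      using independent_bound[OF lattice_basis_independent[OF BS(1)]] card_gA \<open>S = g ` A\<close> by simp
    then have "S = B" using BS(2) lattice_basis_finite[OF BS(1)] by (metis card_seteq)
    ultimately show ?thesis using BS(1) by simp
  qed
  let ?K = "(\<lambda>A. g ` A) ` {A. antipode_free A}"
  have "crosspolytope_fan L ?K"
  proof unfold_locales
    have "finite {A. antipode_free A}"
      by (rule finite_subset[of _ "Pow V"]) (auto simp: antipode_free_def fin)
    then show "finite ?K" by simp
    have "antipode_free {}" by (simp add: antipode_free_def)
    then show "?K \<noteq> {}" by blast
  next
    fix A B assume "A \<in> ?K" "B \<subseteq> A"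
    then obtain C where C: "antipode_free C" "B \<subseteq> g ` C" by blast
    then obtain D where "D \<subseteq> C" "B = g ` D" by (meson subset_imageE)
    then show "B \<in> ?K" using C antipode_free_subset by blast
  next
    fix A assume "A \<in> ?K"
    then obtain C where C: "antipode_free C" "A = g ` C" by blast
    obtain D where "C \<subseteq> D" "antipode_free D" "card D = DIM('a)" using antipode_free_extends[OF C(1)] .
    then show "\<exists>B\<in>?K. A \<subseteq> B \<and> lattice_basis L B" using basis C(2) by blast
  next
    fix A B assume "A \<in> ?K" "B \<in> ?K"
    then obtain C D where CD: "antipode_free C" "antipode_free D" "A = g ` C" "B = g ` D" by blast
    then show "convex_cone hull A \<inter> convex_cone hull B = convex_cone hull (A \<inter> B)"
      using cone_Int_antipode_free[OF CD(1,2)] cone_g[OF CD(1)] cone_g[OF CD(2)]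
        cone_g[OF antipode_free_subset[OF CD(1), of "C \<inter> D"]] gInt[OF CD(1,2)] by simp
  next
    fix y z A assume y: "{y} \<in> ?K" and z: "{z} \<in> ?K" and yz: "{y, z} \<notin> ?K" and A: "A \<in> ?K"
      and nA: "y \<notin> A" "z \<notin> A"
    have vertex: "\<exists>v\<in>V. y = g v" if "{y} \<in> ?K" for y
    proof -
      obtain C where C: "antipode_free C" "g ` C = {y}" using \<open>{y} \<in> ?K\<close> by auto
      then have "C \<noteq> {}" by auto
      then obtain v where "v \<in> C" by blast
      then have "g v \<in> g ` C" by blast
      then show ?thesis using C \<open>v \<in> C\<close> by (auto simp: antipode_free_def)
    qed
    obtain v w where v: "v \<in> V" "y = g v" and w: "w \<in> V" "z = g w"
      using vertex[OF y] vertex[OF z] by (elim bexE)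
    obtain C where C: "antipode_free C" "A = g ` C" using A by blast
    \<comment> \<open>Any two distinct vertices that are not antipodal form an antipode-free set,
      hence an edge of the complex.\<close>
    have "w = \<iota> v"
    proof (rule ccontr)
      assume "w \<noteq> \<iota> v"
      then have "antipode_free {v, w}"
        using v w \<iota>(2)[OF v(1)] \<iota>(2)[OF w(1)] \<iota>(3)[OF w(1)] by (auto simp: antipode_free_def)
      then have "g ` {v, w} \<in> ?K" by blast
      then show False using yz v w by simp
    qed
    moreover have "v \<notin> C" "w \<notin> C" using nA v w C(2) by auto
    moreover have "\<iota> u \<noteq> v" if "u \<in> C" for u
      using \<iota>(3)[of u] that C(1) \<open>w = \<iota> v\<close> \<open>w \<notin> C\<close> by (auto simp: antipode_free_def)
    ultimately have "antipode_free (insert v C)"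
      using C(1) v(1) \<iota>(2)[OF v(1)] by (auto simp: antipode_free_def)
    then have "g ` insert v C \<in> ?K" by blast
    then show "insert y A \<in> ?K" using v C by simp
  qed
  moreover have "spanned_fan P = (\<lambda>A. convex_cone hull A) ` ?K"
    unfolding spanned_fan_eq image_image using cone_g by (intro image_cong) auto
  moreover have "dim L = DIM('a)"
  proof -
    obtain A where A: "antipode_free A" "card A = DIM('a)"
      using antipode_free_extends[of "{}"] by (auto simp: antipode_free_def)
    have "card (g ` A) = DIM('a)"
      using A card_image[OF inj_on_subset[OF inj, of A]] by (simp add: antipode_free_def)
    then show ?thesis using lattice_basis_dim[OF basis[OF A]] by simp
  qed
  ultimately show thesis using that by blast
qed

subsection \<open>Quotient fans\<close>

lemma independent_if_dual_vectors:
  fixes A :: "'a::euclidean_space set"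
  assumes "\<And>a. a \<in> A \<Longrightarrow> \<exists>m. m \<bullet> a = 1 \<and> (\<forall>b\<in>A - {a}. m \<bullet> b = 0)"
  shows "independent A"
  unfolding dependent_def
proof (intro notI, elim bexE)
  fix a assume a: "a \<in> A" "a \<in> span (A - {a})"
  then obtain m where m: "m \<bullet> a = 1" "\<forall>b\<in>A - {a}. m \<bullet> b = 0" using assms by blast
  have "span (A - {a}) \<subseteq> {x. m \<bullet> x = 0}"
    using m(2) by (intro span_minimal subspace_hyperplane) auto
  then show False using m(1) a(2) by auto
qed

text \<open>The sum of the dual vectors of the generators outside \<open>B\<close> is a supporting
  functional that cuts out the cone of \<open>B\<close>.\<close>

lemma cone_face_of_cone:
  fixes A :: "'a::euclidean_space set"
  assumes ind: "independent A" and BA: "B \<subseteq> A"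
  shows "convex_cone hull B face_of convex_cone hull A"
proof -
  have fin: "finite A" using ind by (rule finiteI_independent)
  have "\<exists>m. m \<bullet> s = 1 \<and> (\<forall>b\<in>A - {s}. m \<bullet> b = 0)" if "s \<in> A" for s
    using exists_dual_vector[OF ind that] by metis
  then obtain d where "\<forall>s\<in>A. d s \<bullet> s = 1 \<and> (\<forall>b\<in>A - {s}. d s \<bullet> b = 0)" by metis
  then have d: "d s \<bullet> b = (if b = s then 1 else 0)" if "s \<in> A" "b \<in> A" for s b
    using that by auto
  define m where "m = (\<Sum>s\<in>A - B. d s)"
  have m: "m \<bullet> b = (if b \<in> B then 0 else 1)" if "b \<in> A" for b
  proof -
    have "m \<bullet> b = (\<Sum>s\<in>A - B. if b = s then 1 else 0)"
      unfolding m_def inner_sum_left using that d by (intro sum.cong) auto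
    then show ?thesis using that fin by (simp add: sum.delta)
  qed
  have nonneg: "m \<bullet> v \<ge> 0" if "v \<in> convex_cone hull A" for v
    using inner_nonneg_cone[OF that, of m] m by simp
  have "convex_cone hull A \<inter> {v. m \<bullet> v = 0} face_of convex_cone hull A"
    using nonneg by (intro face_of_Int_supporting_hyperplane_ge convex_convex_cone_hull)
  moreover have "convex_cone hull A \<inter> {v. m \<bullet> v = 0} = convex_cone hull B"
  proof (intro subset_antisym subsetI)
    fix v assume v: "v \<in> convex_cone hull A \<inter> {v. m \<bullet> v = 0}"
    have "v \<in> convex_cone hull (A \<inter> B)"
      by (rule in_cone_of_face[OF fin, of v m]) (use v m in auto)
    then show "v \<in> convex_cone hull B" using BA by (simp add: inf.absorb2)
  next
    fix v assume v: "v \<in> convex_cone hull B"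
    have "0 \<le> m \<bullet> v" "0 \<le> (- m) \<bullet> v"
      by (rule inner_nonneg_cone[OF v]; use m BA in auto)+
    then show "v \<in> convex_cone hull A \<inter> {v. m \<bullet> v = 0}"
      using v hull_mono[OF BA, of convex_cone] by auto
  qed
  ultimately show ?thesis by simp
qed

lemma neg_neq_self: "x \<noteq> 0 \<Longrightarrow> - x \<noteq> x" for x :: "'a::real_vector"
proof
  assume "- x = x"
  then have "2 *\<^sub>R x = 0" by (metis add.left_inverse scaleR_2)
  then show "x \<noteq> 0 \<Longrightarrow> False" by simp
qed

lemma conic_hull_singleton: "conic hull {x} = convex_cone hull {x}"
  by (simp add: convex_cone_hull_separate_nonempty)

lemma linear_perp_proj: "linear (perp_proj x)"
  by (rule linearI) (simp_all add: perp_proj_def inner_add_left algebra_simps add_divide_distrib)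

lemma perp_proj_self [simp]: "perp_proj x x = 0" by (cases "x = 0") (simp_all add: perp_proj_def)

lemma perp_proj_uminus: "perp_proj (- x) = perp_proj x" by (simp add: perp_proj_def fun_eq_iff)

lemma perp_proj_neg_self [simp]: "perp_proj x (- x) = 0"
  using linear_neg[OF linear_perp_proj, of x x] by simp

lemma inner_perp_proj: "m \<bullet> x = 0 \<Longrightarrow> m \<bullet> perp_proj x v = m \<bullet> v"
  by (simp add: perp_proj_def inner_diff_right)

lemma perp_proj_orthogonal: "perp_proj x v \<bullet> x = 0"
  by (cases "x = 0") (simp_all add: perp_proj_def inner_diff_left)

lemma perp_proj_eq_iff: "perp_proj x v = perp_proj x w \<Longrightarrow> \<exists>c. v = w + c *\<^sub>R x"
  by (rule exI[of _ "(v \<bullet> x - w \<bullet> x) / (x \<bullet> x)"])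
    (simp add: perp_proj_def algebra_simps diff_divide_distrib)

lemma dual_monoid_cone:
  "dual_monoid L (convex_cone hull A) = {m \<in> dual_lattice L. \<forall>a\<in>A. 0 \<le> m \<bullet> a}"
proof -
  have "(\<forall>v\<in>convex_cone hull A. 0 \<le> m \<bullet> v) \<longleftrightarrow> (\<forall>a\<in>A. 0 \<le> m \<bullet> a)" for m
    using inner_nonneg_cone[of _ A m] hull_inc[of _ A convex_cone] by meson
  then show ?thesis by (simp add: dual_monoid_def)
qed

context simplicial_fan
begin

lemma complex_independent: "A \<in> K \<Longrightarrow> independent A"
  using extends_to_basis lattice_basis_independent independent_mono by metis

lemma complex_finite: "A \<in> K \<Longrightarrow> finite A"
  using complex_independent finiteI_independent by blast

lemma complex_nonzero: "A \<in> K \<Longrightarrow> a \<in> A \<Longrightarrow> a \<noteq> 0"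
  using complex_independent dependent_zero by blast

lemma empty_complex: "{} \<in> K"
  using complex_nonempty subset_complex by blast

lemma complex_subset_lattice: "A \<in> K \<Longrightarrow> A \<subseteq> L"
  using extends_to_basis lattice_basis_subset by blast

lemma cone_subset_cone_iff:
  assumes "A \<in> K" "B \<in> K"
  shows "convex_cone hull A \<subseteq> convex_cone hull B \<longleftrightarrow> A \<subseteq> B"
proof
  assume *: "convex_cone hull A \<subseteq> convex_cone hull B"
  then have "convex_cone hull A \<subseteq> convex_cone hull (A \<inter> B)" using cone_Int[OF assms] by blast
  then have "A \<subseteq> A \<inter> B"
    using cone_subset_cone_independent[OF complex_independent[OF assms(1)], of A "A \<inter> B"] by blast
  then show "A \<subseteq> B" by blast
qed (rule hull_mono)

lemma cone_eq_cone_iff: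
  "A \<in> K \<Longrightarrow> B \<in> K \<Longrightarrow> convex_cone hull A = convex_cone hull B \<longleftrightarrow> A = B"
  using cone_subset_cone_iff by (metis order_antisym order_refl)

lemma not_both_opposite: "A \<in> K \<Longrightarrow> x \<in> A \<Longrightarrow> - x \<notin> A"
proof
  assume A: "A \<in> K" "x \<in> A" "- x \<in> A"
  obtain m where m: "m \<bullet> x = 1" "\<And>b. b \<in> A - {x} \<Longrightarrow> m \<bullet> b = 0"
    using exists_dual_vector[OF complex_independent[OF A(1)] A(2)] by metis
  have "x \<noteq> 0" by (rule complex_nonzero[OF A(1,2)])
  then have "- x \<noteq> x" by (rule neg_neq_self)
  then show False using m(1) m(2)[of "- x"] A by simp
qed

text \<open>Two notions of primitive generator meet here: \<open>x\<close> generates the lattice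
  points of its ray, whereas the simplex of that ray has an element \<open>a\<close> of a lattice
  basis. So \<open>a\<close> is \<open>n\<close> times \<open>x\<close>, and pairing with the dual
  vector of \<open>a\<close> gives \<open>n * q = 1\<close> with an integer
  \<open>q\<close>.\<close>

lemma ray_generator_vertex:
  assumes "ray_generator L ((\<lambda>A. convex_cone hull A) ` K) x"
  shows "{x} \<in> K"
proof -
  have x: "x \<in> L" "x \<noteq> 0" "\<And>y. y \<in> L \<Longrightarrow> y \<in> conic hull {x} \<Longrightarrow> \<exists>m::nat. y = of_nat m *\<^sub>R x"
    using assms by (auto simp: ray_generator_def)
  obtain A where A: "A \<in> K" "convex_cone hull {x} = convex_cone hull A"
    using assms by (auto simp: ray_generator_def conic_hull_singleton)
  have "x \<in> convex_cone hull A" by (metis A(2) hull_inc insertI1)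
  then have "A \<noteq> {}" using x(2) by auto
  then obtain a where a: "a \<in> A" by blast
  then have "a \<in> convex_cone hull {x}" by (metis A(2) hull_inc)
  moreover have aL: "a \<in> L" using complex_subset_lattice A(1) a by blast
  ultimately obtain n :: nat where n: "a = of_nat n *\<^sub>R x" using x(3) conic_hull_singleton by metis
  obtain B where B: "A \<subseteq> B" "lattice_basis L B" using extends_to_basis[OF A(1)] by blast
  then obtain m where m: "m \<in> dual_lattice L" "m \<bullet> a = 1" using lattice_basis_dual_vector a by (metis subsetD)
  then have "m \<bullet> x \<in> \<int>" using x(1) by (auto simp: dual_lattice_def)
  then obtain q :: int where q: "m \<bullet> x = of_int q" by (auto elim: Ints_cases)
  have "real n * of_int q = 1" using m(2) n q by simp
  then have "int n * q = 1" by (metis of_int_1 of_int_eq_iff of_int_mult of_int_of_nat_eq)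
  then have "int n = 1" using zmult_eq_1_iff[of "int n" q] by linarith
  then have ax: "a = x" using n by simp
  have "convex_cone hull A \<subseteq> convex_cone hull {a}" using A(2) ax by simp
  moreover have "{a} \<in> K" using subset_complex[OF A(1)] a by blast
  ultimately show ?thesis by (simp add: ax)
qed

end

text \<open>One step of the tower: the complex is the suspension, with opposite apices
  \<open>x\<close> and \<open>- x\<close>, of the simplices avoiding both. The bundle of lines is
  constructed from this structure.\<close>

locale fan_suspension = simplicial_fan +
  fixes x
  assumes apex: "{x} \<in> K" "{- x} \<in> K"
    and suspend: "A \<in> K \<Longrightarrow> x \<notin> A \<Longrightarrow> - x \<notin> A \<Longrightarrow> insert x A \<in> K \<and> insert (- x) A \<in> K"

lemma (in crosspolytope_fan) fan_suspensionI:
  assumes "{x} \<in> K" "{- x} \<in> K"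
  shows "fan_suspension L K x"
proof unfold_locales
  have "{x, - x} \<notin> K" "{- x, x} \<notin> K" using not_both_opposite by blast+
  then show "A \<in> K \<Longrightarrow> x \<notin> A \<Longrightarrow> - x \<notin> A \<Longrightarrow> insert x A \<in> K \<and> insert (- x) A \<in> K" for A
    using suspension assms by blast
qed (fact assms)+

text \<open>The exchange property relates any two maximal cones by a chain of wall crossings along which the
  separating characters are coordinate functions; it implies that the toric variety is separated.\<close>

definition (in simplicial_fan) exchange :: bool where
  "exchange \<longleftrightarrow> (\<forall>S\<in>K. \<forall>T\<in>K. lattice_basis L S \<longrightarrow> lattice_basis L T \<longrightarrow> S \<noteq> T \<longrightarrow>
    (\<exists>s\<in>S - T. \<exists>t\<in>T - S. \<exists>m\<in>dual_lattice L. m \<bullet> s = 1 \<and> m \<bullet> t = -1 \<and>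
      (\<forall>a\<in>S - {s}. m \<bullet> a = 0) \<and> (\<forall>a\<in>T - {t}. m \<bullet> a = 0) \<and>
      insert t (S - {s}) \<in> K \<and> insert s (T - {t}) \<in> K))"

section \<open>The link of an apex, the quotient lattice and the quotient complex\<close>

context fan_suspension
begin

text \<open>The link of \<open>x\<close>; in a suspension it is also the link of
  \<open>- x\<close>.\<close>

definition link where "link = {A \<in> K. x \<notin> A \<and> - x \<notin> A}"

definition quotient_complex where "quotient_complex = (\<lambda>A. perp_proj x ` A) ` link"

definition quotient_lattice where "quotient_lattice = perp_proj x ` L"

lemma x_nonzero: "x \<noteq> 0" using complex_nonzero[OF apex(1)] by simp

lemma x_neq_neg: "- x \<noteq> x" "x \<noteq> - x"
proof -
  show "- x \<noteq> x" using x_nonzero by (rule neg_neq_self)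
  then show "x \<noteq> - x" by metis
qed

lemma fan_suspension_uminus: "fan_suspension L K (- x)"
  by unfold_locales (use apex suspend in auto)

lemma x_in_lattice: "x \<in> L" using complex_subset_lattice[OF apex(1)] by simp

text \<open>Otherwise \<open>x\<close> could be added to a simplex that already spans the lattice,
  against independence.\<close>

lemma basis_contains_apex:
  assumes "S \<in> K" "lattice_basis L S"
  shows "x \<in> S \<or> - x \<in> S"
proof (rule ccontr)
  assume "\<not> (x \<in> S \<or> - x \<in> S)"
  then have n: "x \<notin> S" "insert x S \<in> K" using suspend assms(1) by blast+
  then have "x \<notin> span S" using complex_independent[OF n(2)] by (simp add: independent_insert)
  moreover have "x \<in> span S"
    using x_in_lattice lattice_basis_span[OF assms(2)] span_base by blast
  ultimately show False by blast
qed

lemma linkD: "A \<in> link \<Longrightarrow> A \<in> K" "A \<in> link \<Longrightarrow> x \<notin> A" "A \<in> link \<Longrightarrow> - x \<notin> A"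
  "A \<in> link \<Longrightarrow> insert x A \<in> K" "A \<in> link \<Longrightarrow> insert (- x) A \<in> K"
  using suspend by (auto simp: link_def)

lemma link_subset: "A \<in> link \<Longrightarrow> B \<subseteq> A \<Longrightarrow> B \<in> link"
  using subset_complex by (auto simp: link_def)

lemma link_Diff: "A \<in> K \<Longrightarrow> A - {x, - x} \<in> link"
  using subset_complex[of A "A - {x, - x}"] by (auto simp: link_def)

text \<open>Vertices with equal projections differ by a multiple of \<open>x\<close>, nonnegative
  after exchanging them if necessary. Then one vertex lies in the cone of the other and
  \<open>x\<close>, which \<open>cone_Int\<close> permits only if they coincide.\<close>

lemma perp_proj_vertex_inj:
  assumes a: "{a} \<in> link" and b: "{b} \<in> link" and ab: "perp_proj x a = perp_proj x b"
  shows "a = b"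
proof -
  have *: "a = b" if a: "{a} \<in> link" and b: "{b} \<in> link" and ab: "a = b + c *\<^sub>R x" "0 \<le> c" for a b c
  proof (rule ccontr)
    assume "a \<noteq> b"
    have "a \<in> convex_cone hull {a}" by (simp add: hull_inc)
    moreover have "a \<in> convex_cone hull {x, b}"
      unfolding ab(1) using ab(2) by (intro convex_cone_hull_add convex_cone_hull_mul hull_inc) auto
    ultimately have "a \<in> convex_cone hull ({a} \<inter> {x, b})"
      using cone_Int[OF linkD(1)[OF a] linkD(4)[OF b]] by blast
    moreover have "{a} \<inter> {x, b} = {}" using \<open>a \<noteq> b\<close> linkD(2)[OF a] by auto
    ultimately have "a = 0" by simp
    then show False using complex_nonzero[OF linkD(1)[OF a]] by simp
  qed
  obtain c where c: "a = b + c *\<^sub>R x" using perp_proj_eq_iff[OF ab] by blast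
  then have "b = a + (- c) *\<^sub>R x" by simp
  then show ?thesis using *[OF a b c] *[OF b a, of "- c"] by (metis le_cases neg_0_le_iff_le)
qed

lemma perp_proj_inj_on: "inj_on (perp_proj x) {v. {v} \<in> link}"
  by (rule inj_onI) (use perp_proj_vertex_inj in blast)

lemma link_vertices: "A \<in> link \<Longrightarrow> A \<subseteq> {v. {v} \<in> link}"
  using link_subset by blast

lemma perp_proj_image_Int:
  "A \<in> link \<Longrightarrow> B \<in> link \<Longrightarrow> perp_proj x ` A \<inter> perp_proj x ` B = perp_proj x ` (A \<inter> B)"
  by (rule inj_on_image_Int[OF perp_proj_inj_on, symmetric]) (auto dest: link_vertices)

lemma perp_proj_image_eq:
  "A \<in> link \<Longrightarrow> B \<in> link \<Longrightarrow> perp_proj x ` A = perp_proj x ` B \<longleftrightarrow> A = B"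
  by (rule inj_on_image_eq_iff[OF perp_proj_inj_on]) (auto dest: link_vertices)

text \<open>The span of the quotient lattice is the orthogonal complement of \<open>x\<close> in
  \<open>span L\<close>. Hence characters of the base are characters of the total space, with no
  identification in between.\<close>

lemma dual_quotient_lattice: "dual_lattice quotient_lattice = {m \<in> dual_lattice L. m \<bullet> x = 0}"
proof -
  have span: "span quotient_lattice = perp_proj x ` span L"
    unfolding quotient_lattice_def by (rule linear_span_image[OF linear_perp_proj])
  have sub: "perp_proj x ` span L \<subseteq> span L"
    by (auto simp: perp_proj_def span_base[OF x_in_lattice] intro!: span_diff span_scale)
  show ?thesis
  proof (intro subset_antisym subsetI)
    fix m assume m: "m \<in> dual_lattice quotient_lattice"
    then have "m \<in> perp_proj x ` span L" by (simp add: dual_lattice_def span)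
    then have mx: "m \<bullet> x = 0" using perp_proj_orthogonal by auto
    moreover have "m \<bullet> v \<in> \<int>" if "v \<in> L" for v
    proof -
      have "m \<bullet> perp_proj x v \<in> \<int>" using m that by (auto simp: dual_lattice_def quotient_lattice_def)
      then show ?thesis using inner_perp_proj[OF mx] by simp
    qed
    ultimately show "m \<in> {m \<in> dual_lattice L. m \<bullet> x = 0}"
      using sub \<open>m \<in> perp_proj x ` span L\<close> by (auto simp: dual_lattice_def)
  next
    fix m assume m: "m \<in> {m \<in> dual_lattice L. m \<bullet> x = 0}"
    then have "perp_proj x m = m" by (simp add: perp_proj_def)
    then have "m \<in> span quotient_lattice" unfolding span using m by (metis (mono_tags, lifting) dual_lattice_def image_eqI mem_Collect_eq)
    then show "m \<in> dual_lattice quotient_lattice"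
      using m by (auto simp: dual_lattice_def quotient_lattice_def inner_perp_proj)
  qed
qed

text \<open>The dual vectors of the other basis elements are orthogonal to \<open>x\<close>, so they
  remain dual to the projected elements.\<close>

lemma quotient_basis_apex:
  assumes B: "lattice_basis L B" "x \<in> B"
  shows "lattice_basis quotient_lattice (perp_proj x ` (B - {x}))"
proof -
  have fin: "finite B" by (rule lattice_basis_finite[OF B(1)])
  have dual: "\<exists>m. m \<bullet> perp_proj x b = 1 \<and> (\<forall>b'\<in>B - {x} - {b}. m \<bullet> perp_proj x b' = 0)" if b: "b \<in> B - {x}" for b
  proof -
    obtain m where m: "m \<bullet> b = 1" "\<And>b'. b' \<in> B - {b} \<Longrightarrow> m \<bullet> b' = 0"
      using lattice_basis_dual_vector[OF B(1), of b] b by (metis DiffE)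
    have "m \<bullet> x = 0" using m(2) B(2) b by blast
    then show ?thesis using m by (intro exI[of _ m]) (simp add: inner_perp_proj)
  qed
  have inj: "inj_on (perp_proj x) (B - {x})"
  proof (rule inj_onI, rule ccontr)
    fix a b assume ab: "a \<in> B - {x}" "b \<in> B - {x}" "perp_proj x a = perp_proj x b" "a \<noteq> b"
    then show False using dual[of a] by force
  qed
  show ?thesis
    unfolding lattice_basis_def
  proof
    show "independent (perp_proj x ` (B - {x}))"
      using dual by (intro independent_if_dual_vectors) blast
    show "quotient_lattice = {\<Sum>b\<in>perp_proj x ` (B - {x}). of_int (c b) *\<^sub>R b | c :: 'a \<Rightarrow> int. True}"
    proof (intro subset_antisym subsetI)
      fix v assume "v \<in> quotient_lattice"
      then obtain l where l: "l \<in> L" "v = perp_proj x l" unfolding quotient_lattice_def by blast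
      then obtain c :: "'a \<Rightarrow> int" where v: "v = perp_proj x (\<Sum>b\<in>B. of_int (c b) *\<^sub>R b)"
        using lattice_basis_elem[OF B(1)] by metis
      have "v = (\<Sum>b\<in>B. of_int (c b) *\<^sub>R perp_proj x b)"
        unfolding v by (simp add: linear_sum[OF linear_perp_proj] linear_scale[OF linear_perp_proj])
      also have "\<dots> = (\<Sum>b\<in>B - {x}. of_int (c b) *\<^sub>R perp_proj x b)"
        using fin by (intro sum.mono_neutral_right) auto
      also have "\<dots> = (\<Sum>b\<in>perp_proj x ` (B - {x}). of_int (c (inv_into (B - {x}) (perp_proj x) b)) *\<^sub>R b)"
        by (simp add: sum.reindex[OF inj] inv_into_f_f[OF inj])
      finally show "v \<in> {\<Sum>b\<in>perp_proj x ` (B - {x}). of_int (c b) *\<^sub>R b | c :: 'a \<Rightarrow> int. True}"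
        by (intro CollectI exI[of _ "\<lambda>b. c (inv_into (B - {x}) (perp_proj x) b)"] conjI TrueI)
    next
      fix v assume "v \<in> {\<Sum>b\<in>perp_proj x ` (B - {x}). of_int (c b) *\<^sub>R b | c :: 'a \<Rightarrow> int. True}"
      then obtain c :: "'a \<Rightarrow> int" where v: "v = (\<Sum>b\<in>perp_proj x ` (B - {x}). of_int (c b) *\<^sub>R b)" by blast
      have "v = (\<Sum>b\<in>B - {x}. of_int (c (perp_proj x b)) *\<^sub>R perp_proj x b)"
        unfolding v by (simp add: sum.reindex[OF inj])
      also have "\<dots> = (\<Sum>b\<in>B. of_int (c (perp_proj x b)) *\<^sub>R perp_proj x b)"
        using fin by (intro sum.mono_neutral_left) auto
      also have "\<dots> = perp_proj x (\<Sum>b\<in>B. of_int (c (perp_proj x b)) *\<^sub>R b)"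
        by (simp add: linear_sum[OF linear_perp_proj] linear_scale[OF linear_perp_proj])
      finally have "v = perp_proj x (\<Sum>b\<in>B. of_int (c (perp_proj x b)) *\<^sub>R b)" .
      moreover have "(\<Sum>b\<in>B. of_int (c (perp_proj x b)) *\<^sub>R b) \<in> L"
        unfolding lattice_basis_elem[OF B(1)] by (intro exI[of _ "\<lambda>b. c (perp_proj x b)"] refl)
      ultimately show "v \<in> quotient_lattice" by (simp add: quotient_lattice_def)
    qed
  qed
qed

lemma quotient_basis:
  assumes S: "S \<in> K" "lattice_basis L S"
  shows "lattice_basis quotient_lattice (perp_proj x ` (S - {x, - x}))"
proof -
  \<comment> \<open>The projections along \<open>x\<close> and \<open>- x\<close> are the same map,
    so a simplex containing \<open>- x\<close> is covered by exchanging the apices.\<close>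
  interpret neg: fan_suspension L K "- x" by (rule fan_suspension_uminus)
  have neg: "neg.quotient_lattice = quotient_lattice"
    by (simp add: neg.quotient_lattice_def quotient_lattice_def perp_proj_uminus)
  from basis_contains_apex[OF S] show ?thesis
  proof
    assume "x \<in> S"
    then have "S - {x, - x} = S - {x}" using not_both_opposite[OF S(1)] by blast
    then show ?thesis using quotient_basis_apex[OF S(2) \<open>x \<in> S\<close>] by simp
  next
    assume "- x \<in> S"
    then have "S - {x, - x} = S - {- x}" using not_both_opposite[OF S(1)] by auto
    then show ?thesis using neg.quotient_basis_apex[OF S(2) \<open>- x \<in> S\<close>] by (simp add: neg perp_proj_uminus)
  qed
qed

lemma quotient_simplicial_fan: "simplicial_fan quotient_lattice quotient_complex"
proof unfold_locales
  show "finite quotient_complex" using finite_complex by (simp add: quotient_complex_def link_def)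
  show "quotient_complex \<noteq> {}" using link_Diff[OF apex(1)] by (auto simp: quotient_complex_def)
next
  fix A B assume "A \<in> quotient_complex" "B \<subseteq> A"
  then obtain C where C: "C \<in> link" "B \<subseteq> perp_proj x ` C" by (auto simp: quotient_complex_def)
  then obtain D where "D \<subseteq> C" "B = perp_proj x ` D" by (meson subset_imageE)
  then show "B \<in> quotient_complex" using C link_subset by (auto simp: quotient_complex_def)
next
  fix A assume "A \<in> quotient_complex"
  then obtain C where C: "C \<in> link" "A = perp_proj x ` C" by (auto simp: quotient_complex_def)
  obtain S where S: "S \<in> K" "C \<subseteq> S" "lattice_basis L S" using extends_to_basis[OF linkD(1)[OF C(1)]] by blast
  have "C \<subseteq> S - {x, - x}" using S(2) linkD[OF C(1)] by blast
  then show "\<exists>B\<in>quotient_complex. A \<subseteq> B \<and> lattice_basis quotient_lattice B"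
    using quotient_basis[OF S(1,3)] link_Diff[OF S(1)] C(2)
    by (intro bexI[of _ "perp_proj x ` (S - {x, - x})"]) (auto simp: quotient_complex_def)
next
  fix A B assume "A \<in> quotient_complex" "B \<in> quotient_complex"
  then obtain C D where C: "C \<in> link" "A = perp_proj x ` C" and D: "D \<in> link" "B = perp_proj x ` D"
    by (auto simp: quotient_complex_def)
  have cone_image: "convex_cone hull (perp_proj x ` E) = perp_proj x ` (convex_cone hull E)" for E
    by (rule convex_cone_hull_linear_image[OF linear_perp_proj])
  \<comment> \<open>Points with the same projection differ by a multiple of \<open>x\<close>,
    nonnegative up to symmetry. The larger one lies in the cones of \<open>C\<close> and of
    \<open>insert x D\<close>, and \<open>x\<close> is not in \<open>C\<close>.\<close>
  have key: "v \<in> convex_cone hull (C \<inter> D)"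
    if "C \<in> link" "D \<in> link" "v \<in> convex_cone hull C" "w \<in> convex_cone hull D" "v = w + c *\<^sub>R x" "0 \<le> c" for C D v w c
  proof -
    have "w \<in> convex_cone hull (insert x D)" using that(4) hull_mono[of D "insert x D"] by blast
    then have "v \<in> convex_cone hull (insert x D)"
      unfolding that(5) using that(6) hull_inc[of x "insert x D" convex_cone]
      by (simp add: convex_cone_hull_add convex_cone_hull_mul)
    then have "v \<in> convex_cone hull (C \<inter> insert x D)"
      using cone_Int[OF linkD(1)[OF that(1)] linkD(4)[OF that(2)]] that(3) by blast
    moreover have "C \<inter> insert x D = C \<inter> D" using linkD(2)[OF that(1)] by blast
    ultimately show ?thesis by simp
  qed
  have "convex_cone hull A \<inter> convex_cone hull B \<subseteq> convex_cone hull (A \<inter> B)"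
  proof
    fix u assume "u \<in> convex_cone hull A \<inter> convex_cone hull B"
    then obtain v w where vw: "v \<in> convex_cone hull C" "w \<in> convex_cone hull D" "u = perp_proj x v" "u = perp_proj x w"
      unfolding C(2) D(2) cone_image by blast
    then obtain c where c: "v = w + c *\<^sub>R x" using perp_proj_eq_iff[of x v w] by metis
    have "\<exists>y\<in>convex_cone hull (C \<inter> D). u = perp_proj x y"
    proof (cases "0 \<le> c")
      case True
      then show ?thesis using key[OF C(1) D(1) vw(1,2) c] vw(3) by blast
    next
      case False
      then show ?thesis using key[OF D(1) C(1) vw(2,1), of "- c"] c vw(4) by (auto simp: Int_commute)
    qed
    then have "u \<in> perp_proj x ` (convex_cone hull (C \<inter> D))" by blast
    then show "u \<in> convex_cone hull (A \<inter> B)"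
      unfolding C(2) D(2) perp_proj_image_Int[OF C(1) D(1)] cone_image .
  qed
  then show "convex_cone hull A \<inter> convex_cone hull B = convex_cone hull (A \<inter> B)"
    by (simp add: subset_antisym hull_mono)
qed

text \<open>Since \<open>x\<close> projects to 0, a cone with generator \<open>x\<close> has the
  same projection as its part in the link.\<close>

lemma quotient_fan:
  "{perp_proj x ` \<sigma> | \<sigma>. \<sigma> \<in> (\<lambda>A. convex_cone hull A) ` K \<and> conic hull {x} face_of \<sigma>} =
    (\<lambda>A. convex_cone hull A) ` quotient_complex"
proof (intro subset_antisym subsetI)
  have cone_image: "convex_cone hull (perp_proj x ` E) = perp_proj x ` (convex_cone hull E)" for E
    by (rule convex_cone_hull_linear_image[OF linear_perp_proj])
  have drop: "perp_proj x ` (convex_cone hull (insert x E)) = convex_cone hull (perp_proj x ` E)" for E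
    unfolding cone_image[symmetric] by (simp add: hull_redundant convex_cone_hull_contains_0)
  {
    fix \<tau> assume "\<tau> \<in> {perp_proj x ` \<sigma> | \<sigma>. \<sigma> \<in> (\<lambda>A. convex_cone hull A) ` K \<and> conic hull {x} face_of \<sigma>}"
    then obtain A where A: "A \<in> K" "convex_cone hull {x} face_of convex_cone hull A"
      "\<tau> = perp_proj x ` (convex_cone hull A)" by (auto simp: conic_hull_singleton)
    then have "{x} \<subseteq> A" using cone_subset_cone_iff[OF apex(1) A(1)] face_of_imp_subset by blast
    then have "insert x (A - {x, - x}) = A" using not_both_opposite[OF A(1)] by blast
    then have "\<tau> = convex_cone hull (perp_proj x ` (A - {x, - x}))" using A(3) drop by metis
    then show "\<tau> \<in> (\<lambda>A. convex_cone hull A) ` quotient_complex"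
      using link_Diff[OF A(1)] by (auto simp: quotient_complex_def)
  }
  fix \<tau> assume "\<tau> \<in> (\<lambda>A. convex_cone hull A) ` quotient_complex"
  then obtain A where A: "A \<in> link" "\<tau> = convex_cone hull (perp_proj x ` A)"
    by (auto simp: quotient_complex_def)
  have "convex_cone hull {x} face_of convex_cone hull (insert x A)"
    using complex_independent[OF linkD(4)[OF A(1)]] by (intro cone_face_of_cone) auto
  then show "\<tau> \<in> {perp_proj x ` \<sigma> | \<sigma>. \<sigma> \<in> (\<lambda>A. convex_cone hull A) ` K \<and> conic hull {x} face_of \<sigma>}"
    using linkD(4)[OF A(1)] A(2) drop[of A] by (auto simp: conic_hull_singleton)
qed

lemma quotient_dim:
  shows "dim L = Suc (dim quotient_lattice)"
proof -
  obtain S where S: "S \<in> K" "{x} \<subseteq> S" "lattice_basis L S" using extends_to_basis[OF apex(1)] by blast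
  have "S - {x, - x} = S - {x}" using not_both_opposite[OF S(1)] S(2) by blast
  moreover have "card (perp_proj x ` (S - {x, - x})) = card (S - {x, - x})"
    using link_vertices[OF link_Diff[OF S(1)]] inj_on_subset[OF perp_proj_inj_on] card_image by blast
  ultimately have "dim quotient_lattice = card (S - {x})"
    using lattice_basis_dim[OF quotient_basis[OF S(1,3)]] by simp
  moreover have "card S = Suc (card (S - {x}))"
    using S(2) complex_finite[OF S(1)] by (metis card.remove insert_subset)
  ultimately show ?thesis using lattice_basis_dim[OF S(3)] by simp
qed

text \<open>If \<open>S\<close> and \<open>T\<close> agree away from the apices, they are opposite
  across one wall and the dual vector of the apex serves as \<open>m\<close>. Otherwise the exchange
  found in the quotient is used: its \<open>m\<close> is orthogonal to \<open>x\<close>, so it keeps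
  its values on the vertices of the link and vanishes on both apices.\<close>

lemma exchange_lift:
  assumes "simplicial_fan.exchange quotient_lattice quotient_complex"
  shows exchange
  unfolding exchange_def
proof (intro ballI impI)
  interpret Q: simplicial_fan quotient_lattice quotient_complex by (rule quotient_simplicial_fan)
  fix S T assume S: "S \<in> K" "lattice_basis L S" and T: "T \<in> K" "lattice_basis L T" and ST: "S \<noteq> T"
  let ?S = "S - {x, - x}" and ?T = "T - {x, - x}"
  have apex_in: "\<exists>e\<in>{x, - x}. S = insert e (S - {x, - x})" if "S \<in> K" "lattice_basis L S" for S
    using basis_contains_apex[OF that] not_both_opposite[OF that(1)] not_both_opposite[OF that(1), of "- x"]
    by auto
  obtain e where e: "e \<in> {x, - x}" "S = insert e ?S" using apex_in[OF S] by blast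
  obtain f where f: "f \<in> {x, - x}" "T = insert f ?T" using apex_in[OF T] by blast
  show "\<exists>s\<in>S - T. \<exists>t\<in>T - S. \<exists>m\<in>dual_lattice L. m \<bullet> s = 1 \<and> m \<bullet> t = -1 \<and>
      (\<forall>a\<in>S - {s}. m \<bullet> a = 0) \<and> (\<forall>a\<in>T - {t}. m \<bullet> a = 0) \<and>
      insert t (S - {s}) \<in> K \<and> insert s (T - {t}) \<in> K"
  proof (cases "?S = ?T")
    case True
    then have "e \<noteq> f" using e(2) f(2) ST by metis
    then have ef: "f = - e" "e \<noteq> f" using e(1) f(1) by auto
    have eS: "e \<in> S" and fT: "f \<in> T" using e(2) f(2) by blast+
    have "e \<notin> ?S" "f \<notin> ?T" using e(1) f(1) by blast+
    then have "S - {e} = ?S" "T - {f} = ?T" using Diff_insert_absorb e(2) f(2) by metis+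
    then have Te: "T - {f} = S - {e}" using True by simp
    obtain m where m: "m \<in> dual_lattice L" "m \<bullet> e = 1" "\<And>b. b \<in> S - {e} \<Longrightarrow> m \<bullet> b = 0"
      using lattice_basis_dual_vector[OF S(2) eS] by metis
    have "e \<notin> T" "f \<notin> S" using not_both_opposite[OF S(1) eS] not_both_opposite[OF T(1) fT] ef(1) by auto
    moreover have "insert f (S - {e}) = T" "insert e (T - {f}) = S" using Te eS fT by (metis insert_Diff)+
    moreover have "m \<bullet> f = -1" using m(2) ef(1) by simp
    moreover have "\<forall>a\<in>T - {f}. m \<bullet> a = 0" unfolding Te using m(3) by blast
    ultimately show ?thesis using m eS fT S(1) T(1)
      by (intro bexI[of _ e] bexI[of _ f] bexI[of _ m] conjI ballI) simp_all
  next
    case False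
    have lS: "?S \<in> link" and lT: "?T \<in> link" using link_Diff S(1) T(1) by blast+
    have "perp_proj x ` ?S \<noteq> perp_proj x ` ?T" using perp_proj_image_eq[OF lS lT] False by blast
    moreover have "perp_proj x ` ?S \<in> quotient_complex" "perp_proj x ` ?T \<in> quotient_complex"
      using lS lT by (auto simp: quotient_complex_def)
    ultimately obtain s' t' m where st': "s' \<in> perp_proj x ` ?S - perp_proj x ` ?T"
      "t' \<in> perp_proj x ` ?T - perp_proj x ` ?S" and m: "m \<in> dual_lattice quotient_lattice"
      "m \<bullet> s' = 1" "m \<bullet> t' = -1" "\<forall>a\<in>perp_proj x ` ?S - {s'}. m \<bullet> a = 0" "\<forall>a\<in>perp_proj x ` ?T - {t'}. m \<bullet> a = 0"
      and flip: "insert t' (perp_proj x ` ?S - {s'}) \<in> quotient_complex"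
      "insert s' (perp_proj x ` ?T - {t'}) \<in> quotient_complex"
      using assms[unfolded Q.exchange_def, rule_format, OF _ _ quotient_basis[OF S] quotient_basis[OF T]]
      by metis
    obtain s t where s: "s \<in> ?S" "s' = perp_proj x s" and t: "t \<in> ?T" "t' = perp_proj x t"
      using st' by blast
    have mL: "m \<in> dual_lattice L" "m \<bullet> x = 0" using m(1) by (simp_all add: dual_quotient_lattice)
    have mp: "m \<bullet> perp_proj x a = m \<bullet> a" for a using inner_perp_proj[OF mL(2)] .
    have sT: "s \<in> S - T" and tS: "t \<in> T - S" using s t st' by auto
    have remove: "perp_proj x ` U - {perp_proj x u} = perp_proj x ` (U - {u})" if "U \<in> link" "u \<in> U" for U u
      using inj_on_image_set_diff[OF perp_proj_inj_on, of U "{u}"] link_vertices[OF that(1)] that(2) by auto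
    have zero: "m \<bullet> a = 0" if "a \<in> insert e (U - {u})" "e \<in> {x, - x}" "U \<in> link" "u \<in> U"
        "\<forall>a\<in>perp_proj x ` U - {perp_proj x u}. m \<bullet> a = 0" for a e u U
      using that mL(2) mp by (auto simp: remove)
    \<comment> \<open>A flipped simplex of the quotient comes from some simplex of the link;
      injectivity of the projection on link vertices shows that it is the expected one.\<close>
    have "\<exists>V\<in>link. insert (perp_proj x u) (perp_proj x ` (U - {w})) = perp_proj x ` V \<Longrightarrow> insert u (U - {w}) \<in> link"
      if uU: "{u} \<in> link" "U \<in> link" for u w U
    proof -
      assume "\<exists>V\<in>link. insert (perp_proj x u) (perp_proj x ` (U - {w})) = perp_proj x ` V"
      then obtain V where V: "V \<in> link" "perp_proj x ` insert u (U - {w}) = perp_proj x ` V" by auto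
      then have "insert u (U - {w}) = V"
        using inj_on_image_eq_iff[OF perp_proj_inj_on, of "insert u (U - {w})" V] uU link_vertices[OF uU(2)]
          link_vertices[OF V(1)] by blast
      then show "insert u (U - {w}) \<in> link" using V(1) by simp
    qed
    note lift = this
    have l1: "insert t (?S - {s}) \<in> link"
      using flip(1) s t link_subset[OF lT, of "{t}"] remove[OF lS s(1)] lS
      by (intro lift) (auto simp: quotient_complex_def)
    have l2: "insert s (?T - {t}) \<in> link"
      using flip(2) s t link_subset[OF lS, of "{s}"] remove[OF lT t(1)] lT
      by (intro lift) (auto simp: quotient_complex_def)
    have "insert e (insert t (?S - {s})) \<in> K" "insert f (insert s (?T - {t})) \<in> K"
      using linkD(4,5)[OF l1] linkD(4,5)[OF l2] e(1) f(1) by auto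
    moreover have Se: "S - {s} = insert e (?S - {s})"
      using e(1) s(1) by (subst e(2)) auto
    moreover have Tf: "T - {t} = insert f (?T - {t})"
      using f(1) t(1) by (subst f(2)) auto
    ultimately have "insert t (S - {s}) \<in> K" "insert s (T - {t}) \<in> K" by (simp_all add: insert_commute)
    moreover have "\<forall>a\<in>S - {s}. m \<bullet> a = 0" "\<forall>a\<in>T - {t}. m \<bullet> a = 0"
      unfolding Se Tf using zero[OF _ e(1) lS s(1)] zero[OF _ f(1) lT t(1)] m(4,5) s(2) t(2) by blast+
    ultimately show ?thesis
      using sT tS mL(1) m(2,3) mp s(2) t(2) by (intro bexI[of _ s] bexI[of _ t] bexI[of _ m]) auto
  qed
qed

end

text \<open>The link contains every simplex of \<open>K\<close> avoiding both apices. So link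
  vertices whose images are not joined in the quotient are not joined in \<open>K\<close> either,
  and the suspension property of \<open>K\<close> applies to them.\<close>

lemma crosspolytope_fan_quotient:
  assumes "crosspolytope_fan L K" "fan_suspension L K x"
  shows "crosspolytope_fan (fan_suspension.quotient_lattice L x) (fan_suspension.quotient_complex K x)"
proof -
  interpret crosspolytope_fan L K by fact
  interpret fan_suspension L K x by fact
  interpret Q: simplicial_fan quotient_lattice quotient_complex by (rule quotient_simplicial_fan)
  show ?thesis
  proof unfold_locales
    fix y z A
    assume y: "{y} \<in> quotient_complex" and z: "{z} \<in> quotient_complex" and yz: "{y, z} \<notin> quotient_complex"
      and A: "A \<in> quotient_complex" and nA: "y \<notin> A" "z \<notin> A"
    have vertex: "\<exists>v. {v} \<in> link \<and> y = perp_proj x v" if "{y} \<in> quotient_complex" for y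
    proof -
      obtain C where C: "{y} = perp_proj x ` C" "C \<in> link"
        using \<open>{y} \<in> quotient_complex\<close> unfolding quotient_complex_def by (rule imageE)
      have "y \<in> perp_proj x ` C" using C(1) by (metis singletonI)
      then obtain v where v: "y = perp_proj x v" "v \<in> C" by (rule imageE)
      then show ?thesis using link_subset[OF C(2), of "{v}"] by blast
    qed
    obtain v where v: "{v} \<in> link" "y = perp_proj x v" using vertex[OF y] by blast
    obtain w where w: "{w} \<in> link" "z = perp_proj x w" using vertex[OF z] by blast
    obtain C where C: "C \<in> link" "A = perp_proj x ` C" using A by (auto simp: quotient_complex_def)
    have "{v, w} \<notin> K"
    proof
      assume "{v, w} \<in> K"
      then have "{v, w} \<in> link" using linkD[OF v(1)] linkD[OF w(1)] by (auto simp: link_def)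
      then have "perp_proj x ` {v, w} \<in> quotient_complex" unfolding quotient_complex_def by blast
      then show False using yz v w by simp
    qed
    moreover have "v \<notin> C" "w \<notin> C" using nA v w C(2) by auto
    ultimately have "insert v C \<in> K" using suspension linkD(1) v(1) w(1) C(1) by blast
    then have "insert v C \<in> link" using linkD[OF v(1)] linkD[OF C(1)] by (auto simp: link_def)
    then have "perp_proj x ` insert v C \<in> quotient_complex" unfolding quotient_complex_def by blast
    then show "insert y A \<in> quotient_complex" using v(2) C(2) by simp
  qed
qed

subsection \<open>Points and characters of a toric variety\<close>

lemma dual_lattice_0 [simp]: "0 \<in> dual_lattice L"
  by (simp add: dual_lattice_def span_zero)

lemma dual_lattice_add: "m \<in> dual_lattice L \<Longrightarrow> m' \<in> dual_lattice L \<Longrightarrow> m + m' \<in> dual_lattice L"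
  by (auto simp: dual_lattice_def inner_add_left intro: span_add)

lemma dual_lattice_uminus: "m \<in> dual_lattice L \<Longrightarrow> - m \<in> dual_lattice L"
  by (auto simp: dual_lattice_def intro: span_neg)

lemma dual_lattice_diff: "m \<in> dual_lattice L \<Longrightarrow> m' \<in> dual_lattice L \<Longrightarrow> m - m' \<in> dual_lattice L"
  using dual_lattice_add[of m L "- m'"] dual_lattice_uminus by fastforce

lemma dual_lattice_scale: "m \<in> dual_lattice L \<Longrightarrow> of_int k *\<^sub>R m \<in> dual_lattice L"
  by (auto simp: dual_lattice_def intro: span_scale Ints_mult)

lemma dual_lattice_sum: "(\<And>i. i \<in> I \<Longrightarrow> f i \<in> dual_lattice L) \<Longrightarrow> sum f I \<in> dual_lattice L"
  by (induction I rule: infinite_finite_induct) (auto intro: dual_lattice_add)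

context simplicial_fan
begin

abbreviation "hcone A \<equiv> convex_cone hull A"

definition "fan_of = (\<lambda>A. convex_cone hull A) ` K"

definition "mon A = {m \<in> dual_lattice L. \<forall>a\<in>A. 0 \<le> m \<bullet> a}"

definition "homs A = affine_toric L (hcone A)"

lemma mon_eq: "dual_monoid L (hcone A) = mon A"
  by (simp add: mon_def dual_monoid_cone)

lemma mon_antimono: "B \<subseteq> A \<Longrightarrow> mon A \<subseteq> mon B" by (auto simp: mon_def)

lemma mon_0 [simp]: "0 \<in> mon A" by (simp add: mon_def)

lemma mon_add: "m \<in> mon A \<Longrightarrow> m' \<in> mon A \<Longrightarrow> m + m' \<in> mon A"
  by (auto simp: mon_def inner_add_left intro: dual_lattice_add)

lemma mon_dual: "m \<in> mon A \<Longrightarrow> m \<in> dual_lattice L" by (simp add: mon_def)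

lemma mon_uminus: "m \<in> mon A \<Longrightarrow> (\<And>b. b \<in> B \<Longrightarrow> m \<bullet> b = 0) \<Longrightarrow> - m \<in> mon B"
  by (auto simp: mon_def intro: dual_lattice_uminus)

lemma homs_iff: "\<gamma> \<in> homs A \<longleftrightarrow> \<gamma> \<in> extensional (mon A) \<and> \<gamma> 0 = 1 \<and>
    (\<forall>m\<in>mon A. \<forall>m'\<in>mon A. \<gamma> (m + m') = \<gamma> m * \<gamma> m')"
  by (simp add: homs_def affine_toric_def mon_eq)

lemma homs_restrict:
  assumes "\<delta> \<in> homs B" "B \<subseteq> A"
  shows "restrict \<delta> (mon A) \<in> homs A"
  using assms mon_antimono[OF assms(2)] by (auto simp: homs_iff mon_add subset_iff)

lemma homs_add: "\<gamma> \<in> homs A \<Longrightarrow> m \<in> mon A \<Longrightarrow> m' \<in> mon A \<Longrightarrow> \<gamma> (m + m') = \<gamma> m * \<gamma> m'"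
  by (simp add: homs_iff)

lemma homs_0: "\<gamma> \<in> homs A \<Longrightarrow> \<gamma> 0 = 1" by (simp add: homs_iff)

text \<open>A character orthogonal to all generators is invertible in the monoid.\<close>

lemma homs_unit:
  assumes "\<delta> \<in> homs B" "\<nu> \<in> mon B" "\<And>b. b \<in> B \<Longrightarrow> \<nu> \<bullet> b = 0"
  shows "\<delta> \<nu> \<noteq> 0"
  using homs_add[OF assms(1,2) mon_uminus[OF assms(2,3)]] homs_0[OF assms(1)] by auto

lemma dual_functions:
  assumes "A \<in> K"
  obtains d where "\<And>a. a \<in> A \<Longrightarrow> d a \<in> dual_lattice L"
    "\<And>a b. a \<in> A \<Longrightarrow> b \<in> A \<Longrightarrow> d a \<bullet> b = (if b = a then 1 else 0)"
proof -
  obtain B where B: "A \<subseteq> B" "lattice_basis L B" using extends_to_basis[OF assms] by blast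
  have "\<exists>m. m \<in> dual_lattice L \<and> (\<forall>b\<in>A. m \<bullet> b = (if b = a then 1 else 0))" if "a \<in> A" for a
  proof -
    have "a \<in> B" using that B(1) by blast
    then obtain m where "m \<in> dual_lattice L" "m \<bullet> a = 1" "\<And>b'. b' \<in> B - {a} \<Longrightarrow> m \<bullet> b' = 0"
      using lattice_basis_dual_vector[OF B(2)] by metis
    then show ?thesis using B(1) by (intro exI[of _ m]) auto
  qed
  then obtain d where "\<forall>a\<in>A. d a \<in> dual_lattice L \<and> (\<forall>b\<in>A. d a \<bullet> b = (if b = a then 1 else 0))"
    by metis
  then show thesis by (intro that[of d]) simp_all
qed

text \<open>The generators are part of a lattice basis, so integral values on them can be prescribed
  freely. The corrections of exponents below rest on this.\<close>

lemma dual_combination: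
  assumes "A \<in> K"
  obtains \<nu> where "\<nu> \<in> dual_lattice L" "\<And>a. a \<in> A \<Longrightarrow> \<nu> \<bullet> a = of_int (c a)"
proof -
  obtain d where d: "\<And>a. a \<in> A \<Longrightarrow> d a \<in> dual_lattice L"
    "\<And>a b. a \<in> A \<Longrightarrow> b \<in> A \<Longrightarrow> d a \<bullet> b = (if b = a then 1 else 0)"
    using dual_functions[OF assms] by metis
  have fin: "finite A" by (rule complex_finite[OF assms])
  show thesis
  proof (rule that[of "\<Sum>a\<in>A. of_int (c a) *\<^sub>R d a"])
    show "(\<Sum>a\<in>A. of_int (c a) *\<^sub>R d a) \<in> dual_lattice L"
      by (intro dual_lattice_sum dual_lattice_scale d)
    fix b assume b: "b \<in> A"
    have "(\<Sum>a\<in>A. of_int (c a) *\<^sub>R d a) \<bullet> b = (\<Sum>a\<in>A. if b = a then of_int (c a) else 0)"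
      unfolding inner_sum_left using b d(2) by (intro sum.cong) auto
    then show "(\<Sum>a\<in>A. of_int (c a) *\<^sub>R d a) \<bullet> b = of_int (c b)" using b fin by (simp add: sum.delta)
  qed
qed

lemma inner_Ints: "A \<in> K \<Longrightarrow> a \<in> A \<Longrightarrow> m \<in> dual_lattice L \<Longrightarrow> m \<bullet> a \<in> \<int>"
  using complex_subset_lattice by (auto simp: dual_lattice_def)

text \<open>The monoid of a face is that of the cone with the characters orthogonal to the face
  inverted. The denominator \<nu> vanishes on \<open>B\<close> and is at least the absolute value of
  \<open>\<mu> \<bullet> a\<close> at the other generators \<open>a\<close>.\<close>

lemma clear_denominators:
  assumes A: "A \<in> K" "B \<subseteq> A" and \<mu>: "\<mu> \<in> mon B"
  obtains \<nu> where "\<nu> \<in> mon A" "\<And>b. b \<in> B \<Longrightarrow> \<nu> \<bullet> b = 0" "\<mu> + \<nu> \<in> mon A"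
proof -
  obtain \<nu> where \<nu>: "\<nu> \<in> dual_lattice L"
    "\<And>a. a \<in> A \<Longrightarrow> \<nu> \<bullet> a = of_int (if a \<in> B then 0 else \<lceil>\<bar>\<mu> \<bullet> a\<bar>\<rceil>)"
    using dual_combination[OF A(1), of "\<lambda>a. if a \<in> B then 0 else \<lceil>\<bar>\<mu> \<bullet> a\<bar>\<rceil>"] by metis
  have ge: "\<bar>\<mu> \<bullet> a\<bar> \<le> of_int \<lceil>\<bar>\<mu> \<bullet> a\<bar>\<rceil>" for a by (rule le_of_int_ceiling)
  have "0 \<le> \<nu> \<bullet> a" if "a \<in> A" for a
    using \<nu>(2)[OF that] ge[of a] by (auto intro: order_trans[OF abs_ge_zero])
  moreover have "0 \<le> \<mu> \<bullet> a + \<nu> \<bullet> a" if "a \<in> A" for a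
  proof -
    have "0 \<le> \<mu> \<bullet> a + of_int \<lceil>\<bar>\<mu> \<bullet> a\<bar>\<rceil>" using ge[of a] by linarith
    then show ?thesis using \<nu>(2)[OF that] \<mu> by (cases "a \<in> B") (auto simp: mon_def)
  qed
  ultimately have "\<nu> \<in> mon A" "\<mu> + \<nu> \<in> mon A"
    using \<nu>(1) \<mu> by (simp_all add: mon_def inner_add_left dual_lattice_add)
  moreover have "\<nu> \<bullet> b = 0" if "b \<in> B" for b using \<nu>(2)[of b] that A(2) by auto
  ultimately show thesis using that by blast
qed

text \<open>The universal property of that localisation: once the characters orthogonal to
  \<open>B\<close> have nonzero values, the homomorphism extends by quotients.\<close>

lemma homs_extend:
  assumes A: "A \<in> K" "B \<subseteq> A" and \<gamma>: "\<gamma> \<in> homs A"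
    and unit: "\<And>\<nu>. \<nu> \<in> mon A \<Longrightarrow> (\<forall>b\<in>B. \<nu> \<bullet> b = 0) \<Longrightarrow> \<gamma> \<nu> \<noteq> 0"
  obtains \<delta> where "\<delta> \<in> homs B" "\<gamma> = restrict \<delta> (mon A)"
proof -
  have "\<exists>\<nu>. \<nu> \<in> mon A \<and> (\<forall>b\<in>B. \<nu> \<bullet> b = 0) \<and> \<mu> + \<nu> \<in> mon A" if "\<mu> \<in> mon B" for \<mu>
    using clear_denominators[OF A that] by metis
  then obtain N where N: "\<And>\<mu>. \<mu> \<in> mon B \<Longrightarrow> N \<mu> \<in> mon A"
    "\<And>\<mu>. \<mu> \<in> mon B \<Longrightarrow> \<forall>b\<in>B. N \<mu> \<bullet> b = 0" "\<And>\<mu>. \<mu> \<in> mon B \<Longrightarrow> \<mu> + N \<mu> \<in> mon A"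
    by metis
  define \<delta> where "\<delta> = restrict (\<lambda>\<mu>. \<gamma> (\<mu> + N \<mu>) / \<gamma> (N \<mu>)) (mon B)"
  \<comment> \<open>Independence of the denominator; multiplicativity follows by using the sum of
    two chosen denominators for a sum of characters.\<close>
  have \<delta>: "\<delta> \<mu> = \<gamma> (\<mu> + \<nu>) / \<gamma> \<nu>"
    if "\<mu> \<in> mon B" "\<nu> \<in> mon A" "\<forall>b\<in>B. \<nu> \<bullet> b = 0" "\<mu> + \<nu> \<in> mon A" for \<mu> \<nu>
  proof -
    have "\<gamma> (\<mu> + N \<mu>) * \<gamma> \<nu> = \<gamma> ((\<mu> + N \<mu>) + \<nu>)"
      using homs_add[OF \<gamma> N(3)[OF that(1)] that(2)] by simp
    also have "(\<mu> + N \<mu>) + \<nu> = (\<mu> + \<nu>) + N \<mu>" by simp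
    also have "\<gamma> \<dots> = \<gamma> (\<mu> + \<nu>) * \<gamma> (N \<mu>)"
      using homs_add[OF \<gamma> that(4) N(1)[OF that(1)]] .
    finally show ?thesis
      using unit[OF that(2,3)] unit[OF N(1,2)[OF that(1)]] that(1)
      by (simp add: \<delta>_def field_simps)
  qed
  have AB: "mon A \<subseteq> mon B" by (rule mon_antimono[OF A(2)])
  have on_A: "\<delta> \<mu> = \<gamma> \<mu>" if "\<mu> \<in> mon A" for \<mu>
    using \<delta>[of \<mu> 0] that AB homs_0[OF \<gamma>] by auto
  have "\<delta> \<in> homs B"
    unfolding homs_iff
  proof (intro conjI ballI)
    show "\<delta> \<in> extensional (mon B)" by (simp add: \<delta>_def)
    show "\<delta> 0 = 1" using on_A[of 0] homs_0[OF \<gamma>] by simp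
    fix m m' assume m: "m \<in> mon B" "m' \<in> mon B"
    have eq: "m + m' + (N m + N m') = (m + N m) + (m' + N m')" by simp
    have "\<delta> (m + m') = \<gamma> (m + m' + (N m + N m')) / \<gamma> (N m + N m')"
      by (rule \<delta>) (use m N in \<open>auto simp: eq inner_add_left intro: mon_add\<close>)
    also have "\<dots> = (\<gamma> (m + N m) * \<gamma> (m' + N m')) / (\<gamma> (N m) * \<gamma> (N m'))"
      unfolding eq using homs_add[OF \<gamma>] N m by simp
    also have "\<dots> = \<delta> m * \<delta> m'" using m by (simp add: \<delta>_def)
    finally show "\<delta> (m + m') = \<delta> m * \<delta> m'" .
  qed
  moreover have "\<gamma> = restrict \<delta> (mon A)"
    using on_A \<gamma> by (auto simp: homs_iff fun_eq_iff restrict_def extensional_def)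
  ultimately show thesis using that by blast
qed

text \<open>Uniqueness of the extension: multiply by the value at a denominator, which is
  nonzero.\<close>

lemma homs_eqI:
  assumes A: "A \<in> K" "B \<subseteq> A" and \<delta>: "\<delta> \<in> homs B" "\<delta>' \<in> homs B"
    and eq: "\<And>m. m \<in> mon A \<Longrightarrow> \<delta> m = \<delta>' m"
  shows "\<delta> = \<delta>'"
proof (rule extensionalityI[of _ "mon B"])
  fix \<mu> assume \<mu>: "\<mu> \<in> mon B"
  obtain \<nu> where \<nu>: "\<nu> \<in> mon A" "\<And>b. b \<in> B \<Longrightarrow> \<nu> \<bullet> b = 0" "\<mu> + \<nu> \<in> mon A"
    using clear_denominators[OF A \<mu>] by metis
  have \<nu>B: "\<nu> \<in> mon B" using \<nu>(1) mon_antimono[OF A(2)] by blast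
  have "\<delta> \<mu> * \<delta> \<nu> = \<delta>' \<mu> * \<delta> \<nu>"
    using homs_add[OF \<delta>(1) \<mu> \<nu>B] homs_add[OF \<delta>(2) \<mu> \<nu>B] eq[OF \<nu>(1)] eq[OF \<nu>(3)] by metis
  then show "\<delta> \<mu> = \<delta>' \<mu>" using homs_unit[OF \<delta>(1) \<nu>B \<nu>(2)] by (metis mult_right_cancel)
qed (use \<delta> in \<open>auto simp: homs_iff\<close>)

section \<open>Gluing of the affine pieces\<close>

abbreviation "glue \<equiv> toric_glue L fan_of"

lemma glue_iff:
  assumes "A \<in> K" "B \<in> K"
  shows "((hcone A, \<gamma>), (hcone B, \<gamma>')) \<in> glue \<longleftrightarrow>
    (\<exists>\<delta>\<in>homs (A \<inter> B). \<gamma> = restrict \<delta> (mon A) \<and> \<gamma>' = restrict \<delta> (mon B))"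
  using assms by (auto simp: toric_glue_def fan_of_def cone_Int homs_def mon_eq)

lemma glue_cases:
  assumes "(x, y) \<in> glue"
  obtains A B \<delta> where "A \<in> K" "B \<in> K" "\<delta> \<in> homs (A \<inter> B)"
    "x = (hcone A, restrict \<delta> (mon A))" "y = (hcone B, restrict \<delta> (mon B))"
proof -
  obtain \<sigma> \<gamma> \<tau> \<gamma>' where xy: "x = (\<sigma>, \<gamma>)" "y = (\<tau>, \<gamma>')" by (metis surj_pair)
  obtain A B where AB: "A \<in> K" "\<sigma> = hcone A" "B \<in> K" "\<tau> = hcone B"
    using assms by (auto simp: xy toric_glue_def fan_of_def)
  obtain \<delta> where "\<delta> \<in> homs (A \<inter> B)" "\<gamma> = restrict \<delta> (mon A)" "\<gamma>' = restrict \<delta> (mon B)"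
    using assms glue_iff[OF AB(1,3), of \<gamma> \<gamma>'] AB xy by auto
  then show thesis using that AB xy by blast
qed

text \<open>Cuts a character along \<open>B\<close>. In the proof of transitivity it writes a
  character orthogonal to a triple intersection as a sum of two, each a unit on one of the pairwise
  overlaps.\<close>

lemma mon_split:
  assumes A: "A \<in> K" and \<nu>: "\<nu> \<in> mon A"
  obtains \<nu>1 \<nu>2 where "\<nu>1 \<in> mon A" "\<nu>2 \<in> mon A" "\<nu> = \<nu>1 + \<nu>2"
    "\<And>b. b \<in> A \<inter> B \<Longrightarrow> \<nu>1 \<bullet> b = 0" "\<And>b. b \<in> A - B \<Longrightarrow> \<nu>2 \<bullet> b = 0"
proof -
  obtain \<nu>2 where \<nu>2: "\<nu>2 \<in> dual_lattice L" "\<And>a. a \<in> A \<Longrightarrow> \<nu>2 \<bullet> a = of_int (if a \<in> B then \<lfloor>\<nu> \<bullet> a\<rfloor> else 0)"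
    using dual_combination[OF A, of "\<lambda>a. if a \<in> B then \<lfloor>\<nu> \<bullet> a\<rfloor> else 0"] by metis
  have fl: "of_int \<lfloor>\<nu> \<bullet> a\<rfloor> = \<nu> \<bullet> a" if "a \<in> A" for a
    using inner_Ints[OF A that mon_dual[OF \<nu>]] by (auto elim: Ints_cases)
  have \<nu>2': "\<nu>2 \<bullet> a = (if a \<in> B then \<nu> \<bullet> a else 0)" if "a \<in> A" for a
    using \<nu>2(2)[OF that] fl[OF that] by simp
  show thesis
  proof (rule that[of "\<nu> - \<nu>2" \<nu>2])
    show "\<nu> - \<nu>2 \<in> mon A" "\<nu>2 \<in> mon A"
      using \<nu> \<nu>2(1) \<nu>2' by (auto simp: mon_def inner_diff_left intro: dual_lattice_diff)
  qed (use \<nu>2' in \<open>auto simp: inner_diff_left\<close>)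
qed

text \<open>The content is transitivity. The middle point, given on the piece of \<open>B\<close>,
  extends to the overlaps with \<open>A\<close> and with \<open>C\<close>, and must be extended to
  the triple intersection. The extension exists by splitting characters, and uniqueness of
  extensions identifies its restrictions with the two given ones.\<close>

lemma glue_equiv: "equiv (SIGMA \<sigma>:fan_of. affine_toric L \<sigma>) glue"
proof (rule equivI)
  show "glue \<subseteq> (SIGMA \<sigma>:fan_of. affine_toric L \<sigma>) \<times> (SIGMA \<sigma>:fan_of. affine_toric L \<sigma>)"
  proof (rule subrelI)
    fix x y assume "(x, y) \<in> glue"
    then obtain A B \<delta> where *: "A \<in> K" "B \<in> K" "\<delta> \<in> homs (A \<inter> B)"
      "x = (hcone A, restrict \<delta> (mon A))" "y = (hcone B, restrict \<delta> (mon B))" by (rule glue_cases)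
    then have "restrict \<delta> (mon A) \<in> homs A" "restrict \<delta> (mon B) \<in> homs B"
      by (auto intro: homs_restrict)
    then show "(x, y) \<in> (SIGMA \<sigma>:fan_of. affine_toric L \<sigma>) \<times> (SIGMA \<sigma>:fan_of. affine_toric L \<sigma>)"
      using * by (simp add: fan_of_def homs_def)
  qed
  show "refl_on (SIGMA \<sigma>:fan_of. affine_toric L \<sigma>) glue"
  proof (rule refl_onI)
    fix x assume "x \<in> (SIGMA \<sigma>:fan_of. affine_toric L \<sigma>)"
    then obtain A \<gamma> where *: "A \<in> K" "x = (hcone A, \<gamma>)" "\<gamma> \<in> homs A" by (auto simp: fan_of_def homs_def)
    have "\<gamma> = restrict \<gamma> (mon A)" using *(3) by (simp add: homs_iff extensional_restrict)
    then show "(x, x) \<in> glue" using * glue_iff[OF *(1,1), of \<gamma> \<gamma>] by auto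
  qed
  show "sym glue" by (auto simp: sym_def toric_glue_def Int_commute)
  show "trans glue"
  proof (rule transI)
    fix x y z assume xy: "(x, y) \<in> glue" and yz: "(y, z) \<in> glue"
    obtain A B \<delta> where AB: "A \<in> K" "B \<in> K" and \<delta>: "\<delta> \<in> homs (A \<inter> B)"
      "x = (hcone A, restrict \<delta> (mon A))" "y = (hcone B, restrict \<delta> (mon B))" using xy by (rule glue_cases)
    obtain B' C \<delta>' where C: "B' \<in> K" "C \<in> K" and \<delta>': "\<delta>' \<in> homs (B' \<inter> C)"
      "y = (hcone B', restrict \<delta>' (mon B'))" "z = (hcone C, restrict \<delta>' (mon C))" using yz by (rule glue_cases)
    have B': "B' = B" using \<delta>(3) \<delta>'(2) cone_eq_cone_iff[OF AB(2) C(1)] by simp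
    let ?\<gamma> = "restrict \<delta> (mon B)"
    have \<gamma>': "?\<gamma> = restrict \<delta>' (mon B)" using \<delta>(3) \<delta>'(2) by (simp add: B')
    have \<gamma>: "?\<gamma> \<in> homs B" using \<delta>(1) by (rule homs_restrict) simp
    let ?D = "A \<inter> B \<inter> C"
    have DK: "A \<inter> B \<in> K" "B \<inter> C \<in> K" by (rule subset_complex[OF AB(2)], simp)+
    obtain \<epsilon> where \<epsilon>: "\<epsilon> \<in> homs ?D" "?\<gamma> = restrict \<epsilon> (mon B)"
    proof (rule homs_extend[OF AB(2) _ \<gamma>, of ?D])
      fix \<nu> assume \<nu>: "\<nu> \<in> mon B" "\<forall>b\<in>?D. \<nu> \<bullet> b = 0"
      obtain \<nu>1 \<nu>2 where s: "\<nu>1 \<in> mon B" "\<nu>2 \<in> mon B" "\<nu> = \<nu>1 + \<nu>2"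
        "\<And>b. b \<in> B \<inter> A \<Longrightarrow> \<nu>1 \<bullet> b = 0" "\<And>b. b \<in> B - A \<Longrightarrow> \<nu>2 \<bullet> b = 0"
        using mon_split[OF AB(2) \<nu>(1), of A] by metis
      have 2: "\<nu>2 \<bullet> b = 0" if "b \<in> B \<inter> C" for b
      proof (cases "b \<in> A")
        case True
        then have "\<nu> \<bullet> b = 0" using \<nu>(2) that by blast
        then show ?thesis using s(3) s(4)[of b] True that by (simp add: inner_add_left)
      qed (use s(5)[of b] that in blast)
      have 1: "\<nu>1 \<bullet> b = 0" if "b \<in> A \<inter> B" for b using s(4) that by blast
      have m1: "\<nu>1 \<in> mon (A \<inter> B)" and m2: "\<nu>2 \<in> mon (B \<inter> C)"
        using s(1,2) mon_antimono[of "A \<inter> B" B] mon_antimono[of "B \<inter> C" B] by blast+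
      have "\<delta> \<nu>1 \<noteq> 0" using homs_unit[OF \<delta>(1) m1 1] .
      then have n1: "?\<gamma> \<nu>1 \<noteq> 0" using s(1) by simp
      have "\<delta>' \<nu>2 \<noteq> 0" using homs_unit[OF \<delta>'(1)[unfolded B'] m2 2] .
      then have n2: "?\<gamma> \<nu>2 \<noteq> 0" using s(2) unfolding \<gamma>' by simp
      show "?\<gamma> \<nu> \<noteq> 0" using homs_add[OF \<gamma> s(1,2)] n1 n2 s(3) by simp
    qed blast+
    have e1: "restrict \<epsilon> (mon (A \<inter> B)) = \<delta>"
    proof (rule homs_eqI[OF AB(2) _ homs_restrict[OF \<epsilon>(1)] \<delta>(1)])
      fix m assume m: "m \<in> mon B"
      then have "m \<in> mon (A \<inter> B)" using mon_antimono[of "A \<inter> B" B] by blast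
      then show "restrict \<epsilon> (mon (A \<inter> B)) m = \<delta> m" using fun_cong[OF \<epsilon>(2), of m] m by simp
    qed auto
    have e2: "restrict \<epsilon> (mon (B \<inter> C)) = \<delta>'"
    proof (rule homs_eqI[OF AB(2) _ homs_restrict[OF \<epsilon>(1)] \<delta>'(1)[unfolded B']])
      fix m assume m: "m \<in> mon B"
      then have "m \<in> mon (B \<inter> C)" using mon_antimono[of "B \<inter> C" B] by blast
      then show "restrict \<epsilon> (mon (B \<inter> C)) m = \<delta>' m" using fun_cong[OF \<epsilon>(2), of m] fun_cong[OF \<gamma>', of m] m by simp
    qed auto
    let ?\<epsilon> = "restrict \<epsilon> (mon (A \<inter> C))"
    have "?\<epsilon> \<in> homs (A \<inter> C)" by (rule homs_restrict[OF \<epsilon>(1)]) blast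
    moreover have "restrict \<delta> (mon A) = restrict ?\<epsilon> (mon A)"
      unfolding e1[symmetric] using mon_antimono[of "A \<inter> B" A] mon_antimono[of "A \<inter> C" A]
      by (auto simp: fun_eq_iff restrict_def)
    moreover have "restrict \<delta>' (mon C) = restrict ?\<epsilon> (mon C)"
      unfolding e2[symmetric] using mon_antimono[of "B \<inter> C" C] mon_antimono[of "A \<inter> C" C]
      by (auto simp: fun_eq_iff restrict_def)
    ultimately show "(x, z) \<in> glue" using glue_iff[OF AB(1) C(2)] \<delta>(2) \<delta>'(3) by blast
  qed
qed

section \<open>Points, affine pieces and values of characters\<close>

abbreviation "Points \<equiv> toric_points L fan_of"

definition "piece A = toric_piece L fan_of (hcone A)"

text \<open>The value of the character \<open>\<chi>\<^sup>m\<close> at \<open>p\<close>, meaningful only if \<open>m\<close> is nonnegative on some cone whose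
  affine piece contains \<open>p\<close>.\<close>

definition "chi p m = (THE c. \<exists>A \<gamma>. A \<in> K \<and> (hcone A, \<gamma>) \<in> p \<and> m \<in> mon A \<and> c = \<gamma> m)"

lemma Points_related: "p \<in> Points \<Longrightarrow> x \<in> p \<Longrightarrow> y \<in> p \<Longrightarrow> (x, y) \<in> glue"
  using quotient_eq_iff[OF glue_equiv, of p p x y] by (simp add: toric_points_def)

lemma Points_closed: "p \<in> Points \<Longrightarrow> x \<in> p \<Longrightarrow> (x, y) \<in> glue \<Longrightarrow> y \<in> p"
  using in_quotient_imp_closed[OF glue_equiv] by (auto simp: toric_points_def)

lemma pieceE:
  assumes "p \<in> piece A"
  obtains \<gamma> where "p \<in> Points" "(hcone A, \<gamma>) \<in> p" "\<gamma> \<in> homs A"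
proof -
  obtain \<gamma> where *: "p \<in> Points" "(hcone A, \<gamma>) \<in> p" using assms by (auto simp: piece_def toric_piece_def)
  then have "(hcone A, \<gamma>) \<in> (SIGMA \<sigma>:fan_of. affine_toric L \<sigma>)"
    using in_quotient_imp_subset[OF glue_equiv] by (auto simp: toric_points_def)
  then show thesis using that[OF *] by (simp add: homs_def)
qed

lemma chi_eq:
  assumes "p \<in> Points" "(hcone A, \<gamma>) \<in> p" "A \<in> K" "m \<in> mon A"
  shows "chi p m = \<gamma> m"
  unfolding chi_def
proof (rule the_equality)
  show "\<exists>A \<gamma>'. A \<in> K \<and> (hcone A, \<gamma>') \<in> p \<and> m \<in> mon A \<and> \<gamma> m = \<gamma>' m" using assms by blast
  fix c assume "\<exists>A \<gamma>. A \<in> K \<and> (hcone A, \<gamma>) \<in> p \<and> m \<in> mon A \<and> c = \<gamma> m"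
  then obtain B \<gamma>' where B: "B \<in> K" "(hcone B, \<gamma>') \<in> p" "m \<in> mon B" "c = \<gamma>' m" by blast
  obtain \<delta> where "\<gamma> = restrict \<delta> (mon A)" "\<gamma>' = restrict \<delta> (mon B)"
    using Points_related[OF assms(1,2) B(2)] glue_iff[OF assms(3) B(1)] by blast
  then show "c = \<gamma> m" using B assms(4) by simp
qed

lemma piece_homs:
  assumes p: "p \<in> piece A" and A: "A \<in> K"
  shows "restrict (chi p) (mon A) \<in> homs A" and "(hcone A, restrict (chi p) (mon A)) \<in> p"
proof -
  obtain \<gamma> where \<gamma>: "p \<in> Points" "(hcone A, \<gamma>) \<in> p" "\<gamma> \<in> homs A" using p by (rule pieceE)
  have "restrict (chi p) (mon A) = \<gamma>"
    using chi_eq[OF \<gamma>(1,2) A] \<gamma>(3) by (auto simp: homs_iff fun_eq_iff restrict_def extensional_def)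
  then show "restrict (chi p) (mon A) \<in> homs A" "(hcone A, restrict (chi p) (mon A)) \<in> p"
    using \<gamma> by simp_all
qed

lemma toric_value_chi:
  assumes p: "p \<in> piece A" and A: "A \<in> K" and m: "m \<in> mon A"
  shows "toric_value (hcone A) p m = chi p m"
proof -
  have P: "p \<in> Points" using p by (simp add: piece_def toric_piece_def)
  have "(THE \<gamma>. (hcone A, \<gamma>) \<in> p) = restrict (chi p) (mon A)"
  proof (rule the_equality)
    show "(hcone A, restrict (chi p) (mon A)) \<in> p" by (rule piece_homs(2)[OF p A])
    fix \<gamma> assume "(hcone A, \<gamma>) \<in> p"
    from Points_related[OF P this piece_homs(2)[OF p A]]
    show "\<gamma> = restrict (chi p) (mon A)" using glue_iff[OF A A] by auto
  qed
  then show ?thesis using m by (simp add: toric_value_def)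
qed

lemma chi_0: "p \<in> piece A \<Longrightarrow> A \<in> K \<Longrightarrow> chi p 0 = 1"
  using piece_homs(1)[of p A] by (auto simp: homs_iff)

lemma chi_add:
  "p \<in> piece A \<Longrightarrow> A \<in> K \<Longrightarrow> m \<in> mon A \<Longrightarrow> m' \<in> mon A \<Longrightarrow> chi p (m + m') = chi p m * chi p m'"
  using homs_add[OF piece_homs(1)[of p A], of m m'] by (simp add: mon_add)

lemma chi_unit:
  assumes "p \<in> piece A" "A \<in> K" "m \<in> mon A" "\<And>a. a \<in> A \<Longrightarrow> m \<bullet> a = 0"
  shows "chi p m \<noteq> 0"
  using homs_unit[OF piece_homs(1)[OF assms(1,2)] assms(3,4)] assms(3) by simp

lemma point_exists:
  assumes A: "A \<in> K" and \<gamma>: "\<gamma> \<in> homs A"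
  obtains p where "p \<in> piece A" "\<And>m. m \<in> mon A \<Longrightarrow> chi p m = \<gamma> m"
proof -
  have x: "(hcone A, \<gamma>) \<in> (SIGMA \<sigma>:fan_of. affine_toric L \<sigma>)" using A \<gamma> by (simp add: fan_of_def homs_def)
  define p where "p = glue `` {(hcone A, \<gamma>)}"
  have p: "p \<in> Points" unfolding p_def toric_points_def using x by (rule quotientI)
  have in_p: "(hcone A, \<gamma>) \<in> p" unfolding p_def by (rule equiv_class_self[OF glue_equiv x])
  then have "p \<in> piece A" using p by (auto simp: piece_def toric_piece_def)
  then show thesis using that chi_eq[OF p in_p A] by blast
qed

lemma point_eqI:
  assumes p: "p \<in> piece A" and q: "q \<in> piece A" and A: "A \<in> K"
    and eq: "\<And>m. m \<in> mon A \<Longrightarrow> chi p m = chi q m"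
  shows "p = q"
proof -
  have *: "restrict (chi p) (mon A) = restrict (chi q) (mon A)" using eq by auto
  have P: "p \<in> Points" "q \<in> Points" using p q by (simp_all add: piece_def toric_piece_def)
  have "(hcone A, restrict (chi p) (mon A)) \<in> p" "(hcone A, restrict (chi p) (mon A)) \<in> q"
    using piece_homs(2)[OF p A] piece_homs(2)[OF q A] * by simp_all
  moreover have "p \<inter> q = {} \<or> p = q"
    using quotient_disj[OF glue_equiv] P by (auto simp: toric_points_def)
  ultimately show ?thesis by blast
qed

lemma piece_mono:
  assumes p: "p \<in> piece B" and A: "A \<in> K" and BA: "B \<subseteq> A"
  shows "p \<in> piece A"
proof -
  have B: "B \<in> K" using A BA by (rule subset_complex)
  obtain \<gamma> where \<gamma>: "p \<in> Points" "(hcone B, \<gamma>) \<in> p" "\<gamma> \<in> homs B" using p by (rule pieceE)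
  have "B \<inter> A = B" using BA by blast
  moreover have "\<gamma> = restrict \<gamma> (mon B)" using \<gamma>(3) by (simp add: homs_iff extensional_restrict)
  ultimately have "((hcone B, \<gamma>), (hcone A, restrict \<gamma> (mon A))) \<in> glue"
    using glue_iff[OF B A, of \<gamma> "restrict \<gamma> (mon A)"] \<gamma>(3) by auto
  then have "(hcone A, restrict \<gamma> (mon A)) \<in> p" using Points_closed[OF \<gamma>(1,2)] by blast
  then show ?thesis using \<gamma>(1) by (auto simp: piece_def toric_piece_def)
qed

lemma piece_Int:
  assumes A: "A \<in> K" and B: "B \<in> K"
  shows "piece A \<inter> piece B = piece (A \<inter> B)"
proof (intro subset_antisym subsetI)
  fix p assume p: "p \<in> piece A \<inter> piece B"
  obtain \<gamma> where \<gamma>: "p \<in> Points" "(hcone A, \<gamma>) \<in> p" "\<gamma> \<in> homs A" using p pieceE by blast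
  obtain \<gamma>' where \<gamma>': "(hcone B, \<gamma>') \<in> p" using p pieceE by blast
  obtain \<delta> where \<delta>: "\<delta> \<in> homs (A \<inter> B)" "\<gamma> = restrict \<delta> (mon A)"
    using Points_related[OF \<gamma>(1,2) \<gamma>'] glue_iff[OF A B] by blast
  have AB: "A \<inter> B \<in> K" by (rule subset_complex[OF A]) simp
  have "\<delta> = restrict \<delta> (mon (A \<inter> B))" using \<delta>(1) by (simp add: homs_iff extensional_restrict)
  moreover have "A \<inter> (A \<inter> B) = A \<inter> B" by blast
  ultimately have "((hcone A, \<gamma>), (hcone (A \<inter> B), \<delta>)) \<in> glue"
    using glue_iff[OF A AB, of \<gamma> \<delta>] \<delta> by auto
  then have "(hcone (A \<inter> B), \<delta>) \<in> p" using Points_closed[OF \<gamma>(1,2)] by blast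
  then show "p \<in> piece (A \<inter> B)" using \<gamma>(1) by (auto simp: piece_def toric_piece_def)
next
  fix p assume "p \<in> piece (A \<inter> B)"
  then show "p \<in> piece A \<inter> piece B" using piece_mono[OF _ A] piece_mono[OF _ B] by blast
qed

text \<open>Passing to a face inverts the characters orthogonal to it, and the homomorphism at
  \<open>p\<close> extends as soon as they do not vanish. Membership in pieces is thus decided by
  character values.\<close>

lemma piece_subset_iff:
  assumes A: "A \<in> K" and BA: "B \<subseteq> A"
  shows "p \<in> piece B \<longleftrightarrow> p \<in> piece A \<and> (\<forall>\<nu>\<in>mon A. (\<forall>b\<in>B. \<nu> \<bullet> b = 0) \<longrightarrow> chi p \<nu> \<noteq> 0)"
proof (intro iffI conjI ballI impI)
  have B: "B \<in> K" using A BA by (rule subset_complex)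
  {
    assume p: "p \<in> piece B"
    show "p \<in> piece A" by (rule piece_mono[OF p A BA])
    fix \<nu> assume "\<nu> \<in> mon A" "\<forall>b\<in>B. \<nu> \<bullet> b = 0"
    then show "chi p \<nu> \<noteq> 0" using chi_unit[OF p B] mon_antimono[OF BA] by blast
  }
  assume *: "p \<in> piece A \<and> (\<forall>\<nu>\<in>mon A. (\<forall>b\<in>B. \<nu> \<bullet> b = 0) \<longrightarrow> chi p \<nu> \<noteq> 0)"
  then have p: "p \<in> piece A" by blast
  obtain \<delta> where \<delta>: "\<delta> \<in> homs B" "restrict (chi p) (mon A) = restrict \<delta> (mon A)"
    using homs_extend[OF A BA piece_homs(1)[OF p A]] * by (metis restrict_apply')
  obtain q where q: "q \<in> piece B" "\<And>m. m \<in> mon B \<Longrightarrow> chi q m = \<delta> m" using point_exists[OF B \<delta>(1)] by metis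
  have "p = q"
  proof (rule point_eqI[OF p piece_mono[OF q(1) A BA] A])
    fix m assume m: "m \<in> mon A"
    then show "chi p m = chi q m"
      using q(2)[of m] mon_antimono[OF BA] fun_cong[OF \<delta>(2), of m] by auto
  qed
  then show "p \<in> piece B" using q(1) by simp
qed

lemma Points_eq: "Points = (\<Union>A\<in>K. piece A)"
proof (intro subset_antisym subsetI)
  fix p assume p: "p \<in> Points"
  then obtain x where x: "x \<in> p" "x \<in> (SIGMA \<sigma>:fan_of. affine_toric L \<sigma>)"
    unfolding toric_points_def
    by (metis equals0I in_quotient_imp_non_empty[OF glue_equiv] in_quotient_imp_subset[OF glue_equiv] subsetD)
  then obtain A \<gamma> where "A \<in> K" "x = (hcone A, \<gamma>)" by (auto simp: fan_of_def)
  then show "p \<in> (\<Union>A\<in>K. piece A)" using p x by (auto simp: piece_def toric_piece_def)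
qed (auto simp: piece_def toric_piece_def)

lemma piece_basis:
  assumes "p \<in> Points"
  obtains S where "S \<in> K" "lattice_basis L S" "p \<in> piece S"
proof -
  obtain A where A: "A \<in> K" "p \<in> piece A" using assms Points_eq by blast
  obtain S where "S \<in> K" "A \<subseteq> S" "lattice_basis L S" using extends_to_basis[OF A(1)] by blast
  then show thesis using that piece_mono[OF A(2)] by blast
qed

end

subsection \<open>Smooth toric varieties as complex manifolds\<close>

context simplicial_fan
begin

definition "frame u m \<longleftrightarrow> inj_on u {..<dim L} \<and> lattice_basis L (u ` {..<dim L}) \<and>
  (\<forall>i<dim L. m i \<in> dual_lattice L \<and> (\<forall>i'<dim L. m i \<bullet> u i' = (if i = i' then 1 else 0)))"

definition "coords m p = (\<lambda>i. if i < dim L then chi p (m i) else 0)"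

text \<open>In contrast to the charts in the atlas, the generators of the cone may be any elements of the
  basis, not just its initial ones.\<close>

definition "gchart U \<phi> \<longleftrightarrow> (\<exists>u m J. frame u m \<and> J \<subseteq> {..<dim L} \<and> u ` J \<in> K \<and> U = piece (u ` J) \<and>
  (\<forall>p\<in>U. \<phi> p = coords m p))"

abbreviation "X \<equiv> toric_manifold L fan_of"

lemma frame_inner: "frame u m \<Longrightarrow> i < dim L \<Longrightarrow> i' < dim L \<Longrightarrow> m i \<bullet> u i' = (if i = i' then 1 else 0)"
  by (simp add: frame_def)

lemma frame_mon:
  assumes "frame u m" "i < dim L" "J \<subseteq> {..<dim L}"
  shows "m i \<in> mon (u ` J)"
  using assms frame_inner[OF assms(1,2)] by (auto simp: frame_def mon_def subset_iff)

lemma dual_lattice_eqI: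
  assumes B: "lattice_basis L B" and m: "m \<in> dual_lattice L" "m' \<in> dual_lattice L"
    and eq: "\<And>b. b \<in> B \<Longrightarrow> m \<bullet> b = m' \<bullet> b"
  shows "m = m'"
proof -
  have "m - m' \<in> dual_lattice L" using m by (rule dual_lattice_diff)
  then have d: "m - m' \<in> span B" using lattice_basis_span[OF B] by (simp add: dual_lattice_def)
  have "span B \<subseteq> {v. (m - m') \<bullet> v = 0}"
    using eq by (intro span_minimal subspace_hyperplane) (auto simp: inner_diff_left)
  then have "(m - m') \<bullet> (m - m') = 0" using d by blast
  then show ?thesis by simp
qed

text \<open>The inner products are integers here; the floors only turn them into exponents of type
  \<open>int\<close>.\<close>

lemma frame_expansion:
  assumes f: "frame u m" and \<mu>: "\<mu> \<in> dual_lattice L"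
  shows "\<mu> = (\<Sum>i<dim L. of_int \<lfloor>\<mu> \<bullet> u i\<rfloor> *\<^sub>R m i)"
proof (rule dual_lattice_eqI)
  show B: "lattice_basis L (u ` {..<dim L})" using f by (simp add: frame_def)
  show "(\<Sum>i<dim L. of_int \<lfloor>\<mu> \<bullet> u i\<rfloor> *\<^sub>R m i) \<in> dual_lattice L"
    using f by (intro dual_lattice_sum dual_lattice_scale) (simp add: frame_def)
  fix b assume "b \<in> u ` {..<dim L}"
  then obtain i where i: "i < dim L" "b = u i" by blast
  have "b \<in> L" using lattice_basis_subset[OF B] i by blast
  then have "\<mu> \<bullet> b \<in> \<int>" using \<mu> by (simp add: dual_lattice_def)
  then have fl: "of_int \<lfloor>\<mu> \<bullet> b\<rfloor> = \<mu> \<bullet> b" by (auto elim: Ints_cases)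
  have "(\<Sum>j<dim L. of_int \<lfloor>\<mu> \<bullet> u j\<rfloor> *\<^sub>R m j) \<bullet> b = (\<Sum>j<dim L. if j = i then \<mu> \<bullet> b else 0)"
    unfolding inner_sum_left using frame_inner[OF f] i fl by (intro sum.cong) auto
  then show "\<mu> \<bullet> b = (\<Sum>i<dim L. of_int \<lfloor>\<mu> \<bullet> u i\<rfloor> *\<^sub>R m i) \<bullet> b"
    using i(1) by (simp add: sum.delta)
qed (fact \<mu>)

lemma mon_scale_nat: "m \<in> mon A \<Longrightarrow> of_nat n *\<^sub>R m \<in> mon A"
  using dual_lattice_scale[of m L "int n"] by (auto simp: mon_def)

lemma chi_scale_nat:
  assumes p: "p \<in> piece A" and A: "A \<in> K" and m: "m \<in> mon A"
  shows "chi p (of_nat n *\<^sub>R m) = chi p m ^ n"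
proof (induction n)
  case 0
  then show ?case using chi_0[OF p A] by simp
next
  case (Suc n)
  have "chi p (m + of_nat n *\<^sub>R m) = chi p m * chi p (of_nat n *\<^sub>R m)"
    by (rule chi_add[OF p A m mon_scale_nat[OF m]])
  then show ?case using Suc by (simp add: scaleR_left_distrib add.commute)
qed

lemma chi_uminus:
  assumes p: "p \<in> piece A" and A: "A \<in> K" and m: "m \<in> mon A" "- m \<in> mon A"
  shows "chi p (- m) = inverse (chi p m)"
proof -
  have "chi p m * chi p (- m) = 1" using chi_add[OF p A m] chi_0[OF p A] by simp
  then show ?thesis by (metis inverse_unique)
qed

lemma chi_scale_int:
  assumes p: "p \<in> piece A" and A: "A \<in> K" and m: "m \<in> mon A" and k: "k < 0 \<Longrightarrow> - m \<in> mon A"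
  shows "of_int k *\<^sub>R m \<in> mon A" and "chi p (of_int k *\<^sub>R m) = chi p m powi k"
proof -
  have "of_int k *\<^sub>R m \<in> mon A \<and> chi p (of_int k *\<^sub>R m) = chi p m powi k"
  proof (cases "k < 0")
    case True
    then have eq: "of_int k *\<^sub>R m = of_nat (nat (- k)) *\<^sub>R (- m)" by simp
    show ?thesis
      unfolding eq chi_scale_nat[OF p A k[OF True]] chi_uminus[OF p A m k[OF True]]
      using mon_scale_nat[OF k[OF True], of "nat (- k)"] True by (simp only: power_int_def) simp
  next
    case False
    then have eq: "of_int k *\<^sub>R m = of_nat (nat k) *\<^sub>R m" by simp
    show ?thesis
      unfolding eq chi_scale_nat[OF p A m]
      using mon_scale_nat[OF m, of "nat k"] False by (simp only: power_int_def) simp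
  qed
  then show "of_int k *\<^sub>R m \<in> mon A" "chi p (of_int k *\<^sub>R m) = chi p m powi k" by blast+
qed

text \<open>Expand the character in the dual basis. Negative exponents occur only at indices outside
  \<open>J\<close>, where the coordinate is a unit, so the integer powers make sense.\<close>

lemma chi_monomial:
  assumes f: "frame u m" and J: "J \<subseteq> {..<dim L}" "u ` J \<in> K" and p: "p \<in> piece (u ` J)" and \<mu>: "\<mu> \<in> mon (u ` J)"
  shows "chi p \<mu> = (\<Prod>i<dim L. coords m p i powi \<lfloor>\<mu> \<bullet> u i\<rfloor>)"
proof -
  let ?k = "\<lambda>i. \<lfloor>\<mu> \<bullet> u i\<rfloor>"
  have neg: "- m i \<in> mon (u ` J)" if "i < dim L" "?k i < 0" for i
  proof (rule mon_uminus[OF frame_mon[OF f that(1) J(1)]])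
    fix b assume "b \<in> u ` J"
    then obtain j where j: "j \<in> J" "b = u j" by blast
    then have "0 \<le> \<mu> \<bullet> u j" using \<mu> by (auto simp: mon_def)
    then have "i \<noteq> j" using that(2) by auto
    then show "m i \<bullet> b = 0" using frame_inner[OF f that(1), of j] j J(1) by auto
  qed
  have step: "of_int (?k i) *\<^sub>R m i \<in> mon (u ` J)" "chi p (of_int (?k i) *\<^sub>R m i) = chi p (m i) powi ?k i"
    if "i < dim L" for i
    using chi_scale_int[OF p J(2) frame_mon[OF f that J(1)] neg[OF that]] by blast+
  have "(\<Sum>i\<in>I. of_int (?k i) *\<^sub>R m i) \<in> mon (u ` J) \<and>
      chi p (\<Sum>i\<in>I. of_int (?k i) *\<^sub>R m i) = (\<Prod>i\<in>I. chi p (m i) powi ?k i)" if "I \<subseteq> {..<dim L}" for I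
    using finite_subset[OF that finite_lessThan] that
  proof (induction I)
    case empty
    then show ?case using chi_0[OF p J(2)] by simp
  next
    case (insert i I)
    then have i: "i < dim L" and IH: "(\<Sum>i\<in>I. of_int (?k i) *\<^sub>R m i) \<in> mon (u ` J)"
      "chi p (\<Sum>i\<in>I. of_int (?k i) *\<^sub>R m i) = (\<Prod>i\<in>I. chi p (m i) powi ?k i)" by auto
    show ?case
      using insert(1,2) mon_add[OF step(1)[OF i] IH(1)] chi_add[OF p J(2) step(1)[OF i] IH(1)] step(2)[OF i] IH(2)
      by simp
  qed
  from this[of "{..<dim L}"] have "chi p \<mu> = (\<Prod>i<dim L. chi p (m i) powi ?k i)"
    using frame_expansion[OF f mon_dual[OF \<mu>]] by simp
  also have "\<dots> = (\<Prod>i<dim L. coords m p i powi ?k i)" by (intro prod.cong) (auto simp: coords_def)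
  finally show ?thesis .
qed

lemma coords_inj_on:
  assumes f: "frame u m" and J: "J \<subseteq> {..<dim L}" "u ` J \<in> K"
  shows "inj_on (coords m) (piece (u ` J))"
proof (rule inj_onI)
  fix p q assume pq: "p \<in> piece (u ` J)" "q \<in> piece (u ` J)" "coords m p = coords m q"
  show "p = q"
    by (rule point_eqI[OF pq(1,2) J(2)]) (simp add: chi_monomial[OF f J pq(1)] chi_monomial[OF f J pq(2)] pq(3))
qed

lemma coords_image:
  assumes f: "frame u m" and J: "J \<subseteq> {..<dim L}" "u ` J \<in> K"
  shows "coords m ` piece (u ` J) = {z \<in> Cspace (dim L). \<forall>i<dim L. i \<notin> J \<longrightarrow> z i \<noteq> 0}"
proof (intro subset_antisym subsetI)
  fix z assume "z \<in> coords m ` piece (u ` J)"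
  then obtain p where p: "p \<in> piece (u ` J)" "z = coords m p" by blast
  have "z i \<noteq> 0" if "i < dim L" "i \<notin> J" for i
  proof -
    have "m i \<bullet> a = 0" if "a \<in> u ` J" for a
      using that frame_inner[OF f \<open>i < dim L\<close>] J(1) \<open>i \<notin> J\<close> by auto
    then show ?thesis
      using chi_unit[OF p(1) J(2) frame_mon[OF f \<open>i < dim L\<close> J(1)]] that by (simp add: p(2) coords_def)
  qed
  then show "z \<in> {z \<in> Cspace (dim L). \<forall>i<dim L. i \<notin> J \<longrightarrow> z i \<noteq> 0}"
    by (simp add: Cspace_def p(2) coords_def)
next
  fix z assume "z \<in> {z \<in> Cspace (dim L). \<forall>i<dim L. i \<notin> J \<longrightarrow> z i \<noteq> 0}"
  then have z: "z \<in> Cspace (dim L)" "\<And>i. i < dim L \<Longrightarrow> i \<notin> J \<Longrightarrow> z i \<noteq> 0" by auto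
  \<comment> \<open>The point with coordinates \<open>z\<close> is the homomorphism given by the
    monomial formula.\<close>
  define \<gamma> where "\<gamma> = restrict (\<lambda>\<mu>. \<Prod>i<dim L. z i powi \<lfloor>\<mu> \<bullet> u i\<rfloor>) (mon (u ` J))"
  have int: "\<mu> \<bullet> u i \<in> \<int>" if "\<mu> \<in> mon (u ` J)" "i < dim L" for \<mu> i
  proof -
    have "lattice_basis L (u ` {..<dim L})" using f by (simp add: frame_def)
    then have "u i \<in> L" using lattice_basis_subset that(2) by blast
    then show ?thesis using mon_dual[OF that(1)] by (simp add: dual_lattice_def)
  qed
  have "\<gamma> \<in> homs (u ` J)"
    unfolding homs_iff
  proof (intro conjI ballI)
    show "\<gamma> \<in> extensional (mon (u ` J))" "\<gamma> 0 = 1" by (simp_all add: \<gamma>_def)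
    fix \<mu> \<mu>' assume \<mu>: "\<mu> \<in> mon (u ` J)" "\<mu>' \<in> mon (u ` J)"
    have "z i powi \<lfloor>(\<mu> + \<mu>') \<bullet> u i\<rfloor> = z i powi \<lfloor>\<mu> \<bullet> u i\<rfloor> * z i powi \<lfloor>\<mu>' \<bullet> u i\<rfloor>" if i: "i < dim L" for i
    proof -
      have fl: "\<lfloor>(\<mu> + \<mu>') \<bullet> u i\<rfloor> = \<lfloor>\<mu> \<bullet> u i\<rfloor> + \<lfloor>\<mu>' \<bullet> u i\<rfloor>"
        using int[OF \<mu>(1) i] int[OF \<mu>(2) i] by (auto simp: inner_add_left elim!: Ints_cases)
      show ?thesis
      \<comment> \<open>At a base that may be 0, integer powers are additive only for nonnegative
        exponents, which is the case for indices in \<open>J\<close>.\<close>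
      proof (cases "i \<in> J")
        case True
        then have "0 \<le> \<lfloor>\<mu> \<bullet> u i\<rfloor>" "0 \<le> \<lfloor>\<mu>' \<bullet> u i\<rfloor>" using \<mu> by (auto simp: mon_def)
        then show ?thesis unfolding fl by (simp add: power_int_def nat_add_distrib power_add)
      next
        case False
        then show ?thesis unfolding fl using z(2)[OF i] by (simp add: power_int_add)
      qed
    qed
    then show "\<gamma> (\<mu> + \<mu>') = \<gamma> \<mu> * \<gamma> \<mu>'"
      using \<mu> mon_add[OF \<mu>] by (simp add: \<gamma>_def prod.distrib[symmetric])
  qed
  then obtain p where p: "p \<in> piece (u ` J)" "\<And>\<mu>. \<mu> \<in> mon (u ` J) \<Longrightarrow> chi p \<mu> = \<gamma> \<mu>"
    using point_exists[OF J(2)] by metis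
  have "coords m p i = z i" for i
  proof (cases "i < dim L")
    case True
    have "(\<Prod>j<dim L. z j powi \<lfloor>m i \<bullet> u j\<rfloor>) = (\<Prod>j<dim L. if j = i then z i else 1)"
      using frame_inner[OF f True] by (intro prod.cong) auto
    then have "\<gamma> (m i) = z i" using frame_mon[OF f True J(1)] True by (simp add: \<gamma>_def prod.delta)
    then show ?thesis using p(2)[OF frame_mon[OF f True J(1)]] True by (simp add: coords_def)
  next
    case False
    then show ?thesis using z(1) by (simp add: coords_def Cspace_def)
  qed
  then have "coords m p = z" by blast
  then show "z \<in> coords m ` piece (u ` J)" using p(1) by blast
qed

lemma gchart_inj: "gchart U \<phi> \<Longrightarrow> inj_on \<phi> U"
  unfolding gchart_def using coords_inj_on inj_on_cong by metis

lemma gchart_subset: "gchart U \<phi> \<Longrightarrow> U \<subseteq> Points"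
  unfolding gchart_def Points_eq by blast

text \<open>Inside the chart, the piece of \<open>B\<close> is that of the common generators. Its
  image is given by nonvanishing coordinates, and a character of \<open>B\<close> has nonnegative
  exponents at all coordinates that may vanish.\<close>

lemma gchart_holo:
  assumes U: "gchart U \<phi>" and B: "B \<in> K"
  shows "openin (top_of_set (Cspace (dim L))) (\<phi> ` (U \<inter> piece B))"
    and "\<mu> \<in> mon B \<Longrightarrow> holo_on (dim L) (\<phi> ` (U \<inter> piece B)) ((\<lambda>p. chi p \<mu>) \<circ> inv_into U \<phi>)"
proof -
  obtain u m J where f: "frame u m" and J: "J \<subseteq> {..<dim L}" "u ` J \<in> K" and Ueq: "U = piece (u ` J)"
    and \<phi>: "\<And>p. p \<in> U \<Longrightarrow> \<phi> p = coords m p" using U unfolding gchart_def by blast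
  let ?I = "{j \<in> J. u j \<in> B}"
  have uI: "u ` ?I = u ` J \<inter> B" by blast
  have I: "?I \<subseteq> {..<dim L}" "u ` ?I \<in> K" using J subset_complex[OF B, of "u ` ?I"] by auto
  have UB: "U \<inter> piece B = piece (u ` ?I)" unfolding Ueq uI by (rule piece_Int[OF J(2) B])
  have img: "\<phi> ` (U \<inter> piece B) = {z \<in> Cspace (dim L). \<forall>i<dim L. i \<notin> ?I \<longrightarrow> z i \<noteq> 0}"
  proof -
    have "\<phi> ` (U \<inter> piece B) = coords m ` (U \<inter> piece B)" using \<phi> by (intro image_cong) auto
    also have "\<dots> = {z \<in> Cspace (dim L). \<forall>i<dim L. i \<notin> ?I \<longrightarrow> z i \<noteq> 0}"
      unfolding UB by (rule coords_image[OF f I])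
    finally show ?thesis .
  qed
  show op: "openin (top_of_set (Cspace (dim L))) (\<phi> ` (U \<inter> piece B))"
    unfolding img by (rule openin_Cspace_nonzero)
  show "holo_on (dim L) (\<phi> ` (U \<inter> piece B)) ((\<lambda>p. chi p \<mu>) \<circ> inv_into U \<phi>)" if \<mu>: "\<mu> \<in> mon B"
  proof (rule holo_on_cong)
    have \<mu>I: "\<mu> \<in> mon (u ` ?I)" using \<mu> mon_antimono[of "u ` ?I" B] by blast
    show "holo_on (dim L) (\<phi> ` (U \<inter> piece B)) (\<lambda>z. \<Prod>i<dim L. z i powi \<lfloor>\<mu> \<bullet> u i\<rfloor>)"
    proof (rule holo_on_monomial[OF op])
      fix z i assume z: "z \<in> \<phi> ` (U \<inter> piece B)" "i < dim L" "\<lfloor>\<mu> \<bullet> u i\<rfloor> < 0"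
      then have "\<not> 0 \<le> \<mu> \<bullet> u i" by auto
      then have "i \<notin> ?I" using \<mu>I unfolding mon_def by blast
      then show "z i \<noteq> 0" using z(1,2) unfolding img by blast
    qed
    fix z assume "z \<in> \<phi> ` (U \<inter> piece B)"
    then obtain p where p: "p \<in> U" "p \<in> piece B" "z = \<phi> p" by blast
    have "p \<in> piece (u ` ?I)" using UB p(1,2) by blast
    then show "(\<Prod>i<dim L. z i powi \<lfloor>\<mu> \<bullet> u i\<rfloor>) = ((\<lambda>p. chi p \<mu>) \<circ> inv_into U \<phi>) z"
      using chi_monomial[OF f I _ \<mu>I, of p] p inv_into_f_f[OF gchart_inj[OF U] p(1)] \<phi>[OF p(1)] by simp
  qed
qed

lemma gchart_transition:
  assumes U: "gchart U \<phi>" and V: "gchart V \<psi>"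
  shows "holo_map (dim L) (\<phi> ` (U \<inter> V)) (dim L) (\<psi> \<circ> inv_into U \<phi>)"
proof -
  obtain u m J where f: "frame u m" and J: "J \<subseteq> {..<dim L}" "u ` J \<in> K" and Veq: "V = piece (u ` J)"
    and \<psi>: "\<And>p. p \<in> V \<Longrightarrow> \<psi> p = coords m p" using V unfolding gchart_def by blast
  have inv: "inv_into U \<phi> z \<in> V" if "z \<in> \<phi> ` (U \<inter> V)" for z
    using that inv_into_f_f[OF gchart_inj[OF U]] by auto
  show ?thesis
    unfolding holo_map_def
  proof (intro conjI allI impI)
    show "openin (top_of_set (Cspace (dim L))) (\<phi> ` (U \<inter> V))"
      unfolding Veq by (rule gchart_holo(1)[OF U J(2)])
    show "(\<psi> \<circ> inv_into U \<phi>) ` \<phi> ` (U \<inter> V) \<subseteq> Cspace (dim L)"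
      using inv \<psi> by (auto simp: Cspace_def coords_def)
    fix j assume j: "j < dim L"
    show "holo_on (dim L) (\<phi> ` (U \<inter> V)) (\<lambda>z. (\<psi> \<circ> inv_into U \<phi>) z j)"
    proof (rule holo_on_cong)
      show "holo_on (dim L) (\<phi> ` (U \<inter> V)) ((\<lambda>p. chi p (m j)) \<circ> inv_into U \<phi>)"
        unfolding Veq by (rule gchart_holo(2)[OF U J(2) frame_mon[OF f j J(1)]])
      fix z assume "z \<in> \<phi> ` (U \<inter> V)"
      then show "((\<lambda>p. chi p (m j)) \<circ> inv_into U \<phi>) z = (\<psi> \<circ> inv_into U \<phi>) z j"
        using \<psi>[OF inv] j by (simp add: coords_def)
    qed
  qed
qed

text \<open>The atlas only records that the cone belongs to the fan. Since a smooth cone determines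
  its generators, the initial part of the basis is a simplex of \<open>K\<close>.\<close>

lemma atlas_gchart: "(U, \<phi>) \<in> atlas X \<Longrightarrow> gchart U \<phi>"
proof -
  assume "(U, \<phi>) \<in> atlas X"
  then obtain \<sigma> m u j where \<sigma>: "\<sigma> \<in> fan_of" and U: "U = toric_piece L fan_of \<sigma>"
    and \<phi>: "\<phi> = (\<lambda>p i. if i < dim L then toric_value \<sigma> p (m i) else 0)"
    and f: "frame u m" and j: "j \<le> dim L" "\<sigma> = hcone (u ` {..<j})"
    unfolding toric_manifold_def frame_def by auto
  have J: "{..<j} \<subseteq> {..<dim L}" using j(1) by auto
  obtain A where A: "A \<in> K" "\<sigma> = hcone A" using \<sigma> by (auto simp: fan_of_def)
  have B: "lattice_basis L (u ` {..<dim L})" using f by (simp add: frame_def)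
  obtain A' where A': "A \<subseteq> A'" "lattice_basis L A'" using extends_to_basis[OF A(1)] by blast
  have "u ` {..<j} = A"
    using lattice_cone_generators_subset[OF B image_mono[OF J] A'(2,1)]
      lattice_cone_generators_subset[OF A'(2,1) B image_mono[OF J]] A(2) j(2) by auto
  then have AK: "u ` {..<j} \<in> K" using A(1) by simp
  show "gchart U \<phi>"
    unfolding gchart_def
  proof (intro exI conjI ballI)
    show "frame u m" "{..<j} \<subseteq> {..<dim L}" "u ` {..<j} \<in> K" by fact+
    show "U = piece (u ` {..<j})" by (simp add: U j(2) piece_def)
    then show "\<phi> p = coords m p" if "p \<in> U" for p
      using that toric_value_chi[OF _ AK frame_mon[OF f _ J], of p] by (auto simp: \<phi> coords_def j(2))
  qed
qed

lemma mdim_X: "mdim X = dim L" by (simp add: toric_manifold_def)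

text \<open>Charts in the atlas list the generators of the cone first; this permutation reorders a
  basis accordingly.\<close>

lemma exists_sorting_permutation:
  assumes "J \<subseteq> {..<d}"
  shows "\<exists>\<pi>. bij_betw \<pi> {..<d} {..<d} \<and> \<pi> ` {..<card J} = J" and "card J \<le> d"
proof -
  have fin: "finite J" by (rule finite_subset[OF assms]) simp
  show le: "card J \<le> d" using card_mono[OF _ assms] by simp
  obtain f where f: "bij_betw f {..<card J} J" using finite_same_card_bij[of "{..<card J}" J] fin by auto
  have "card ({..<d} - {..<card J}) = card ({..<d} - J)"
    using le assms fin by (simp add: card_Diff_subset)
  then obtain g where g: "bij_betw g ({..<d} - {..<card J}) ({..<d} - J)"
    using finite_same_card_bij[of "{..<d} - {..<card J}" "{..<d} - J"] by auto
  define \<pi> where "\<pi> = (\<lambda>i. if i < card J then f i else g i)"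
  have 1: "bij_betw \<pi> {..<card J} J"
    using f by (subst bij_betw_cong[of _ _ f]) (auto simp: \<pi>_def)
  have 2: "bij_betw \<pi> ({..<d} - {..<card J}) ({..<d} - J)"
    using g by (subst bij_betw_cong[of _ _ g]) (auto simp: \<pi>_def)
  have "bij_betw \<pi> ({..<card J} \<union> ({..<d} - {..<card J})) (J \<union> ({..<d} - J))"
    by (rule bij_betw_combine[OF 1 2]) blast
  moreover have "{..<card J} \<union> ({..<d} - {..<card J}) = {..<d}" "J \<union> ({..<d} - J) = {..<d}"
    using le assms by auto
  ultimately show "\<exists>\<pi>. bij_betw \<pi> {..<d} {..<d} \<and> \<pi> ` {..<card J} = J"
    using 1 by (auto simp: bij_betw_def)
qed

text \<open>A general chart differs from one in the atlas on the same piece only by a permutation of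
  the coordinates, which \<open>h\<close> undoes. Topological statements therefore carry
  over.\<close>

lemma gchart_standard:
  assumes "gchart U \<phi>"
  obtains \<phi>' and h :: "(nat \<Rightarrow> complex) \<Rightarrow> nat \<Rightarrow> complex"
  where "(U, \<phi>') \<in> atlas X" "continuous_on UNIV h" "\<And>p. p \<in> U \<Longrightarrow> \<phi> p = h (\<phi>' p)"
proof -
  obtain u m J where f: "frame u m" and J: "J \<subseteq> {..<dim L}" "u ` J \<in> K" and Ueq: "U = piece (u ` J)"
    and \<phi>: "\<And>p. p \<in> U \<Longrightarrow> \<phi> p = coords m p" using assms unfolding gchart_def by blast
  obtain \<pi> where \<pi>: "bij_betw \<pi> {..<dim L} {..<dim L}" "\<pi> ` {..<card J} = J"
    using exists_sorting_permutation(1)[OF J(1)] by blast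
  have \<pi>lt: "\<pi> i < dim L" if "i < dim L" for i using \<pi>(1) that by (auto simp: bij_betw_def)
  have img: "u ` \<pi> ` {..<dim L} = u ` {..<dim L}" using \<pi>(1) by (simp add: bij_betw_def)
  have inj: "inj_on (u \<circ> \<pi>) {..<dim L}"
    using \<pi>(1) f by (intro comp_inj_on) (auto simp: bij_betw_def frame_def)
  have eq: "\<pi> i = \<pi> j \<longleftrightarrow> i = j" if "i < dim L" "j < dim L" for i j
    using \<pi>(1) that by (auto simp: bij_betw_def inj_on_def)
  let ?\<sigma> = "convex_cone hull (u ` J)"
  let ?\<phi> = "\<lambda>p i. if i < dim L then toric_value ?\<sigma> p (m (\<pi> i)) else 0"
  define h where "h = (\<lambda>(z :: nat \<Rightarrow> complex) i. if i < dim L then z (inv_into {..<dim L} \<pi> i) else 0)"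
  have "(U, ?\<phi>) \<in> atlas X"
    unfolding toric_manifold_def
  proof (simp only: cmanifold.simps, intro CollectI exI conjI)
    show "(U, ?\<phi>) = (toric_piece L fan_of ?\<sigma>, \<lambda>p i. if i < dim L then toric_value ?\<sigma> p ((m \<circ> \<pi>) i) else 0)"
      unfolding Ueq piece_def comp_def by (rule refl)
    show "?\<sigma> \<in> fan_of" using J(2) by (simp add: fan_of_def)
    show "inj_on (u \<circ> \<pi>) {..<dim L}" by (rule inj)
    show "lattice_basis L ((u \<circ> \<pi>) ` {..<dim L})" using f img unfolding frame_def image_comp by simp
    show "card J \<le> dim L" by (rule exists_sorting_permutation(2)[OF J(1)])
    show "?\<sigma> = convex_cone hull ((u \<circ> \<pi>) ` {..<card J})" by (simp only: image_comp[symmetric] \<pi>(2))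
    show "\<forall>i<dim L. (m \<circ> \<pi>) i \<in> dual_lattice L \<and> (\<forall>i'<dim L. (m \<circ> \<pi>) i \<bullet> (u \<circ> \<pi>) i' = (if i = i' then 1 else 0))"
      using f \<pi>lt eq by (simp add: frame_def)
  qed
  moreover have "continuous_on UNIV h"
  proof (rule continuous_on_coordinatewise_then_product)
    show "continuous_on UNIV (\<lambda>z. h z i)" for i by (cases "i < dim L") (simp_all add: h_def)
  qed
  moreover have "\<phi> p = h (?\<phi> p)" if p: "p \<in> U" for p
  proof
    fix i
    show "\<phi> p i = h (?\<phi> p) i"
    proof (cases "i < dim L")
      case True
      then have "i \<in> \<pi> ` {..<dim L}" using \<pi>(1) by (auto simp: bij_betw_def)
      then have "inv_into {..<dim L} \<pi> i < dim L" "\<pi> (inv_into {..<dim L} \<pi> i) = i"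
        using inv_into_into[of i \<pi> "{..<dim L}"] f_inv_into_f[of i \<pi> "{..<dim L}"] by auto
      then show ?thesis
        using True p toric_value_chi[OF _ J(2) frame_mon[OF f True J(1)], of p]
        by (simp add: \<phi>[OF p] h_def coords_def Ueq)
    qed (simp add: \<phi>[OF p] h_def coords_def)
  qed
  ultimately show thesis using that by blast
qed

lemma atlas_preimage_open:
  assumes "(U, \<phi>) \<in> atlas X" "open W"
  shows "openin (mtopology X) (U \<inter> \<phi> -` W)"
  unfolding mtopology_def using assms by (intro topology_generated_by_Basis) blast

lemma gchart_preimage_open:
  assumes "gchart U \<phi>" "open W"
  shows "openin (mtopology X) (U \<inter> \<phi> -` W)"
proof -
  obtain \<phi>' h where h: "(U, \<phi>') \<in> atlas X" "continuous_on UNIV h" "\<And>p. p \<in> U \<Longrightarrow> \<phi> p = h (\<phi>' p)"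
    using gchart_standard[OF assms(1)] by metis
  have "U \<inter> \<phi> -` W = U \<inter> \<phi>' -` (h -` W)" using h(3) by auto
  moreover have "open (h -` W)" using h(2) assms(2) by (simp add: continuous_on_open_vimage)
  ultimately show ?thesis using atlas_preimage_open[OF h(1)] by metis
qed

lemma gchart_open_if_image_open:
  assumes U: "gchart U \<phi>" and "V \<subseteq> U" "openin (top_of_set (Cspace (dim L))) (\<phi> ` V)"
  shows "openin (mtopology X) V"
proof -
  obtain W where W: "open W" "\<phi> ` V = Cspace (dim L) \<inter> W" using assms(3) by (auto simp: openin_open)
  have C: "\<phi> ` U \<subseteq> Cspace (dim L)" using U by (auto simp: gchart_def coords_def Cspace_def)
  have "V = U \<inter> \<phi> -` W"
  proof (intro subset_antisym subsetI)
    fix p assume p: "p \<in> U \<inter> \<phi> -` W"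
    then have "\<phi> p \<in> \<phi> ` V" using W(2) C by auto
    then obtain q where q: "q \<in> V" "\<phi> p = \<phi> q" by blast
    then have "p = q" using inj_onD[OF gchart_inj[OF U], of p q] p assms(2) by blast
    then show "p \<in> V" using q(1) by simp
  qed (use assms(2) W(2) in auto)
  then show ?thesis using gchart_preimage_open[OF U W(1)] by metis
qed

text \<open>Induction on the generation of the topology; for a generating set, the transition map is
  continuous on an open domain.\<close>

lemma gchart_image_open:
  assumes V: "openin (mtopology X) V" and U: "gchart U \<phi>"
  shows "openin (top_of_set (Cspace (dim L))) (\<phi> ` (U \<inter> V))"
proof -
  have inj: "inj_on \<phi> U" by (rule gchart_inj[OF U])
  have "generate_topology_on {U \<inter> \<phi> -` W | U \<phi> W. (U, \<phi>) \<in> atlas X \<and> open W} V"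
    using V unfolding mtopology_def by (rule openin_topology_generated_by)
  then show ?thesis
  proof induction
    case (Int a b)
    have "\<phi> ` (U \<inter> (a \<inter> b)) = \<phi> ` (U \<inter> a) \<inter> \<phi> ` (U \<inter> b)"
      using inj_on_image_Int[OF inj, of "U \<inter> a" "U \<inter> b"] by (simp add: Int_ac)
    then show ?case using openin_Int[OF Int.IH] by simp
  next
    case (UN K)
    have "\<phi> ` (U \<inter> \<Union>K) = (\<Union>k\<in>K. \<phi> ` (U \<inter> k))" by blast
    then show ?case using UN.IH by auto
  next
    case (Basis s)
    then obtain V \<psi> W where s: "s = V \<inter> \<psi> -` W" "(V, \<psi>) \<in> atlas X" "open W" by blast
    have t: "holo_map (dim L) (\<phi> ` (U \<inter> V)) (dim L) (\<psi> \<circ> inv_into U \<phi>)"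
      by (rule gchart_transition[OF U atlas_gchart[OF s(2)]])
    have eq: "\<phi> ` (U \<inter> s) = \<phi> ` (U \<inter> V) \<inter> (\<psi> \<circ> inv_into U \<phi>) -` W"
      using inv_into_f_f[OF inj] by (auto simp: s(1))
    have "openin (top_of_set (\<phi> ` (U \<inter> V))) (\<phi> ` (U \<inter> V) \<inter> (\<psi> \<circ> inv_into U \<phi>) -` W)"
      by (rule continuous_openin_preimage_gen[OF holo_map_continuous_on[OF t] s(3)])
    moreover have "openin (top_of_set (Cspace (dim L))) (\<phi> ` (U \<inter> V))" using t by (simp add: holo_map_def)
    ultimately show ?case unfolding eq by (rule openin_trans)
  qed simp
qed

lemma exists_frame:
  assumes A: "A \<in> K"
  obtains u m J where "frame u m" "J \<subseteq> {..<dim L}" "u ` J = A"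
proof -
  obtain B where B: "A \<subseteq> B" "lattice_basis L B" using extends_to_basis[OF A] by blast
  obtain u where u: "bij_betw u {..<dim L} B"
    using finite_same_card_bij[of "{..<dim L}" B] lattice_basis_finite[OF B(2)] lattice_basis_dim[OF B(2)] by auto
  have "\<exists>m. m \<in> dual_lattice L \<and> m \<bullet> b = 1 \<and> (\<forall>b'\<in>B - {b}. m \<bullet> b' = 0)" if "b \<in> B" for b
    using lattice_basis_dual_vector[OF B(2) that] by metis
  then obtain d where d: "\<And>b. b \<in> B \<Longrightarrow> d b \<in> dual_lattice L \<and> d b \<bullet> b = 1 \<and> (\<forall>b'\<in>B - {b}. d b \<bullet> b' = 0)"
    by metis
  have uB: "u i \<in> B" if "i < dim L" for i using u that by (auto simp: bij_betw_def)
  have inj: "u i = u j \<longleftrightarrow> i = j" if "i < dim L" "j < dim L" for i j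
    using u that by (auto simp: bij_betw_def inj_on_def)
  have "frame u (d \<circ> u)"
    unfolding frame_def
  proof (intro conjI allI impI)
    show "inj_on u {..<dim L}" "lattice_basis L (u ` {..<dim L})" using u B(2) by (auto simp: bij_betw_def)
    fix i assume i: "i < dim L"
    show "(d \<circ> u) i \<in> dual_lattice L" using d[OF uB[OF i]] by simp
    fix j assume j: "j < dim L"
    show "(d \<circ> u) i \<bullet> u j = (if i = j then 1 else 0)"
      using d[OF uB[OF i]] uB[OF j] inj[OF i j] by auto
  qed
  moreover have "u ` {i \<in> {..<dim L}. u i \<in> A} = A" using u B(1) by (auto simp: bij_betw_def)
  ultimately show thesis using that[of u "d \<circ> u" "{i \<in> {..<dim L}. u i \<in> A}"] by blast
qed

lemma exists_gchart:
  assumes "A \<in> K"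
  obtains \<phi> where "gchart (piece A) \<phi>"
proof -
  obtain u m J where "frame u m" "J \<subseteq> {..<dim L}" "u ` J = A" using exists_frame[OF assms] by metis
  then have "gchart (piece A) (coords m)" unfolding gchart_def using assms by metis
  then show thesis by (rule that)
qed

lemma points_toric_manifold: "points X = Points"
proof
  show "points X \<subseteq> Points"
    unfolding points_def using gchart_subset[OF atlas_gchart] by blast
  have "piece A \<subseteq> points X" if A: "A \<in> K" for A
  proof -
    obtain \<phi> where "gchart (piece A) \<phi>" by (rule exists_gchart[OF A])
    then obtain \<phi>' where "(piece A, \<phi>') \<in> atlas X" using gchart_standard by metis
    then show ?thesis by (auto simp: points_def)
  qed
  then show "Points \<subseteq> points X" by (auto simp: Points_eq)
qed

lemma topspace_toric_manifold: "topspace (mtopology X) = Points"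
proof
  show "topspace (mtopology X) \<subseteq> Points"
    unfolding mtopology_def topology_generated_by_topspace using gchart_subset[OF atlas_gchart] by blast
  have "piece A \<subseteq> topspace (mtopology X)" if A: "A \<in> K" for A
  proof -
    obtain \<phi> where "gchart (piece A) \<phi>" by (rule exists_gchart[OF A])
    then have "openin (mtopology X) (piece A \<inter> \<phi> -` UNIV)" by (rule gchart_preimage_open) simp
    then show ?thesis using openin_subset by fastforce
  qed
  then show "Points \<subseteq> topspace (mtopology X)" by (auto simp: Points_eq)
qed

lemma chi_preimage_open:
  assumes A: "A \<in> K" and \<mu>: "\<mu> \<in> mon A" and W: "open W"
  shows "openin (mtopology X) {p \<in> piece A. chi p \<mu> \<in> W}"
proof -
  obtain \<phi> where \<phi>: "gchart (piece A) \<phi>" by (rule exists_gchart[OF A])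
  have holo: "holo_on (dim L) (\<phi> ` piece A) ((\<lambda>p. chi p \<mu>) \<circ> inv_into (piece A) \<phi>)"
    and op: "openin (top_of_set (Cspace (dim L))) (\<phi> ` piece A)"
    using gchart_holo[OF \<phi> A] \<mu> by simp_all
  have eq: "\<phi> ` {p \<in> piece A. chi p \<mu> \<in> W} = \<phi> ` piece A \<inter> ((\<lambda>p. chi p \<mu>) \<circ> inv_into (piece A) \<phi>) -` W"
    using inv_into_f_f[OF gchart_inj[OF \<phi>]] by auto
  have "openin (top_of_set (\<phi> ` piece A)) (\<phi> ` piece A \<inter> ((\<lambda>p. chi p \<mu>) \<circ> inv_into (piece A) \<phi>) -` W)"
    by (rule continuous_openin_preimage_gen[OF holo_on_continuous_on[OF holo] W])
  then have "openin (top_of_set (Cspace (dim L))) (\<phi> ` {p \<in> piece A. chi p \<mu> \<in> W})"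
    unfolding eq by (rule openin_trans[OF _ op])
  then show ?thesis by (intro gchart_open_if_image_open[OF \<phi>]) auto
qed

section \<open>Separation of points and countability\<close>

lemma card_basis: "S \<in> K \<Longrightarrow> card S = dim L \<Longrightarrow> lattice_basis L S"
  using extends_to_basis[of S] lattice_basis_dim lattice_basis_finite card_subset_eq by metis

lemma coordinate_mon:
  assumes "m \<in> dual_lattice L" "m \<bullet> s = 1" "\<forall>a\<in>S - {s}. m \<bullet> a = 0"
  shows "m \<in> mon S"
proof -
  have "0 \<le> m \<bullet> a" if "a \<in> S" for a using assms(2,3) that by (cases "a = s") auto
  then show ?thesis using assms(1) by (simp add: mon_def)
qed

text \<open>In the monoid of \<open>S\<close>, a character vanishing on the wall
  \<open>S - {s}\<close> is a nonnegative multiple of \<open>m\<close>. So a single nonzero value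
  puts the point into the piece of the wall.\<close>

lemma cross_wall:
  assumes S: "S \<in> K" "lattice_basis L S" and s: "s \<in> S" and m: "m \<in> dual_lattice L" "m \<bullet> s = 1"
    "\<forall>a\<in>S - {s}. m \<bullet> a = 0" and p: "p \<in> piece S" "chi p m \<noteq> 0"
  shows "m \<in> mon S" "p \<in> piece (S - {s})"
proof -
  show mS: "m \<in> mon S" by (rule coordinate_mon[OF m])
  have "chi p \<nu> \<noteq> 0" if \<nu>: "\<nu> \<in> mon S" "\<forall>b\<in>S - {s}. \<nu> \<bullet> b = 0" for \<nu>
  proof -
    have "\<nu> \<bullet> s \<in> \<int>" by (rule inner_Ints[OF S(1) s mon_dual[OF \<nu>(1)]])
    moreover have "0 \<le> \<nu> \<bullet> s" using \<nu>(1) s by (simp add: mon_def)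
    ultimately obtain n where n: "\<nu> \<bullet> s = of_nat n" by (metis Ints_cases of_int_0_le_iff of_int_of_nat_eq zero_le_imp_eq_int)
    have "\<nu> = of_nat n *\<^sub>R m"
    proof (rule dual_lattice_eqI[OF S(2) mon_dual[OF \<nu>(1)] mon_dual[OF mon_scale_nat[OF mS]]])
      fix b assume "b \<in> S"
      then show "\<nu> \<bullet> b = (of_nat n *\<^sub>R m) \<bullet> b" using n m \<nu>(2) by (cases "b = s") auto
    qed
    then show ?thesis using chi_scale_nat[OF p(1) S(1) mS, of n] p(2) by simp
  qed
  then show "p \<in> piece (S - {s})" using piece_subset_iff[OF S(1), of "S - {s}" p] p(1) by blast
qed

text \<open>Walk between the two cones. If \<open>m\<close> does not vanish at \<open>p\<close>, or
  \<open>- m\<close> at \<open>q\<close>, that point lies in the piece of a wall and hence in that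
  of the neighbouring simplex, which shares more generators with the other one. If both values are
  0, the sets where they have norm below 1 are disjoint, since on the overlap the two values are
  inverse to each other.\<close>

lemma separated_points:
  assumes "exchange" and "S \<in> K" "lattice_basis L S" "T \<in> K" "lattice_basis L T"
    and "p \<in> piece S" "q \<in> piece T" "p \<noteq> q"
  shows "\<exists>U V. openin (mtopology X) U \<and> openin (mtopology X) V \<and> p \<in> U \<and> q \<in> V \<and> disjnt U V"
  using assms(2-)
proof (induction "card (S - T)" arbitrary: S T rule: less_induct)
  case (less S T)
  note S = less.prems(1,2) and T = less.prems(3,4) and p = less.prems(5) and q = less.prems(6) and pq = less.prems(7)
  show ?case
  proof (cases "S = T")
    case True
    obtain \<phi> where \<phi>: "gchart (piece S) \<phi>" by (rule exists_gchart[OF S(1)])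
    have "\<phi> p \<noteq> \<phi> q" using inj_onD[OF gchart_inj[OF \<phi>], of p q] p q pq True by blast
    then obtain W W' where W: "open W" "open W'" "\<phi> p \<in> W" "\<phi> q \<in> W'" "W \<inter> W' = {}"
      using hausdorff[of "\<phi> p" "\<phi> q"] by metis
    show ?thesis
      using gchart_preimage_open[OF \<phi> W(1)] gchart_preimage_open[OF \<phi> W(2)] W(3-5) p q True
      by (intro exI[of _ "piece S \<inter> \<phi> -` W"] exI[of _ "piece S \<inter> \<phi> -` W'"]) (auto simp: disjnt_def)
  next
    case False
    obtain s t m where st: "s \<in> S - T" "t \<in> T - S" and m: "m \<in> dual_lattice L" "m \<bullet> s = 1" "m \<bullet> t = -1"
      "\<forall>a\<in>S - {s}. m \<bullet> a = 0" "\<forall>a\<in>T - {t}. m \<bullet> a = 0"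
      and flip: "insert t (S - {s}) \<in> K" "insert s (T - {t}) \<in> K"
      using assms(1)[unfolded exchange_def, rule_format, OF S(1) T(1) S(2) T(2) False] by metis
    have m': "- m \<in> dual_lattice L" "- m \<bullet> t = 1" "\<forall>a\<in>T - {t}. - m \<bullet> a = 0"
      using m dual_lattice_uminus by auto
    have finS: "finite S" "finite T" using complex_finite S(1) T(1) by blast+
    have dS: "card S = dim L" "card T = dim L" using lattice_basis_dim S(2) T(2) by metis+
    consider (p) "chi p m \<noteq> 0" | (q) "chi q (- m) \<noteq> 0" | (0) "chi p m = 0" "chi q (- m) = 0" by blast
    then show ?thesis
    proof cases
      case p
      have "p \<in> piece (S - {s})" using cross_wall(2)[OF S _ m(1,2,4) less.prems(5) p] st(1) by blast
      then have p': "p \<in> piece (insert t (S - {s}))" using piece_mono[OF _ flip(1)] by blast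
      have "card (insert t (S - {s})) = Suc (card (S - {s}))" using st finS by (intro card_insert_disjoint) auto
      also have "\<dots> = dim L" using card.remove[OF finS(1), of s] st dS by simp
      finally have "card (insert t (S - {s})) = dim L" .
      then have b: "lattice_basis L (insert t (S - {s}))" by (rule card_basis[OF flip(1)])
      have "insert t (S - {s}) - T = (S - T) - {s}" using st by blast
      then have "card (insert t (S - {s}) - T) < card (S - T)" using st(1) finS by (metis card_Diff1_less finite_Diff)
      then show ?thesis using less.hyps[OF _ flip(1) b T p' q pq] by blast
    next
      case q
      have "q \<in> piece (T - {t})" using cross_wall(2)[OF T _ m' less.prems(6) q] st(2) by blast
      then have q': "q \<in> piece (insert s (T - {t}))" using piece_mono[OF _ flip(2)] by blast
      have "card (insert s (T - {t})) = Suc (card (T - {t}))" using st finS by (intro card_insert_disjoint) auto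
      also have "\<dots> = dim L" using card.remove[OF finS(2), of t] st dS by simp
      finally have "card (insert s (T - {t})) = dim L" .
      then have b: "lattice_basis L (insert s (T - {t}))" by (rule card_basis[OF flip(2)])
      have "S - insert s (T - {t}) = (S - T) - {s}" using st by blast
      then have "card (S - insert s (T - {t})) < card (S - T)" using st(1) finS by (metis card_Diff1_less finite_Diff)
      then show ?thesis using less.hyps[OF _ S flip(2) b p q' pq] by blast
    next
      case 0
      have mS: "m \<in> mon S" by (rule coordinate_mon[OF m(1,2,4)])
      have mT: "- m \<in> mon T" by (rule coordinate_mon[OF m'])
      let ?U = "{r \<in> piece S. chi r m \<in> ball 0 1}" and ?V = "{r \<in> piece T. chi r (- m) \<in> ball 0 1}"
      have "?U \<inter> ?V = {}"
      proof (rule ccontr)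
        assume "?U \<inter> ?V \<noteq> {}"
        then obtain r where r: "r \<in> piece S \<inter> piece T" "norm (chi r m) < 1" "norm (chi r (- m)) < 1" by auto
        have ST: "S \<inter> T \<in> K" by (rule subset_complex[OF S(1)]) simp
        have "r \<in> piece (S \<inter> T)" using r(1) piece_Int[OF S(1) T(1)] by simp
        moreover have "m \<in> mon (S \<inter> T)" "- m \<in> mon (S \<inter> T)"
          using mS mT mon_antimono[of "S \<inter> T" S] mon_antimono[of "S \<inter> T" T] by blast+
        ultimately have "chi r m * chi r (- m) = 1" using chi_add[OF _ ST] chi_0[OF _ ST] by (metis add.right_inverse)
        then have "norm (chi r m) * norm (chi r (- m)) = 1" by (metis norm_mult norm_one)
        moreover have "norm (chi r m) * norm (chi r (- m)) < 1 * 1" using r(2,3) by (intro mult_strict_mono) auto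
        ultimately show False by simp
      qed
      then show ?thesis
        using chi_preimage_open[OF S(1) mS open_ball, of 0 1] chi_preimage_open[OF T(1) mT open_ball, of 0 1] p q 0
        by - (rule exI[of _ ?U], rule exI[of _ ?V], simp add: disjnt_def)
    qed
  qed
qed

text \<open>Finitely many charts cover the variety, and the model space is second countable.\<close>

lemma second_countable_toric_manifold: "second_countable (mtopology X)"
proof -
  have "\<exists>\<phi>. gchart (piece A) \<phi>" if "A \<in> K" for A using exists_gchart[OF that] by metis
  then obtain \<phi> where \<phi>: "\<And>A. A \<in> K \<Longrightarrow> gchart (piece A) (\<phi> A)" by metis
  obtain \<B> :: "(nat \<Rightarrow> complex) set set" where B: "countable \<B>" "\<And>W. W \<in> \<B> \<Longrightarrow> open W"
    "\<And>S. open S \<Longrightarrow> \<exists>U. U \<subseteq> \<B> \<and> S = \<Union>U"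
    using univ_second_countable by metis
  let ?C = "(\<lambda>(A, W). piece A \<inter> \<phi> A -` W) ` (K \<times> \<B>)"
  show ?thesis
    unfolding second_countable_def
  proof (intro exI[of _ ?C] conjI ballI allI impI)
    show "countable ?C" using B(1) finite_complex by (intro countable_image countable_SIGMA countable_finite[OF finite_complex])
    show "openin (mtopology X) V" if "V \<in> ?C" for V
      using that gchart_preimage_open[OF \<phi>] B(2) by auto
    fix U p assume U: "openin (mtopology X) U \<and> p \<in> U"
    then have "p \<in> Points" using openin_subset topspace_toric_manifold by blast
    then obtain A where A: "A \<in> K" "p \<in> piece A" using Points_eq by blast
    have "openin (top_of_set (Cspace (dim L))) (\<phi> A ` (piece A \<inter> U))"
      using gchart_image_open[OF _ \<phi>[OF A(1)]] U by blast
    then obtain W where W: "open W" "\<phi> A ` (piece A \<inter> U) = Cspace (dim L) \<inter> W" by (auto simp: openin_open)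
    then obtain \<U> where \<U>: "\<U> \<subseteq> \<B>" "W = \<Union>\<U>" using B(3) by blast
    have "\<phi> A p \<in> W" using W(2) A(2) U by blast
    then obtain W' where W': "W' \<in> \<B>" "\<phi> A p \<in> W'" "W' \<subseteq> W" using \<U> by blast
    have "piece A \<inter> \<phi> A -` W' \<subseteq> U"
    proof
      fix q assume q: "q \<in> piece A \<inter> \<phi> A -` W'"
      have "\<phi> A q \<in> Cspace (dim L)" using \<phi>[OF A(1)] q by (auto simp: gchart_def coords_def Cspace_def)
      then have "\<phi> A q \<in> \<phi> A ` (piece A \<inter> U)" using W(2) q W'(3) by blast
      then obtain r where "r \<in> piece A" "r \<in> U" "\<phi> A q = \<phi> A r" by blast
      then show "q \<in> U" using inj_onD[OF gchart_inj[OF \<phi>[OF A(1)]], of q r] q by blast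
    qed
    then show "\<exists>V\<in>?C. p \<in> V \<and> V \<subseteq> U"
      using A W'(1,2) by (intro bexI[of _ "piece A \<inter> \<phi> A -` W'"]) auto
  qed
qed

lemma complex_manifold_toric:
  assumes "exchange"
  shows "complex_manifold X"
  unfolding complex_manifold_def
proof (intro conjI)
  show "\<forall>(U, \<phi>)\<in>atlas X. inj_on \<phi> U \<and> openin (top_of_set (Cspace (mdim X))) (\<phi> ` U)"
  proof (intro ballI case_prodI2 conjI)
    fix U \<phi> c assume "c \<in> atlas X" "c = (U, \<phi>)"
    then have U: "gchart U \<phi>" using atlas_gchart by blast
    show "inj_on \<phi> U" by (rule gchart_inj[OF U])
    show "openin (top_of_set (Cspace (mdim X))) (\<phi> ` U)"
      using gchart_transition[OF U U] by (simp add: holo_map_def mdim_X)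
  qed
  show "\<forall>(U, \<phi>)\<in>atlas X. \<forall>(V, \<psi>)\<in>atlas X.
      holo_map (mdim X) (\<phi> ` (U \<inter> V)) (mdim X) (\<psi> \<circ> inv_into U \<phi>)"
    using gchart_transition atlas_gchart unfolding mdim_X by blast
  show "Hausdorff_space (mtopology X)"
    unfolding Hausdorff_space_def topspace_toric_manifold
    using separated_points[OF assms] piece_basis by metis
  show "second_countable (mtopology X)" by (rule second_countable_toric_manifold)
qed

end

subsection \<open>The projective line bundle of a suspension\<close>

lemma holo_map_cong:
  assumes "holo_map k U l f" "\<And>z. z \<in> U \<Longrightarrow> f z = g z"
  shows "holo_map k U l g"
  using assms holo_on_cong[of k U "\<lambda>z. f z _" "\<lambda>z. g z _"] unfolding holo_map_def
  by (metis (no_types, lifting) image_cong)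

context simplicial_fan
begin

lemma piece_open: "A \<in> K \<Longrightarrow> openin (mtopology X) (piece A)"
  using chi_preimage_open[of A 0 UNIV] by simp

lemma gchart_Cspace: "gchart U \<phi> \<Longrightarrow> p \<in> U \<Longrightarrow> \<phi> p \<in> Cspace (dim L)"
  by (auto simp: gchart_def coords_def Cspace_def)

text \<open>With all charts of \<open>P\<close> pulled back to charts in the sense of
  \<open>gchart\<close>, both holomorphy conditions turn into transitions between charts of
  \<open>X\<close>.\<close>

lemma biholomorphicI:
  fixes P :: "'q cmanifold"
  assumes dim: "mdim P = dim L" and bij: "bij_betw f Points (points P)"
    and charts: "\<And>V \<psi>. (V, \<psi>) \<in> atlas P \<Longrightarrow> gchart {p \<in> Points. f p \<in> V} (\<psi> \<circ> f)"
  shows "biholomorphic X P"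
proof -
  let ?g = "inv_into Points f"
  have inj: "inj_on f Points" and img: "f ` Points = points P" using bij by (auto simp: bij_betw_def)
  have gf: "?g (f p) = p" if "p \<in> Points" for p using inv_into_f_f[OF inj that] .
  have VP: "V \<subseteq> points P" if "(V, \<psi>) \<in> atlas P" for V \<psi> using that by (auto simp: points_def)
  have surj: "\<exists>p\<in>Points. f p = y" if "(V, \<psi>) \<in> atlas P" "y \<in> V" for V \<psi> y
    using VP[OF that(1)] that(2) img by (metis imageE subsetD)
  have inj\<psi>: "inj_on \<psi> V" if c: "(V, \<psi>) \<in> atlas P" for V \<psi>
  proof (rule inj_onI)
    fix y y' assume y: "y \<in> V" "y' \<in> V" "\<psi> y = \<psi> y'"
    obtain p where p: "p \<in> Points" "f p = y" using surj[OF c y(1)] by blast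
    obtain p' where p': "p' \<in> Points" "f p' = y'" using surj[OF c y(2)] by blast
    have "p = p'" using inj_onD[OF gchart_inj[OF charts[OF c]], of p p'] p p' y by simp
    then show "y = y'" using p p' by simp
  qed
  have topP: "topspace (mtopology P) = points P"
  proof
    show "topspace (mtopology P) \<subseteq> points P"
      unfolding mtopology_def topology_generated_by_topspace points_def by blast
    have "V \<subseteq> topspace (mtopology P)" if "(V, \<psi>) \<in> atlas P" for V \<psi>
    proof -
      have "V \<inter> \<psi> -` UNIV \<in> {U \<inter> \<phi> -` W | U \<phi> W. (U, \<phi>) \<in> atlas P \<and> open W}" using that open_UNIV by blast
      then show ?thesis unfolding mtopology_def topology_generated_by_topspace by auto
    qed
    then show "points P \<subseteq> topspace (mtopology P)" by (auto simp: points_def)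
  qed
  \<comment> \<open>Openness of \<open>f\<close>, which is the continuity of its inverse, checked in
    each chart of \<open>P\<close>.\<close>
  have open_image: "openin (mtopology P) (f ` O1)" if O1: "openin (mtopology X) O1" for O1
  proof -
    have OP: "O1 \<subseteq> Points" using openin_subset[OF O1] topspace_toric_manifold by simp
    have "openin (mtopology P) (V \<inter> f ` O1)" if c: "(V, \<psi>) \<in> atlas P" for V \<psi>
    proof -
      let ?U = "{p \<in> Points. f p \<in> V}"
      have "openin (top_of_set (Cspace (dim L))) ((\<psi> \<circ> f) ` (?U \<inter> O1))"
        by (rule gchart_image_open[OF O1 charts[OF c]])
      then obtain W where W: "open W" "(\<psi> \<circ> f) ` (?U \<inter> O1) = Cspace (dim L) \<inter> W" by (auto simp: openin_open)
      have "V \<inter> f ` O1 = V \<inter> \<psi> -` W"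
      proof (intro subset_antisym subsetI)
        fix y assume "y \<in> V \<inter> f ` O1"
        then obtain p where p: "p \<in> O1" "y = f p" "f p \<in> V" by blast
        then have "(\<psi> \<circ> f) p \<in> (\<psi> \<circ> f) ` (?U \<inter> O1)" using OP by (intro imageI) auto
        then show "y \<in> V \<inter> \<psi> -` W" using W(2) p by auto
      next
        fix y assume y: "y \<in> V \<inter> \<psi> -` W"
        then obtain p where p: "p \<in> Points" "f p = y" using surj[OF c] by blast
        have "(\<psi> \<circ> f) p \<in> Cspace (dim L) \<inter> W"
          using gchart_Cspace[OF charts[OF c], of p] p y by auto
        then obtain r where r: "r \<in> ?U \<inter> O1" "(\<psi> \<circ> f) p = (\<psi> \<circ> f) r" unfolding W(2)[symmetric] by blast
        have "p = r" using inj_onD[OF gchart_inj[OF charts[OF c]] r(2)] r(1) p y by blast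
        then show "y \<in> V \<inter> f ` O1" using r(1) p y by blast
      qed
      then show ?thesis unfolding mtopology_def using c W(1) by (auto intro!: topology_generated_by_Basis)
    qed
    then have "openin (mtopology P) (\<Union>{V \<inter> f ` O1 | V \<psi>. (V, \<psi>) \<in> atlas P})"
      by (intro openin_Union) blast
    moreover have "f ` O1 = \<Union>{V \<inter> f ` O1 | V \<psi>. (V, \<psi>) \<in> atlas P}"
    proof (intro subset_antisym subsetI)
      fix y assume y: "y \<in> f ` O1"
      then have "y \<in> points P" using OP img by blast
      then obtain V \<psi> where "(V, \<psi>) \<in> atlas P" "y \<in> V" by (auto simp: points_def)
      then show "y \<in> \<Union>{V \<inter> f ` O1 | V \<psi>. (V, \<psi>) \<in> atlas P}" using y by blast
    qed blast
    ultimately show ?thesis by (simp only:)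
  qed
  have "holomorphic_map X P f"
    unfolding holomorphic_map_def
  proof (intro conjI ballI case_prodI2)
    show "continuous_map (mtopology X) (mtopology P) f"
      unfolding mtopology_def[of P]
    proof (rule continuous_on_generated_topo)
      fix U assume "U \<in> {U \<inter> \<phi> -` W | U \<phi> W. (U, \<phi>) \<in> atlas P \<and> open W}"
      then obtain V \<psi> W where U: "U = V \<inter> \<psi> -` W" "(V, \<psi>) \<in> atlas P" "open W" by blast
      have "f -` U \<inter> topspace (mtopology X) = {p \<in> Points. f p \<in> V} \<inter> (\<psi> \<circ> f) -` W"
        unfolding topspace_toric_manifold U(1) by auto
      then show "openin (mtopology X) (f -` U \<inter> topspace (mtopology X))"
        using gchart_preimage_open[OF charts[OF U(2)] U(3)] by simp
    next
      show "f ` topspace (mtopology X) \<subseteq> \<Union>{U \<inter> \<phi> -` W | U \<phi> W. (U, \<phi>) \<in> atlas P \<and> open W}"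
      proof -
        have *: "\<Union>{U \<inter> \<phi> -` W | U \<phi> W. (U, \<phi>) \<in> atlas P \<and> open W} = points P"
          using topP by (simp only: mtopology_def topology_generated_by_topspace)
        show ?thesis unfolding * topspace_toric_manifold img by (rule subset_refl)
      qed
    qed
    fix c d U \<phi> V \<psi> assume c: "c \<in> atlas X" "c = (U, \<phi>)" and d: "d \<in> atlas P" "d = (V, \<psi>)"
    have U: "gchart U \<phi>" using atlas_gchart c by blast
    have "{p \<in> U. f p \<in> V} = U \<inter> {p \<in> Points. f p \<in> V}" using gchart_subset[OF U] by blast
    then show "holo_map (mdim X) (\<phi> ` {x \<in> U. f x \<in> V}) (mdim P) (\<psi> \<circ> f \<circ> inv_into U \<phi>)"
      using gchart_transition[OF U charts, of V \<psi>] d dim by (simp add: mdim_X)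
  qed
  moreover have "holomorphic_map P X ?g"
    unfolding holomorphic_map_def
  proof (intro conjI ballI case_prodI2)
    show "continuous_map (mtopology P) (mtopology X) ?g"
      unfolding continuous_map_def
    proof (intro conjI allI impI)
      show "?g \<in> topspace (mtopology P) \<rightarrow> topspace (mtopology X)"
        using img by (auto simp: topP topspace_toric_manifold intro: inv_into_into)
      fix O1 assume O1: "openin (mtopology X) O1"
      have "{y \<in> topspace (mtopology P). ?g y \<in> O1} = f ` O1"
        using openin_subset[OF O1] img gf unfolding topP topspace_toric_manifold by (auto simp: image_iff) (metis f_inv_into_f)
      then show "openin (mtopology P) {y \<in> topspace (mtopology P). ?g y \<in> O1}" using open_image[OF O1] by simp
    qed
    fix c d U \<phi> V \<psi> assume c: "c \<in> atlas P" "c = (V, \<psi>)" and d: "d \<in> atlas X" "d = (U, \<phi>)"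
    have V: "(V, \<psi>) \<in> atlas P" using c by simp
    let ?U = "{p \<in> Points. f p \<in> V}"
    have U: "gchart U \<phi>" using atlas_gchart d by blast
    have dom: "\<psi> ` {y \<in> V. ?g y \<in> U} = (\<psi> \<circ> f) ` (?U \<inter> U)"
    proof (intro subset_antisym subsetI)
      fix z assume "z \<in> \<psi> ` {y \<in> V. ?g y \<in> U}"
      then obtain y where y: "y \<in> V" "?g y \<in> U" "z = \<psi> y" by blast
      then obtain p where p: "p \<in> Points" "f p = y" using surj[OF V] by blast
      then have "p \<in> ?U \<inter> U" using y gf by auto
      then show "z \<in> (\<psi> \<circ> f) ` (?U \<inter> U)" using y(3) p(2) by auto
    next
      fix z assume "z \<in> (\<psi> \<circ> f) ` (?U \<inter> U)"
      then show "z \<in> \<psi> ` {y \<in> V. ?g y \<in> U}" using gf by auto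
    qed
    show "holo_map (mdim P) (\<psi> ` {x \<in> V. ?g x \<in> U}) (mdim X) (\<phi> \<circ> ?g \<circ> inv_into V \<psi>)"
      unfolding dom dim mdim_X
    proof (rule holo_map_cong[OF gchart_transition[OF charts[OF V] U]])
      fix z assume "z \<in> (\<psi> \<circ> f) ` (?U \<inter> U)"
      then obtain p where p: "p \<in> ?U" "p \<in> U" "z = (\<psi> \<circ> f) p" by blast
      have "inv_into ?U (\<psi> \<circ> f) z = p" using inv_into_f_f[OF gchart_inj[OF charts[OF V]] p(1)] p(3) by simp
      moreover have "inv_into V \<psi> z = f p" using inv_into_f_f[OF inj\<psi>[OF V], of "f p"] p by simp
      ultimately show "(\<phi> \<circ> inv_into ?U (\<psi> \<circ> f)) z = (\<phi> \<circ> ?g \<circ> inv_into V \<psi>) z" using gf p(1) by simp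
    qed
  qed
  ultimately show ?thesis
    unfolding biholomorphic_def points_toric_manifold using bij by blast
qed

end

section \<open>The projection to the toric variety of the quotient fan\<close>

sublocale fan_suspension \<subseteq> Q: simplicial_fan quotient_lattice quotient_complex
  by (rule quotient_simplicial_fan)

context fan_suspension
begin

definition "bar A = perp_proj x ` (A - {x, - x})"

lemma bar_complex: "A \<in> K \<Longrightarrow> bar A \<in> quotient_complex"
  using link_Diff by (auto simp: bar_def quotient_complex_def)

lemma bar_mono: "A \<subseteq> B \<Longrightarrow> bar A \<subseteq> bar B" by (auto simp: bar_def)

lemma bar_insert: "bar (insert x A) = bar A" "bar (insert (- x) A) = bar A"
  by (auto simp: bar_def)

lemma bar_link: "A \<in> link \<Longrightarrow> bar A = perp_proj x ` A"
  using linkD(2,3)[of A] by (auto simp: bar_def)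

lemma quotient_complexE:
  assumes "C \<in> quotient_complex"
  obtains D where "D \<in> link" "C = bar D"
  using assms bar_link unfolding quotient_complex_def by blast

lemma bar_Int:
  assumes "A \<in> K" "B \<in> K"
  shows "bar A \<inter> bar B = bar (A \<inter> B)"
proof -
  have "A \<inter> B - {x, - x} = (A - {x, - x}) \<inter> (B - {x, - x})" by blast
  then show ?thesis
    unfolding bar_def using perp_proj_image_Int[OF link_Diff[OF assms(1)] link_Diff[OF assms(2)]] by simp
qed

text \<open>This lets a point of the total space be projected by restricting its homomorphism to the
  characters orthogonal to \<open>x\<close>.\<close>

lemma Q_mon: "Q.mon (bar A) = {m \<in> mon A. m \<bullet> x = 0}"
proof -
  have "(\<forall>a\<in>A - {x, - x}. 0 \<le> m \<bullet> a) \<longleftrightarrow> (\<forall>a\<in>A. 0 \<le> m \<bullet> a)" if "m \<bullet> x = 0" for m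
    using that by auto
  then show ?thesis
    by (auto simp: Q.mon_def mon_def bar_def dual_quotient_lattice inner_perp_proj)
qed

lemma Q_mon_perp:
  assumes "\<nu> \<in> Q.mon (bar A)" "\<And>b. b \<in> bar B \<Longrightarrow> \<nu> \<bullet> b = 0" "b \<in> B"
  shows "\<nu> \<bullet> b = 0"
proof -
  have \<nu>x: "\<nu> \<bullet> x = 0" using assms(1) by (simp add: Q_mon)
  show ?thesis
  proof (cases "b \<in> {x, - x}")
    case False
    then have "perp_proj x b \<in> bar B" using assms(3) by (simp add: bar_def)
    then show ?thesis using assms(2) inner_perp_proj[OF \<nu>x] by metis
  qed (use \<nu>x in auto)
qed

lemma bar_perp: "\<nu> \<bullet> x = 0 \<Longrightarrow> (\<And>b. b \<in> B \<Longrightarrow> \<nu> \<bullet> b = 0) \<Longrightarrow> c \<in> bar B \<Longrightarrow> \<nu> \<bullet> c = 0"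
  by (auto simp: bar_def inner_perp_proj)

definition "over p b A \<longleftrightarrow> A \<in> K \<and> p \<in> piece A \<and> b \<in> Q.piece (bar A) \<and>
  (\<forall>\<mu>\<in>Q.mon (bar A). Q.chi b \<mu> = chi p \<mu>)"

text \<open>The choice is harmless: by \<open>over_proj\<close> the result is the restriction in
  every piece containing \<open>p\<close>.\<close>

definition "proj p = (SOME b. \<exists>A. over p b A)"

lemma exists_over:
  assumes p: "p \<in> piece A" and A: "A \<in> K"
  shows "\<exists>b. over p b A"
proof -
  have sub: "Q.mon (bar A) \<subseteq> mon A" by (auto simp: Q_mon)
  have "restrict (chi p) (Q.mon (bar A)) \<in> Q.homs (bar A)"
    unfolding Q.homs_iff using chi_0[OF p A] chi_add[OF p A] sub Q.mon_add by (auto simp: subset_iff)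
  then obtain b where "b \<in> Q.piece (bar A)" "\<And>m. m \<in> Q.mon (bar A) \<Longrightarrow> Q.chi b m = restrict (chi p) (Q.mon (bar A)) m"
    using Q.point_exists[OF bar_complex[OF A]] by metis
  then show ?thesis using p A by (auto simp: over_def)
qed

text \<open>A point in the pieces of \<open>A\<close> and \<open>B\<close> lies in that of their
  intersection \<open>C\<close>. Base characters orthogonal to \<open>bar C\<close> are then units
  at \<open>p\<close>, so the point obtained from \<open>B\<close> lies in the piece of
  \<open>bar C\<close>; clearing denominators recovers its values on the characters of
  \<open>bar A\<close>.\<close>

lemma over_proj:
  assumes p: "p \<in> piece A" and A: "A \<in> K"
  shows "over p (proj p) A"
proof -
  have "\<exists>B. over p (proj p) B"
    unfolding proj_def using exists_over[OF p A] by (rule someI2_ex[OF ex_comm[THEN iffD1], OF exI]) blast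
  then obtain B where B: "B \<in> K" "p \<in> piece B" "proj p \<in> Q.piece (bar B)"
    "\<And>\<mu>. \<mu> \<in> Q.mon (bar B) \<Longrightarrow> Q.chi (proj p) \<mu> = chi p \<mu>" by (auto simp: over_def)
  let ?C = "B \<inter> A"
  have C: "?C \<in> K" by (rule subset_complex[OF A]) simp
  have pC: "p \<in> piece ?C" using piece_Int[OF B(1) A] p B(2) by blast
  have barC: "bar ?C \<subseteq> bar B" by (rule bar_mono) simp
  have nz: "chi p \<nu> \<noteq> 0" if "\<nu> \<in> Q.mon (bar B)" "\<forall>b\<in>bar ?C. \<nu> \<bullet> b = 0" for \<nu>
  proof (rule chi_unit[OF pC C])
    show "\<nu> \<in> mon ?C" using that(1) mon_antimono[of ?C B] by (auto simp: Q_mon)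
    show "\<nu> \<bullet> a = 0" if "a \<in> ?C" for a
      by (rule Q_mon_perp[OF \<open>\<nu> \<in> Q.mon (bar B)\<close> _ that]) (use \<open>\<forall>b\<in>bar ?C. \<nu> \<bullet> b = 0\<close> in blast)
  qed
  have projC: "proj p \<in> Q.piece (bar ?C)"
    using Q.piece_subset_iff[OF bar_complex[OF B(1)] barC, of "proj p"] B(3,4) nz by simp
  have "proj p \<in> Q.piece (bar A)"
    by (rule Q.piece_mono[OF projC bar_complex[OF A] bar_mono]) simp
  moreover have "Q.chi (proj p) \<mu> = chi p \<mu>" if \<mu>: "\<mu> \<in> Q.mon (bar A)" for \<mu>
  proof -
    have \<mu>C: "\<mu> \<in> Q.mon (bar ?C)" using \<mu> Q.mon_antimono[OF bar_mono, of ?C A] by blast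
    obtain \<nu> where \<nu>: "\<nu> \<in> Q.mon (bar B)" "\<And>b. b \<in> bar ?C \<Longrightarrow> \<nu> \<bullet> b = 0" "\<mu> + \<nu> \<in> Q.mon (bar B)"
      using Q.clear_denominators[OF bar_complex[OF B(1)] barC \<mu>C] by metis
    have \<nu>C: "\<nu> \<in> Q.mon (bar ?C)" using \<nu>(1) Q.mon_antimono[OF barC] by blast
    have "Q.chi (proj p) \<mu> * Q.chi (proj p) \<nu> = chi p \<mu> * chi p \<nu>"
      using Q.chi_add[OF projC bar_complex[OF C] \<mu>C \<nu>C] chi_add[OF pC C, of \<mu> \<nu>] \<mu>C \<nu>C B(4)[OF \<nu>(3)]
      by (simp add: Q_mon)
    then show ?thesis using B(4)[OF \<nu>(1)] nz[OF \<nu>(1)] \<nu>(2) by (metis mult_right_cancel)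
  qed
  ultimately show ?thesis using p A by (simp add: over_def)
qed

lemma proj_piece: "p \<in> piece A \<Longrightarrow> A \<in> K \<Longrightarrow> proj p \<in> Q.piece (bar A)"
  using over_proj by (simp add: over_def)

lemma chi_proj: "p \<in> piece A \<Longrightarrow> A \<in> K \<Longrightarrow> \<mu> \<in> Q.mon (bar A) \<Longrightarrow> Q.chi (proj p) \<mu> = chi p \<mu>"
  using over_proj by (simp add: over_def)

text \<open>As \<open>A\<close> contains an apex, characters orthogonal to all generators of the
  intersection are orthogonal to \<open>x\<close>, so they come from the base and are nonzero at
  \<open>proj p\<close>. Hence the base point decides which generators other than the apex are
  kept.\<close>

lemma piece_from_proj:
  assumes p: "p \<in> piece A" and A: "A \<in> K" "x \<in> A \<or> - x \<in> A" and B: "B \<in> K" "proj p \<in> Q.piece (bar B)"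
  shows "p \<in> piece (A \<inter> (B \<union> {x, - x}))"
proof -
  let ?C = "A \<inter> (B \<union> {x, - x})"
  have "chi p \<nu> \<noteq> 0" if \<nu>: "\<nu> \<in> mon A" "\<forall>b\<in>?C. \<nu> \<bullet> b = 0" for \<nu>
  proof -
    have \<nu>x: "\<nu> \<bullet> x = 0" using \<nu>(2)[rule_format, of x] \<nu>(2)[rule_format, of "- x"] A(2) by auto
    then have \<nu>A: "\<nu> \<in> Q.mon (bar A)" using \<nu>(1) by (simp add: Q_mon)
    have AB: "A \<inter> B \<in> K" by (rule subset_complex[OF A(1)]) simp
    have "proj p \<in> Q.piece (bar (A \<inter> B))"
      using proj_piece[OF p A(1)] B Q.piece_Int[OF bar_complex[OF A(1)] bar_complex[OF B(1)]]
        bar_Int[OF A(1) B(1)] by auto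
    moreover have "\<nu> \<in> Q.mon (bar (A \<inter> B))" using \<nu>A Q.mon_antimono[OF bar_mono, of "A \<inter> B" A] by blast
    moreover have "\<nu> \<bullet> c = 0" if "c \<in> bar (A \<inter> B)" for c
      by (rule bar_perp[OF \<nu>x _ that]) (use \<nu>(2) in blast)
    ultimately have "Q.chi (proj p) \<nu> \<noteq> 0" using Q.chi_unit[OF _ bar_complex[OF AB]] by blast
    then show ?thesis using chi_proj[OF p A(1) \<nu>A] by simp
  qed
  then show ?thesis using piece_subset_iff[OF A(1), of ?C p] p by blast
qed

text \<open>\<open>e\<close> is dual to the apex \<open>y\<close> in \<open>A\<close>; its character
  is the coordinate along the fibres of \<open>proj\<close> over the piece of
  \<open>bar A\<close>.\<close>

definition "apex_coordinate y e A \<longleftrightarrow> A \<in> K \<and> y \<in> {x, - x} \<and> y \<in> A \<and> e \<in> dual_lattice L \<and> e \<bullet> y = 1 \<and>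
  (\<forall>a\<in>A - {y}. e \<bullet> a = 0)"

lemma apex_coordinate_mon: "apex_coordinate y e A \<Longrightarrow> e \<in> mon A"
  unfolding apex_coordinate_def using coordinate_mon by blast

text \<open>Subtracting the right multiple of \<open>e\<close> leaves a base character. On the level
  of exponents this splits the piece of \<open>A\<close> into a base piece and an affine
  line.\<close>

lemma apex_coordinate_split:
  assumes e: "apex_coordinate y e A" and \<mu>: "\<mu> \<in> mon A"
  shows "\<mu> - of_nat (nat \<lfloor>\<mu> \<bullet> y\<rfloor>) *\<^sub>R e \<in> Q.mon (bar A)" and "of_nat (nat \<lfloor>\<mu> \<bullet> y\<rfloor>) = \<mu> \<bullet> y"
proof -
  have A: "A \<in> K" "y \<in> A" using e by (auto simp: apex_coordinate_def)
  have "\<mu> \<bullet> y \<in> \<int>" by (rule inner_Ints[OF A mon_dual[OF \<mu>]])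
  moreover have "0 \<le> \<mu> \<bullet> y" using \<mu> A by (simp add: mon_def)
  ultimately show n: "of_nat (nat \<lfloor>\<mu> \<bullet> y\<rfloor>) = \<mu> \<bullet> y" by (auto elim!: Ints_cases)
  let ?\<mu> = "\<mu> - of_nat (nat \<lfloor>\<mu> \<bullet> y\<rfloor>) *\<^sub>R e"
  have "?\<mu> \<in> dual_lattice L"
    by (intro dual_lattice_diff mon_dual[OF \<mu>] mon_dual[OF mon_scale_nat[OF apex_coordinate_mon[OF e]]])
  moreover have "?\<mu> \<bullet> y = 0" using e n by (simp add: apex_coordinate_def inner_diff_left)
  moreover have "0 \<le> ?\<mu> \<bullet> a" if "a \<in> A" for a
    using e \<mu> that \<open>?\<mu> \<bullet> y = 0\<close> by (cases "a = y") (auto simp: apex_coordinate_def inner_diff_left mon_def)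
  ultimately show "?\<mu> \<in> Q.mon (bar A)" using e by (auto simp: Q_mon mon_def apex_coordinate_def)
qed

lemma chi_apex_split:
  assumes e: "apex_coordinate y e A" and \<mu>: "\<mu> \<in> mon A" and p: "p \<in> piece A"
  shows "chi p \<mu> = Q.chi (proj p) (\<mu> - of_nat (nat \<lfloor>\<mu> \<bullet> y\<rfloor>) *\<^sub>R e) * chi p e ^ nat \<lfloor>\<mu> \<bullet> y\<rfloor>"
proof -
  have A: "A \<in> K" using e by (simp add: apex_coordinate_def)
  let ?n = "nat \<lfloor>\<mu> \<bullet> y\<rfloor>"
  note m = apex_coordinate_mon[OF e]
  have s: "\<mu> - of_nat ?n *\<^sub>R e \<in> Q.mon (bar A)" by (rule apex_coordinate_split(1)[OF e \<mu>])
  then have s': "\<mu> - of_nat ?n *\<^sub>R e \<in> mon A" by (simp add: Q_mon)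
  have "chi p ((\<mu> - of_nat ?n *\<^sub>R e) + of_nat ?n *\<^sub>R e) = chi p (\<mu> - of_nat ?n *\<^sub>R e) * chi p (of_nat ?n *\<^sub>R e)"
    by (rule chi_add[OF p A s' mon_scale_nat[OF m]])
  then show ?thesis using chi_scale_nat[OF p A m, of ?n] chi_proj[OF p A s] by simp
qed

lemma point_determined:
  assumes e: "apex_coordinate y e A" and p: "p \<in> piece A" and q: "q \<in> piece A"
    and eq: "proj p = proj q" "chi p e = chi q e"
  shows "p = q"
proof (rule point_eqI[OF p q])
  show "A \<in> K" using e by (simp add: apex_coordinate_def)
  show "chi p m = chi q m" if "m \<in> mon A" for m
    using chi_apex_split[OF e that p] chi_apex_split[OF e that q] eq by simp
qed

text \<open>The splitting of exponents forces the homomorphism. Together with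
  \<open>point_determined\<close> this identifies the piece of \<open>A\<close> with the piece of
  \<open>bar A\<close> times the complex line.\<close>

lemma exists_point_over:
  assumes e: "apex_coordinate y e A" and b: "b \<in> Q.piece (bar A)"
  shows "\<exists>p\<in>piece A. proj p = b \<and> chi p e = t"
proof -
  have A: "A \<in> K" and y: "y \<in> {x, - x}" using e by (auto simp: apex_coordinate_def)
  note bA = bar_complex[OF A]
  let ?n = "\<lambda>\<mu>. nat \<lfloor>\<mu> \<bullet> y\<rfloor>"
  define \<gamma> where "\<gamma> = restrict (\<lambda>\<mu>. Q.chi b (\<mu> - of_nat (?n \<mu>) *\<^sub>R e) * t ^ ?n \<mu>) (mon A)"
  have "\<gamma> \<in> homs A"
    unfolding homs_iff
  proof (intro conjI ballI)
    show "\<gamma> \<in> extensional (mon A)" by (simp add: \<gamma>_def)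
    show "\<gamma> 0 = 1" using Q.chi_0[OF b bA] by (simp add: \<gamma>_def)
    fix \<mu> \<mu>' assume \<mu>: "\<mu> \<in> mon A" "\<mu>' \<in> mon A"
    have "real (?n (\<mu> + \<mu>')) = real (?n \<mu> + ?n \<mu>')"
      using apex_coordinate_split(2)[OF e \<mu>(1)] apex_coordinate_split(2)[OF e \<mu>(2)]
        apex_coordinate_split(2)[OF e mon_add[OF \<mu>]] by (simp only: inner_add_left of_nat_add)
    then have n: "?n (\<mu> + \<mu>') = ?n \<mu> + ?n \<mu>'" by (simp only: of_nat_eq_iff)
    have eq: "\<mu> + \<mu>' - of_nat (?n (\<mu> + \<mu>')) *\<^sub>R e = (\<mu> - of_nat (?n \<mu>) *\<^sub>R e) + (\<mu>' - of_nat (?n \<mu>') *\<^sub>R e)"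
      unfolding n by (simp add: scaleR_left_distrib)
    have "Q.chi b (\<mu> + \<mu>' - of_nat (?n (\<mu> + \<mu>')) *\<^sub>R e) =
        Q.chi b (\<mu> - of_nat (?n \<mu>) *\<^sub>R e) * Q.chi b (\<mu>' - of_nat (?n \<mu>') *\<^sub>R e)"
      unfolding eq by (rule Q.chi_add[OF b bA apex_coordinate_split(1)[OF e \<mu>(1)] apex_coordinate_split(1)[OF e \<mu>(2)]])
    then show "\<gamma> (\<mu> + \<mu>') = \<gamma> \<mu> * \<gamma> \<mu>'"
      unfolding \<gamma>_def using \<mu> mon_add[OF \<mu>] n by (simp add: power_add)
  qed
  then obtain p where p: "p \<in> piece A" "\<And>\<mu>. \<mu> \<in> mon A \<Longrightarrow> chi p \<mu> = \<gamma> \<mu>" using point_exists[OF A] by metis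
  have "proj p = b"
  proof (rule Q.point_eqI[OF proj_piece[OF p(1) A] b bA])
    fix m assume m: "m \<in> Q.mon (bar A)"
    then have "m \<in> mon A" "m \<bullet> y = 0" using y by (auto simp: Q_mon)
    then show "Q.chi (proj p) m = Q.chi b m" using chi_proj[OF p(1) A m] p(2)[of m] by (simp add: \<gamma>_def)
  qed
  moreover have "chi p e = t"
    using p(2)[OF apex_coordinate_mon[OF e]] apex_coordinate_mon[OF e] e Q.chi_0[OF b bA]
    by (simp add: \<gamma>_def apex_coordinate_def)
  ultimately show ?thesis using p(1) by blast
qed

text \<open>A lift of a basis vector of the quotient can be corrected by a multiple of
  \<open>y\<close> to be orthogonal to \<open>e\<close>; with \<open>y\<close> itself these lifts
  are dual to the old dual vectors and \<open>e\<close>. The fibre index comes last, as in the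
  charts of \<open>projectivization\<close>.\<close>

lemma lift_frame:
  assumes e: "e \<in> dual_lattice L" "e \<bullet> y = 1" "y \<in> {x, - x}" and f: "Q.frame u m"
  shows "\<exists>v. frame v (m(dim quotient_lattice := e)) \<and> v (dim quotient_lattice) = y \<and>
    (\<forall>i<dim quotient_lattice. perp_proj x (v i) = u i \<and> e \<bullet> v i = 0)"
proof -
  let ?k = "dim quotient_lattice" and ?m = "m(dim quotient_lattice := e)"
  have dimL: "dim L = Suc ?k" by (rule quotient_dim)
  have yL: "y \<in> L" using e(3) complex_subset_lattice[OF apex(1)] complex_subset_lattice[OF apex(2)] by auto
  have py: "perp_proj x y = 0" using e(3) by auto
  have uQ: "u i \<in> quotient_lattice" if "i < ?k" for i
    using f that lattice_basis_subset[of quotient_lattice "u ` {..<?k}"] by (auto simp: Q.frame_def)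
  have mQ: "m i \<in> dual_lattice L" "m i \<bullet> x = 0" if "i < ?k" for i
    using f that by (auto simp: Q.frame_def dual_quotient_lattice)
  obtain S where S: "S \<in> K" "{x} \<subseteq> S" "lattice_basis L S" using extends_to_basis[OF apex(1)] by blast
  have lattice_comb: "v + of_int c *\<^sub>R w \<in> L" if vw: "v \<in> L" "w \<in> L" for v w c
  proof -
    obtain p q :: "'a \<Rightarrow> int" where "v = (\<Sum>b\<in>S. of_int (p b) *\<^sub>R b)" "w = (\<Sum>b\<in>S. of_int (q b) *\<^sub>R b)"
      using vw lattice_basis_elem[OF S(3)] by metis
    then have "v + of_int c *\<^sub>R w = (\<Sum>b\<in>S. of_int (p b + c * q b) *\<^sub>R b)"
      by (simp add: scaleR_sum_right sum.distrib[symmetric] scaleR_left_distrib)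
    then show ?thesis unfolding lattice_basis_elem[OF S(3)] by (rule exI[of _ "\<lambda>b. p b + c * q b"])
  qed
  have "\<exists>l. l \<in> L \<and> perp_proj x l = u i \<and> e \<bullet> l = 0" if i: "i < ?k" for i
  proof -
    obtain l where l: "l \<in> L" "perp_proj x l = u i" using uQ[OF i] by (auto simp: quotient_lattice_def)
    have "e \<bullet> l \<in> \<int>" using e(1) l(1) by (simp add: dual_lattice_def)
    then obtain c where c: "e \<bullet> l = of_int c" by (auto elim: Ints_cases)
    have "perp_proj x (l + of_int (- c) *\<^sub>R y) = u i"
      using l(2) py by (simp add: linear_add[OF linear_perp_proj] linear_diff[OF linear_perp_proj] linear_scale[OF linear_perp_proj])
    moreover have "e \<bullet> (l + of_int (- c) *\<^sub>R y) = 0" using c e(2) by (simp add: inner_add_right inner_diff_right)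
    ultimately show ?thesis using lattice_comb[OF l(1) yL, of "- c"] by blast
  qed
  then obtain w where w: "\<And>i. i < ?k \<Longrightarrow> w i \<in> L \<and> perp_proj x (w i) = u i \<and> e \<bullet> w i = 0" by metis
  define v where "v = w(?k := y)"
  have vL: "v i \<in> L" if "i < Suc ?k" for i using that w yL by (cases "i = ?k") (auto simp: v_def)
  have dual: "?m i \<bullet> v j = (if i = j then 1 else 0)" if ij: "i < Suc ?k" "j < Suc ?k" for i j
  proof (cases "i = ?k")
    case True
    then show ?thesis using ij w e(2) by (auto simp: v_def)
  next
    case False
    then have i: "i < ?k" using ij by simp
    show ?thesis
    proof (cases "j = ?k")
      case True
      then show ?thesis using False mQ(2)[OF i] e(3) by (auto simp: v_def)
    next
      case False
      then have j: "j < ?k" using ij by simp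
      have "m i \<bullet> w j = m i \<bullet> u j" using inner_perp_proj[OF mQ(2)[OF i], of "w j"] w[OF j] by simp
      then show ?thesis using i j Q.frame_inner[OF f i j] by (simp add: v_def)
    qed
  qed
  have m_dual: "?m i \<in> dual_lattice L" if "i < Suc ?k" for i using that mQ(1) e(1) by auto
  have inj: "inj_on v {..<Suc ?k}"
  proof (rule inj_onI, rule ccontr)
    fix i j assume "i \<in> {..<Suc ?k}" "j \<in> {..<Suc ?k}" "v i = v j" "i \<noteq> j"
    then show False using dual[of i i] dual[of i j] by simp
  qed
  have ind: "independent (v ` {..<Suc ?k})"
  proof (rule independent_if_dual_vectors)
    fix a assume "a \<in> v ` {..<Suc ?k}"
    then obtain i where i: "i < Suc ?k" "a = v i" by blast
    have "?m i \<bullet> b = 0" if "b \<in> v ` {..<Suc ?k} - {a}" for b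
    proof -
      obtain j where "j < Suc ?k" "b = v j" "b \<noteq> a" using \<open>b \<in> v ` {..<Suc ?k} - {a}\<close> by blast
      then show ?thesis using dual[OF i(1), of j] i(2) by auto
    qed
    then show "\<exists>m. m \<bullet> a = 1 \<and> (\<forall>b\<in>v ` {..<Suc ?k} - {a}. m \<bullet> b = 0)"
      using dual[OF i(1) i(1)] i(2) by (intro exI[of _ "?m i"]) auto
  qed
  \<comment> \<open>The difference of the two sides projects to 0, so it is a multiple of
    \<open>x\<close>; it is also orthogonal to \<open>e\<close>, whose value at \<open>x\<close> is
    1 or -1.\<close>
  have expand: "l = (\<Sum>i<Suc ?k. (?m i \<bullet> l) *\<^sub>R v i)" if l: "l \<in> L" for l
  proof -
    have Qb: "lattice_basis quotient_lattice (u ` {..<?k})" and u_inj: "inj_on u {..<?k}"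
      using f by (simp_all add: Q.frame_def)
    have "perp_proj x l \<in> quotient_lattice" using l by (simp add: quotient_lattice_def)
    then obtain c :: "'a \<Rightarrow> int" where "perp_proj x l = (\<Sum>b\<in>u ` {..<?k}. of_int (c b) *\<^sub>R b)"
      unfolding lattice_basis_elem[OF Qb] by blast
    then have c: "perp_proj x l = (\<Sum>i<?k. of_int (c (u i)) *\<^sub>R u i)" by (simp add: sum.reindex[OF u_inj])
    have mc: "m i \<bullet> l = of_int (c (u i))" if i: "i < ?k" for i
    proof -
      have "m i \<bullet> l = m i \<bullet> perp_proj x l" using inner_perp_proj[OF mQ(2)[OF i], of l] by simp
      also have "\<dots> = (\<Sum>j<?k. if j = i then of_int (c (u i)) else 0)"
        unfolding c inner_sum_right using Q.frame_inner[OF f i] by (intro sum.cong) auto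
      finally show ?thesis using i by (simp add: sum.delta)
    qed
    define r where "r = (\<Sum>i<Suc ?k. (?m i \<bullet> l) *\<^sub>R v i)"
    have "perp_proj x r = (\<Sum>i<?k. (m i \<bullet> l) *\<^sub>R u i)"
      unfolding r_def using w py by (simp add: linear_sum[OF linear_perp_proj] linear_add[OF linear_perp_proj]
          linear_scale[OF linear_perp_proj] v_def)
    then have "perp_proj x l = perp_proj x r" unfolding c using mc by simp
    then obtain s where s: "l = r + s *\<^sub>R x" using perp_proj_eq_iff by blast
    have "e \<bullet> r = e \<bullet> l"
      unfolding r_def using w e(2) by (simp add: inner_sum_right inner_add_right v_def)
    moreover have "e \<bullet> l = e \<bullet> r + s * (e \<bullet> x)"
      using arg_cong[OF s, of "\<lambda>z. e \<bullet> z"] by (simp only: inner_add_right inner_scaleR_right)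
    moreover have "e \<bullet> x \<noteq> 0" using e(2,3) by auto
    ultimately have "s = 0" by simp
    then show ?thesis using s r_def by simp
  qed
  have "lattice_basis L (v ` {..<Suc ?k})"
    unfolding lattice_basis_def
  proof (intro conjI ind subset_antisym subsetI)
    fix l assume l: "l \<in> L"
    have fl: "of_int \<lfloor>?m i \<bullet> l\<rfloor> = ?m i \<bullet> l" if "i < Suc ?k" for i
    proof -
      have "?m i \<bullet> l \<in> \<int>" using m_dual[OF that] l unfolding dual_lattice_def by blast
      then show ?thesis by (metis Ints_cases floor_of_int)
    qed
    have "l = (\<Sum>i<Suc ?k. of_int \<lfloor>?m i \<bullet> l\<rfloor> *\<^sub>R v i)"
      by (subst expand[OF l]) (rule sum.cong[OF refl], drule lessThan_iff[THEN iffD1], simp only: fl)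
    also have "\<dots> = (\<Sum>b\<in>v ` {..<Suc ?k}. of_int \<lfloor>?m (inv_into {..<Suc ?k} v b) \<bullet> l\<rfloor> *\<^sub>R b)"
      by (simp only: sum.reindex[OF inj] comp_def) (rule sum.cong, simp_all only: inv_into_f_f[OF inj] refl)
    finally show "l \<in> {\<Sum>b\<in>v ` {..<Suc ?k}. of_int (c b) *\<^sub>R b | c :: 'a \<Rightarrow> int. True}"
      by (intro CollectI exI[of _ "\<lambda>b. \<lfloor>?m (inv_into {..<Suc ?k} v b) \<bullet> l\<rfloor>"] conjI TrueI)
  next
    fix l assume "l \<in> {\<Sum>b\<in>v ` {..<Suc ?k}. of_int (c b) *\<^sub>R b | c :: 'a \<Rightarrow> int. True}"
    then obtain c :: "'a \<Rightarrow> int" where l: "l = (\<Sum>b\<in>v ` {..<Suc ?k}. of_int (c b) *\<^sub>R b)" by blast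
    have zero: "0 \<in> L" unfolding lattice_basis_elem[OF S(3)] by (intro exI[of _ "\<lambda>_. 0"]) simp
    have "(\<Sum>b\<in>B. of_int (c b) *\<^sub>R b) \<in> L" if "B \<subseteq> v ` {..<Suc ?k}" for B
      using finite_subset[OF that finite_imageI[OF finite_lessThan]] that
    proof (induction B)
      case (insert b B)
      then show ?case using lattice_comb[of "\<Sum>b\<in>B. of_int (c b) *\<^sub>R b" b "c b"] vL by (auto simp: add.commute)
    qed (simp add: zero)
    then show "l \<in> L" using l by blast
  qed
  then have "frame v ?m" unfolding frame_def dimL using inj m_dual dual by simp
  moreover have "v ?k = y" "\<And>i. i < ?k \<Longrightarrow> perp_proj x (v i) = u i \<and> e \<bullet> v i = 0"
    using w by (auto simp: v_def)
  ultimately show ?thesis by blast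
qed

text \<open>The lifted frame works for the whole base chart. Over the piece of \<open>bar E\<close>,
  its index set shrinks to the lifted vectors lying in \<open>E\<close> and gains the index of the
  apex.\<close>

lemma lift_gchart:
  assumes e: "apex_coordinate y e (insert y E)" and E: "E \<in> link"
    and f: "Q.frame u m" and J: "J \<subseteq> {..<dim quotient_lattice}" and sub: "bar E \<subseteq> u ` J"
    and \<phi>: "\<And>b. b \<in> Q.piece (bar E) \<Longrightarrow> \<phi> b = Q.coords m b"
  shows "gchart (piece (insert y E)) (\<lambda>p. (\<phi> (proj p))(dim quotient_lattice := chi p e))"
proof -
  let ?k = "dim quotient_lattice"
  have y: "y \<in> {x, - x}" "e \<in> dual_lattice L" "e \<bullet> y = 1" and yE: "insert y E \<in> K"
    using e by (auto simp: apex_coordinate_def)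
  have ynE: "y \<notin> E" using y(1) linkD(2,3)[OF E] by auto
  obtain v where v: "frame v (m(?k := e))" "v ?k = y" "\<And>i. i < ?k \<Longrightarrow> perp_proj x (v i) = u i \<and> e \<bullet> v i = 0"
    using lift_frame[OF y(2,3,1) f] by blast
  have bar_yE: "bar (insert y E) = bar E" using y(1) bar_insert by auto
  let ?J = "{j \<in> J. v j \<in> E}"
  have "v ` ?J = E"
  proof (intro subset_antisym subsetI)
    fix a assume a: "a \<in> E"
    then have "perp_proj x a \<in> u ` J" using sub bar_link[OF E] by blast
    then obtain j where j: "j \<in> J" "perp_proj x a = u j" by blast
    then have jk: "j < ?k" using J by blast
    \<comment> \<open>\<open>a\<close> and \<open>v j\<close> have the same projection and are both
      orthogonal to \<open>e\<close>, so the multiple of \<open>x\<close> between them is 0.\<close>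
    obtain c where c: "a = v j + c *\<^sub>R x" using perp_proj_eq_iff[of x a "v j"] v(3)[OF jk] j(2) by auto
    have "e \<bullet> a = 0" using e a ynE by (auto simp: apex_coordinate_def)
    then have "c * (e \<bullet> x) = 0" using v(3)[OF jk] c by (simp add: inner_add_right)
    moreover have "e \<bullet> x \<noteq> 0" using y by auto
    ultimately have "a = v j" using c by simp
    then show "a \<in> v ` ?J" using j(1) a by blast
  qed auto
  then have img: "v ` insert ?k ?J = insert y E" using v(2) by simp
  show ?thesis
    unfolding gchart_def
  proof (intro exI conjI ballI)
    show "frame v (m(?k := e))" by (rule v(1))
    show "insert ?k ?J \<subseteq> {..<dim L}" using J quotient_dim by auto
    show "v ` insert ?k ?J \<in> K" using img yE by simp
    show "piece (insert y E) = piece (v ` insert ?k ?J)" using img by simp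
    fix p assume p: "p \<in> piece (insert y E)"
    have b: "proj p \<in> Q.piece (bar E)" using proj_piece[OF p yE] bar_yE by simp
    have "Q.chi (proj p) (m i) = chi p (m i)" if i: "i < ?k" for i
    proof -
      have "m i \<in> Q.mon (bar (insert y E))"
        using Q.frame_mon[OF f i J] Q.mon_antimono[OF sub] bar_yE by auto
      then show ?thesis by (rule chi_proj[OF p yE])
    qed
    then show "(\<phi> (proj p))(?k := chi p e) = coords (m(?k := e)) p"
      unfolding \<phi>[OF b] by (auto simp: fun_eq_iff Q.coords_def coords_def quotient_dim)
  qed
qed

end

lemma (in simplicial_fan) gchart_cong: "gchart U \<phi> \<Longrightarrow> (\<And>p. p \<in> U \<Longrightarrow> \<phi> p = \<psi> p) \<Longrightarrow> gchart U \<psi>"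
  unfolding gchart_def by metis

section \<open>The line bundle and the map to its bundle of lines\<close>

context fan_suspension
begin

definition "apex_bases = {S \<in> K. lattice_basis L S \<and> x \<in> S}"

definition "ecoord S = (SOME e. apex_coordinate x e S)"

text \<open>The maximal simplex on the other side of the wall \<open>S - {x}\<close>.\<close>

definition "flip S = insert (- x) (S - {x})"

definition "ref b = (SOME S. S \<in> apex_bases \<and> b \<in> Q.piece (bar S))"

text \<open>Compares the fibre coordinates given by \<open>S\<close> and by the reference cone chosen for \<open>b\<close>.\<close>

definition "transition S b = Q.chi b (ecoord S - ecoord (ref b))"

text \<open>The second entry of a vector over \<open>b\<close> is its fibre coordinate with respect
  to the reference cone of \<open>b\<close>, which may jump with \<open>b\<close>. Multiplication by
  \<open>transition S\<close> converts it to the coordinate of the fixed cone \<open>S\<close>;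
  these products are the holomorphic trivialisations.\<close>

definition axis_bundle :: "('a toric_point, 'a toric_point \<times> complex) line_bundle" where
  "axis_bundle = \<lparr>lb_total = Q.Points \<times> UNIV, lb_proj = fst, lb_add = (\<lambda>v w. (fst v, snd v + snd w)),
    lb_scale = (\<lambda>c v. (fst v, c * snd v)),
    lb_triv = {(Q.piece (bar S), \<lambda>v. transition S (fst v) * snd v) | S. S \<in> apex_bases}\<rparr>"

definition line :: "'a toric_point \<Rightarrow> complex \<Rightarrow> complex \<Rightarrow> (complex \<times> 'a toric_point \<times> complex) set" where
  "line b \<alpha> \<beta> = range (\<lambda>c. (c * \<alpha>, (b, c * \<beta>)))"

text \<open>The second case is the point of the fibre at which the reference coordinate is
  infinite.\<close>

definition "hom_line p = (if p \<in> piece (ref (proj p)) then line (proj p) 1 (chi p (ecoord (ref (proj p))))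
  else line (proj p) 0 1)"

lemma apex_basesD: "S \<in> apex_bases \<Longrightarrow> S \<in> K" "S \<in> apex_bases \<Longrightarrow> lattice_basis L S" "S \<in> apex_bases \<Longrightarrow> x \<in> S"
  "S \<in> apex_bases \<Longrightarrow> - x \<notin> S" "S \<in> apex_bases \<Longrightarrow> S - {x} \<in> link"
  using not_both_opposite subset_complex[of S "S - {x}"] by (auto simp: apex_bases_def link_def)

lemma ecoord: "S \<in> apex_bases \<Longrightarrow> apex_coordinate x (ecoord S) S"
proof -
  assume S: "S \<in> apex_bases"
  obtain m where "m \<in> dual_lattice L" "m \<bullet> x = 1" "\<And>b. b \<in> S - {x} \<Longrightarrow> m \<bullet> b = 0"
    using lattice_basis_dual_vector[OF apex_basesD(2,3)[OF S]] by metis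
  then have "apex_coordinate x m S" using apex_basesD[OF S] by (simp add: apex_coordinate_def)
  then show ?thesis unfolding ecoord_def by (rule someI)
qed

lemma ecoord_inner:
  assumes "S \<in> apex_bases"
  shows "ecoord S \<in> dual_lattice L" "ecoord S \<bullet> x = 1" "\<forall>a\<in>S - {x}. ecoord S \<bullet> a = 0"
  using ecoord[OF assms] by (auto simp: apex_coordinate_def)

lemma flip_complex: "S \<in> apex_bases \<Longrightarrow> flip S \<in> K"
  unfolding flip_def by (rule linkD(5)[OF apex_basesD(5)])

lemma flip_minus: "S \<in> apex_bases \<Longrightarrow> flip S - {- x} = S - {x}"
  using apex_basesD(4) unfolding flip_def by auto

lemma flip_basis:
  assumes S: "S \<in> apex_bases"
  shows "lattice_basis L (flip S)"
proof (rule card_basis[OF flip_complex[OF S]])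
  have fin: "finite S" by (rule complex_finite[OF apex_basesD(1)[OF S]])
  have "card (flip S) = Suc (card (S - {x}))"
    unfolding flip_def using fin apex_basesD(4)[OF S] by (intro card_insert_disjoint) auto
  then show "card (flip S) = dim L"
    using card.remove[OF fin apex_basesD(3)[OF S]] lattice_basis_dim[OF apex_basesD(2)[OF S]] by simp
qed

lemma flip_coordinate:
  assumes S: "S \<in> apex_bases"
  shows "apex_coordinate (- x) (- ecoord S) (flip S)"
  using ecoord_inner[OF S] flip_complex[OF S] flip_minus[OF S]
  by (simp add: apex_coordinate_def dual_lattice_uminus) (simp add: flip_def)

lemma bar_flip: "S \<in> apex_bases \<Longrightarrow> bar (flip S) = bar S"
proof -
  assume S: "S \<in> apex_bases"
  have "flip S - {x, - x} = S - {x, - x}" using x_neq_neg by (auto simp: flip_def)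
  then show ?thesis by (simp add: bar_def)
qed

lemma exists_apex_basis:
  assumes "b \<in> Q.Points"
  shows "\<exists>S\<in>apex_bases. b \<in> Q.piece (bar S)"
proof -
  obtain C where C: "C \<in> quotient_complex" "b \<in> Q.piece C" using assms Q.Points_eq by blast
  obtain D where D: "D \<in> link" "C = bar D" using quotient_complexE[OF C(1)] by blast
  obtain S where S: "S \<in> K" "insert x D \<subseteq> S" "lattice_basis L S" using extends_to_basis[OF linkD(4)[OF D(1)]] by blast
  have "bar D \<subseteq> bar S" using S(2) by (intro bar_mono) blast
  then have "b \<in> Q.piece (bar S)" using Q.piece_mono[OF C(2) bar_complex[OF S(1)]] D(2) by blast
  then show ?thesis using S by (auto simp: apex_bases_def)
qed

lemma ref:
  assumes "b \<in> Q.Points"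
  shows "ref b \<in> apex_bases" "b \<in> Q.piece (bar (ref b))"
  using someI_ex[of "\<lambda>S. S \<in> apex_bases \<and> b \<in> Q.piece (bar S)"] exists_apex_basis[OF assms]
  unfolding ref_def by blast+

lemma ecoord_diff:
  assumes S: "S \<in> apex_bases" and T: "T \<in> apex_bases" and A: "A \<subseteq> S \<inter> T"
  shows "ecoord T - ecoord S \<in> Q.mon (bar A)" "a \<in> bar A \<Longrightarrow> (ecoord T - ecoord S) \<bullet> a = 0"
proof -
  have 0: "(ecoord T - ecoord S) \<bullet> a = 0" if "a \<in> A" for a
  proof (cases "a = x")
    case True
    then show ?thesis using ecoord_inner(2)[OF S] ecoord_inner(2)[OF T] by (simp add: inner_diff_left)
  next
    case False
    then have "a \<in> S - {x}" "a \<in> T - {x}" using that A by blast+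
    then show ?thesis using ecoord_inner(3)[OF S] ecoord_inner(3)[OF T] by (simp add: inner_diff_left)
  qed
  have x0: "(ecoord T - ecoord S) \<bullet> x = 0"
    using ecoord_inner(2)[OF S] ecoord_inner(2)[OF T] by (simp add: inner_diff_left)
  have "ecoord T - ecoord S \<in> mon A"
    using 0 dual_lattice_diff[OF ecoord_inner(1)[OF T] ecoord_inner(1)[OF S]] by (simp add: mon_def)
  then show "ecoord T - ecoord S \<in> Q.mon (bar A)" using x0 by (simp add: Q_mon)
  show "a \<in> bar A \<Longrightarrow> (ecoord T - ecoord S) \<bullet> a = 0" using bar_perp[OF x0 0] .
qed

lemma Q_piece_bar_Int:
  "A \<in> K \<Longrightarrow> B \<in> K \<Longrightarrow> Q.piece (bar A) \<inter> Q.piece (bar B) = Q.piece (bar (A \<inter> B))"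
  using Q.piece_Int[OF bar_complex bar_complex] bar_Int by metis

lemma chi_ecoord_diff_nonzero:
  assumes S: "S \<in> apex_bases" and T: "T \<in> apex_bases" and b: "b \<in> Q.piece (bar S)" "b \<in> Q.piece (bar T)"
  shows "Q.chi b (ecoord T - ecoord S) \<noteq> 0"
proof -
  have ST: "S \<inter> T \<in> K" by (rule subset_complex[OF apex_basesD(1)[OF S]]) simp
  have "b \<in> Q.piece (bar (S \<inter> T))" using Q_piece_bar_Int[OF apex_basesD(1)[OF S] apex_basesD(1)[OF T]] b by blast
  from Q.chi_unit[OF this bar_complex[OF ST] ecoord_diff[OF S T order_refl]] show ?thesis .
qed

lemma Q_piece_Points: "A \<in> K \<Longrightarrow> b \<in> Q.piece (bar A) \<Longrightarrow> b \<in> Q.Points"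
  using bar_complex Q.Points_eq by blast

lemma transition_nonzero: "S \<in> apex_bases \<Longrightarrow> b \<in> Q.piece (bar S) \<Longrightarrow> transition S b \<noteq> 0"
  unfolding transition_def
  using chi_ecoord_diff_nonzero ref Q_piece_Points apex_basesD(1) by metis

text \<open>The cocycle identity. On the triple intersection with the reference cone, the difference
  to \<open>ecoord (ref b)\<close> is a sum of two characters, so the values multiply.\<close>

lemma transition_change:
  assumes S: "S \<in> apex_bases" and T: "T \<in> apex_bases" and b: "b \<in> Q.piece (bar S)" "b \<in> Q.piece (bar T)"
  shows "transition T b = Q.chi b (ecoord T - ecoord S) * transition S b"
proof -
  let ?R = "ref b"
  note bP = Q_piece_Points[OF apex_basesD(1)[OF S] b(1)]
  note R = ref[OF bP]
  let ?A = "S \<inter> T \<inter> ?R"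
  have ST: "S \<inter> T \<in> K" by (rule subset_complex[OF apex_basesD(1)[OF S]]) simp
  have A: "?A \<in> K" by (rule subset_complex[OF ST]) blast
  have "b \<in> Q.piece (bar (S \<inter> T))" using Q_piece_bar_Int[OF apex_basesD(1)[OF S] apex_basesD(1)[OF T]] b by blast
  then have "b \<in> Q.piece (bar ?A)" using Q_piece_bar_Int[OF ST apex_basesD(1)[OF R(1)]] R(2) by blast
  from Q.chi_add[OF this bar_complex[OF A] ecoord_diff(1)[OF S T] ecoord_diff(1)[OF R(1) S]]
  have "Q.chi b (ecoord T - ecoord S + (ecoord S - ecoord ?R)) =
      Q.chi b (ecoord T - ecoord S) * Q.chi b (ecoord S - ecoord ?R)" by blast
  then show ?thesis by (simp add: transition_def)
qed

lemma axis_bundle_simps [simp]: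
  "lb_total axis_bundle = Q.Points \<times> UNIV" "lb_proj axis_bundle = fst" "lb_add axis_bundle v w = (fst v, snd v + snd w)"
  "lb_scale axis_bundle c v = (fst v, c * snd v)"
  "lb_triv axis_bundle = {(Q.piece (bar S), \<lambda>v. transition S (fst v) * snd v) | S. S \<in> apex_bases}"
  by (simp_all add: axis_bundle_def)

lemma fibre_bundle: "b \<in> Q.Points \<Longrightarrow> lb_fibre axis_bundle b = {b} \<times> UNIV"
  by (auto simp: lb_fibre_def)

lemma holomorphic_bundle: "holomorphic_line_bundle Q.X axis_bundle"
  unfolding holomorphic_line_bundle_def
proof (intro conjI)
  show "lb_proj axis_bundle ` lb_total axis_bundle \<subseteq> points Q.X" by (auto simp: Q.points_toric_manifold)
  show "(\<Union>(W, \<tau>)\<in>lb_triv axis_bundle. W) = points Q.X"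
    using exists_apex_basis Q_piece_Points apex_basesD(1) by (fastforce simp: Q.points_toric_manifold)
  show "\<forall>(W, \<tau>)\<in>lb_triv axis_bundle. openin (mtopology Q.X) W \<and>
      (\<forall>b\<in>W. bij_betw \<tau> (lb_fibre axis_bundle b) UNIV \<and>
        (\<forall>v\<in>lb_fibre axis_bundle b. \<forall>w\<in>lb_fibre axis_bundle b.
           lb_add axis_bundle v w \<in> lb_fibre axis_bundle b \<and> \<tau> (lb_add axis_bundle v w) = \<tau> v + \<tau> w) \<and>
        (\<forall>c. \<forall>v\<in>lb_fibre axis_bundle b.
           lb_scale axis_bundle c v \<in> lb_fibre axis_bundle b \<and> \<tau> (lb_scale axis_bundle c v) = c * \<tau> v))"
  proof (intro ballI case_prodI2)
    fix d W and \<tau> :: "'a toric_point \<times> complex \<Rightarrow> complex" assume "d \<in> lb_triv axis_bundle" "d = (W, \<tau>)"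
    then obtain S where S: "S \<in> apex_bases" "W = Q.piece (bar S)" "\<tau> = (\<lambda>v. transition S (fst v) * snd v)" by auto
    show "openin (mtopology Q.X) W \<and>
      (\<forall>b\<in>W. bij_betw \<tau> (lb_fibre axis_bundle b) UNIV \<and>
        (\<forall>v\<in>lb_fibre axis_bundle b. \<forall>w\<in>lb_fibre axis_bundle b.
           lb_add axis_bundle v w \<in> lb_fibre axis_bundle b \<and> \<tau> (lb_add axis_bundle v w) = \<tau> v + \<tau> w) \<and>
        (\<forall>c. \<forall>v\<in>lb_fibre axis_bundle b.
           lb_scale axis_bundle c v \<in> lb_fibre axis_bundle b \<and> \<tau> (lb_scale axis_bundle c v) = c * \<tau> v))"
    proof (intro conjI ballI)
      show "openin (mtopology Q.X) W"
        unfolding S(2) by (rule Q.piece_open[OF bar_complex[OF apex_basesD(1)[OF S(1)]]])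
      fix b assume "b \<in> W"
      then have b: "b \<in> Q.piece (bar S)" by (simp add: S(2))
      note fib = fibre_bundle[OF Q_piece_Points[OF apex_basesD(1)[OF S(1)] b]]
      note nz = transition_nonzero[OF S(1) b]
      show "bij_betw \<tau> (lb_fibre axis_bundle b) UNIV"
        unfolding fib S(3)
        by (rule bij_betw_byWitness[where f' = "\<lambda>c. (b, c / transition S b)"]) (use nz in auto)
    qed (auto simp: S(3) fibre_bundle Q_piece_Points[OF apex_basesD(1)[OF S(1)]] S(2) algebra_simps)
  qed
  show "\<forall>(W, \<tau>)\<in>lb_triv axis_bundle. \<forall>(W', \<tau>')\<in>lb_triv axis_bundle. \<exists>g.
      holomorphic_fun Q.X (W \<inter> W') g \<and> (\<forall>b\<in>W \<inter> W'. \<forall>v\<in>lb_fibre axis_bundle b. \<tau>' v = g b * \<tau> v)"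
  proof (intro ballI case_prodI2)
    fix d d' W W' and \<tau> \<tau>' :: "'a toric_point \<times> complex \<Rightarrow> complex"
    assume "d \<in> lb_triv axis_bundle" "d = (W, \<tau>)"
    then obtain S where S: "S \<in> apex_bases" "W = Q.piece (bar S)" "\<tau> = (\<lambda>v. transition S (fst v) * snd v)" by auto
    assume "d' \<in> lb_triv axis_bundle" "d' = (W', \<tau>')"
    then obtain T where T: "T \<in> apex_bases" "W' = Q.piece (bar T)" "\<tau>' = (\<lambda>v. transition T (fst v) * snd v)" by auto
    have ST: "S \<inter> T \<in> K" by (rule subset_complex[OF apex_basesD(1)[OF S(1)]]) simp
    have WW: "W \<inter> W' = Q.piece (bar (S \<inter> T))"
      unfolding S(2) T(2) by (rule Q_piece_bar_Int[OF apex_basesD(1)[OF S(1)] apex_basesD(1)[OF T(1)]])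
    show "\<exists>g. holomorphic_fun Q.X (W \<inter> W') g \<and> (\<forall>b\<in>W \<inter> W'. \<forall>v\<in>lb_fibre axis_bundle b. \<tau>' v = g b * \<tau> v)"
    proof (intro exI conjI ballI)
      show "holomorphic_fun Q.X (W \<inter> W') (\<lambda>b. Q.chi b (ecoord T - ecoord S))"
        unfolding holomorphic_fun_def WW
        using Q.gchart_holo(2)[OF Q.atlas_gchart bar_complex[OF ST] ecoord_diff(1)[OF S(1) T(1)]]
        by (auto simp: Q.mdim_X)
      fix b v assume b: "b \<in> W \<inter> W'" and v: "v \<in> lb_fibre axis_bundle b"
      have "fst v = b" using v by (simp add: lb_fibre_def)
      then show "\<tau>' v = Q.chi b (ecoord T - ecoord S) * \<tau> v"
        using transition_change[OF S(1) T(1), of b] b by (simp add: S(2,3) T(2,3))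
    qed
  qed
qed

lemma in_line_iff: "(a, v) \<in> line b \<alpha> \<beta> \<longleftrightarrow> (\<exists>c. a = c * \<alpha> \<and> v = (b, c * \<beta>))"
  by (auto simp: line_def)

lemma line_base_line [simp]: "line_base axis_bundle (line b \<alpha> \<beta>) = b"
  unfolding line_base_def
proof (rule the_equality)
  show "\<forall>(a, v)\<in>line b \<alpha> \<beta>. lb_proj axis_bundle v = b" by (auto simp: line_def)
  show "\<forall>(a, v)\<in>line b \<alpha> \<beta>. lb_proj axis_bundle v = b' \<Longrightarrow> b' = b" for b' by (auto simp: line_def)
qed

lemma fibre_lines_bundle:
  assumes "b \<in> Q.Points"
  shows "fibre_lines axis_bundle b = {line b \<alpha> \<beta> | \<alpha> \<beta>. \<alpha> \<noteq> 0 \<or> \<beta> \<noteq> 0}"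
  unfolding fibre_lines_def fibre_bundle[OF assms] by (auto simp: line_def)

lemma line_in_fibre_lines_iff:
  assumes "b' \<in> Q.Points"
  shows "line b \<alpha> \<beta> \<in> fibre_lines axis_bundle b' \<longleftrightarrow> b = b' \<and> (\<alpha> \<noteq> 0 \<or> \<beta> \<noteq> 0)"
proof
  assume "line b \<alpha> \<beta> \<in> fibre_lines axis_bundle b'"
  then obtain \<alpha>' \<beta>' where l: "line b \<alpha> \<beta> = line b' \<alpha>' \<beta>'" "\<alpha>' \<noteq> 0 \<or> \<beta>' \<noteq> 0"
    unfolding fibre_lines_bundle[OF assms] by blast
  have "b = b'" using arg_cong[OF l(1), of "line_base axis_bundle"] by simp
  moreover have "\<alpha> \<noteq> 0 \<or> \<beta> \<noteq> 0"
  proof (rule ccontr)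
    assume "\<not> (\<alpha> \<noteq> 0 \<or> \<beta> \<noteq> 0)"
    moreover have "(\<alpha>', (b', \<beta>')) \<in> line b' \<alpha>' \<beta>'" unfolding in_line_iff by (intro exI[of _ 1]) simp
    ultimately show False using l unfolding l(1)[symmetric] in_line_iff by auto
  qed
  ultimately show "b = b' \<and> (\<alpha> \<noteq> 0 \<or> \<beta> \<noteq> 0)" by blast
next
  assume "b = b' \<and> (\<alpha> \<noteq> 0 \<or> \<beta> \<noteq> 0)"
  then show "line b \<alpha> \<beta> \<in> fibre_lines axis_bundle b'" unfolding fibre_lines_bundle[OF assms] by blast
qed

lemma proj_Points: "p \<in> Points \<Longrightarrow> proj p \<in> Q.Points"
  using Points_eq proj_piece Q_piece_Points by blast

text \<open>Both simplices contain \<open>x\<close>, so whether \<open>p\<close> is a finite point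
  of its fibre does not depend on the cone used over the base point.\<close>

lemma piece_switch:
  assumes S: "S \<in> apex_bases" and T: "T \<in> apex_bases" and p: "p \<in> piece T" "proj p \<in> Q.piece (bar S)"
  shows "p \<in> piece S"
proof -
  have "p \<in> piece (T \<inter> (S \<union> {x, - x}))"
    using piece_from_proj[OF p(1) apex_basesD(1)[OF T] _ apex_basesD(1)[OF S] p(2)] apex_basesD(3)[OF T] by blast
  moreover have "T \<inter> (S \<union> {x, - x}) \<subseteq> S" using apex_basesD(3)[OF S] apex_basesD(4)[OF T] by blast
  ultimately show ?thesis using piece_mono[OF _ apex_basesD(1)[OF S]] by blast
qed

text \<open>Over the base piece of \<open>S\<close> two maximal pieces suffice, one for each
  apex.\<close>

lemma piece_or_flip:
  assumes S: "S \<in> apex_bases" and p: "p \<in> Points" "proj p \<in> Q.piece (bar S)"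
  shows "p \<in> piece S \<or> p \<in> piece (flip S)"
proof -
  obtain T where T: "T \<in> K" "lattice_basis L T" "p \<in> piece T" using piece_basis[OF p(1)] by metis
  have a: "x \<in> T \<or> - x \<in> T" by (rule basis_contains_apex[OF T(1,2)])
  have *: "p \<in> piece (T \<inter> (S \<union> {x, - x}))"
    by (rule piece_from_proj[OF T(3,1) a apex_basesD(1)[OF S] p(2)])
  from a show ?thesis
  proof
    assume "x \<in> T"
    then have "T \<inter> (S \<union> {x, - x}) \<subseteq> S" using not_both_opposite[OF T(1)] apex_basesD(3)[OF S] by blast
    then show ?thesis using piece_mono[OF * apex_basesD(1)[OF S]] by blast
  next
    assume "- x \<in> T"
    then have "x \<notin> T" using not_both_opposite[OF T(1), of x] by blast
    then have "T \<inter> (S \<union> {x, - x}) \<subseteq> flip S" by (auto simp: flip_def)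
    then show ?thesis using piece_mono[OF * flip_complex[OF S]] by blast
  qed
qed

text \<open>The projective line glued from two affine lines: the overlap is where the coordinate
  does not vanish, and there the two coordinates are inverse.\<close>

lemma piece_Int_flip:
  assumes S: "S \<in> apex_bases"
  shows "p \<in> piece S \<Longrightarrow> chi p (ecoord S) \<noteq> 0 \<Longrightarrow> p \<in> piece (flip S)"
    and "p \<in> piece (flip S) \<Longrightarrow> chi p (- ecoord S) \<noteq> 0 \<Longrightarrow> p \<in> piece S"
    and "p \<in> piece S \<Longrightarrow> p \<in> piece (flip S) \<Longrightarrow> chi p (ecoord S) \<noteq> 0 \<and> chi p (- ecoord S) = inverse (chi p (ecoord S))"
proof -
  note e = ecoord_inner[OF S]
  have "- ecoord S \<in> dual_lattice L" "- ecoord S \<bullet> - x = 1" "\<forall>a\<in>flip S - {- x}. - ecoord S \<bullet> a = 0"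
    using flip_coordinate[OF S] by (simp_all add: apex_coordinate_def)
  note e' = this
  have sub: "S - {x} \<subseteq> S" "S - {x} \<subseteq> flip S" by (auto simp: flip_def)
  {
    assume p: "p \<in> piece S" "chi p (ecoord S) \<noteq> 0"
    have "p \<in> piece (S - {x})" by (rule cross_wall(2)[OF apex_basesD(1,2)[OF S] apex_basesD(3)[OF S] e p])
    then show "p \<in> piece (flip S)" by (rule piece_mono[OF _ flip_complex[OF S] sub(2)])
  }
  {
    assume p: "p \<in> piece (flip S)" "chi p (- ecoord S) \<noteq> 0"
    have "p \<in> piece (flip S - {- x})"
      by (rule cross_wall(2)[OF flip_complex[OF S] flip_basis[OF S] _ e' p]) (simp add: flip_def)
    then show "p \<in> piece S" unfolding flip_minus[OF S] by (rule piece_mono[OF _ apex_basesD(1)[OF S] sub(1)])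
  }
  assume p: "p \<in> piece S" "p \<in> piece (flip S)"
  have SK: "S - {x} \<in> K" by (rule subset_complex[OF apex_basesD(1)[OF S] sub(1)])
  have "S \<inter> flip S = S - {x}" using apex_basesD(4)[OF S] x_neq_neg by (auto simp: flip_def)
  then have p': "p \<in> piece (S - {x})" using piece_Int[OF apex_basesD(1)[OF S] flip_complex[OF S]] p by auto
  have m: "ecoord S \<in> mon (S - {x})" "- ecoord S \<in> mon (S - {x})"
    using e dual_lattice_uminus by (auto simp: mon_def)
  show "chi p (ecoord S) \<noteq> 0 \<and> chi p (- ecoord S) = inverse (chi p (ecoord S))"
    using chi_unit[OF p' SK m(1)] e(3) chi_uminus[OF p' SK m] by blast
qed

text \<open>\<open>hom_line\<close> is defined through the reference cone. Here the same line is
  described from any cone \<open>S\<close> over the base point, with \<open>transition S\<close>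
  accounting for the change of coordinate.\<close>

lemma hom_line_cases:
  assumes S: "S \<in> apex_bases" and p: "p \<in> Points" "proj p \<in> Q.piece (bar S)"
  obtains \<beta> where "p \<in> piece S" "hom_line p = line (proj p) 1 \<beta>" "transition S (proj p) * \<beta> = chi p (ecoord S)"
  | "p \<notin> piece S" "p \<in> piece (flip S)" "hom_line p = line (proj p) 0 1" "chi p (- ecoord S) = 0"
proof -
  let ?b = "proj p" and ?R = "ref (proj p)"
  note R = ref[OF proj_Points[OF p(1)]]
  show thesis
  proof (cases "p \<in> piece S")
    case True
    have pR: "p \<in> piece ?R" by (rule piece_switch[OF R(1) S True R(2)])
    then have h: "hom_line p = line ?b 1 (chi p (ecoord ?R))" by (simp add: hom_line_def)
    have RS: "?R \<inter> S \<in> K" by (rule subset_complex[OF apex_basesD(1)[OF S]]) simp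
    have pRS: "p \<in> piece (?R \<inter> S)" using piece_Int[OF apex_basesD(1)[OF R(1)] apex_basesD(1)[OF S]] True pR by blast
    note d = ecoord_diff(1)[OF R(1) S order_refl]
    have d': "ecoord S - ecoord ?R \<in> mon (?R \<inter> S)" using d by (simp add: Q_mon)
    have eR: "ecoord ?R \<in> mon (?R \<inter> S)"
      using apex_coordinate_mon[OF ecoord[OF R(1)]] mon_antimono[of "?R \<inter> S" ?R] by blast
    \<comment> \<open>\<open>ecoord S\<close> is split into the reference covector and a difference
      that comes from the base.\<close>
    have "chi p (ecoord S - ecoord ?R + ecoord ?R) = chi p (ecoord S - ecoord ?R) * chi p (ecoord ?R)"
      by (rule chi_add[OF pRS RS d' eR])
    then have "transition S ?b * chi p (ecoord ?R) = chi p (ecoord S)"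
      using chi_proj[OF pRS RS d] by (simp add: transition_def)
    then show thesis using that(1) True h by blast
  next
    case False
    have pf: "p \<in> piece (flip S)" using piece_or_flip[OF S p] False by blast
    have "p \<notin> piece ?R" using piece_switch[OF S R(1) _ p(2)] False by blast
    then have "hom_line p = line ?b 0 1" by (simp add: hom_line_def)
    moreover have "chi p (- ecoord S) = 0" using piece_Int_flip(2)[OF S pf] False by blast
    ultimately show thesis using that(2) False pf by blast
  qed
qed

lemma hom_line_fibre:
  assumes p: "p \<in> Points" and b: "b \<in> Q.Points"
  shows "hom_line p \<in> fibre_lines axis_bundle b \<longleftrightarrow> proj p = b"
  unfolding hom_line_def using line_in_fibre_lines_iff[OF b] by auto

text \<open>A dictionary for the charts of \<open>projectivization\<close>: their domains become the
  pieces of \<open>S\<close> and \<open>flip S\<close>, their last coordinates the characters of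
  \<open>ecoord S\<close> and its negative.\<close>

lemma hom_line_affine:
  assumes S: "S \<in> apex_bases" and p: "p \<in> Points" "proj p \<in> Q.piece (bar S)"
  shows "(\<exists>v. (1, v) \<in> hom_line p) \<longleftrightarrow> p \<in> piece S"
    and "p \<in> piece S \<Longrightarrow> (THE t. \<exists>v. (1, v) \<in> hom_line p \<and> transition S (fst v) * snd v = t) = chi p (ecoord S)"
    and "(\<exists>a v. (a, v) \<in> hom_line p \<and> transition S (fst v) * snd v = 1) \<longleftrightarrow> p \<in> piece (flip S)"
    and "p \<in> piece (flip S) \<Longrightarrow>
      (THE t. \<exists>v. (t, v) \<in> hom_line p \<and> transition S (fst v) * snd v = 1) = chi p (- ecoord S)"
proof -
  note nz = transition_nonzero[OF S p(2)]
  have "((\<exists>v. (1, v) \<in> hom_line p) \<longleftrightarrow> p \<in> piece S) \<and>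
    (p \<in> piece S \<longrightarrow> (THE t. \<exists>v. (1, v) \<in> hom_line p \<and> transition S (fst v) * snd v = t) = chi p (ecoord S)) \<and>
    ((\<exists>a v. (a, v) \<in> hom_line p \<and> transition S (fst v) * snd v = 1) \<longleftrightarrow> p \<in> piece (flip S)) \<and>
    (p \<in> piece (flip S) \<longrightarrow>
      (THE t. \<exists>v. (t, v) \<in> hom_line p \<and> transition S (fst v) * snd v = 1) = chi p (- ecoord S))"
    using S p
  proof (cases rule: hom_line_cases)
    case (1 \<beta>)
    let ?h = "transition S (proj p)"
    have v1: "(1, v) \<in> hom_line p \<longleftrightarrow> v = (proj p, \<beta>)" for v unfolding 1(2) in_line_iff by auto
    have av: "(a, v) \<in> hom_line p \<longleftrightarrow> v = (proj p, a * \<beta>)" for a v unfolding 1(2) in_line_iff by auto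
    have f: "p \<in> piece (flip S) \<longleftrightarrow> chi p (ecoord S) \<noteq> 0"
      using piece_Int_flip(1,3)[OF S 1(1)] by blast
    have ex: "(\<exists>a v. (a, v) \<in> hom_line p \<and> transition S (fst v) * snd v = 1) \<longleftrightarrow> chi p (ecoord S) \<noteq> 0"
    proof
      assume "chi p (ecoord S) \<noteq> 0"
      then have "?h * (inverse (chi p (ecoord S)) * \<beta>) = 1" using 1(3) by (metis mult.left_commute left_inverse)
      then show "\<exists>a v. (a, v) \<in> hom_line p \<and> transition S (fst v) * snd v = 1"
        unfolding av by (intro exI[of _ "inverse (chi p (ecoord S))"] exI) auto
    qed (use 1(3) nz in \<open>auto simp: av\<close>)
    have the: "(THE t. \<exists>v. (t, v) \<in> hom_line p \<and> transition S (fst v) * snd v = 1) = chi p (- ecoord S)"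
      if "p \<in> piece (flip S)"
    proof -
      have i: "chi p (ecoord S) \<noteq> 0" "chi p (- ecoord S) = inverse (chi p (ecoord S))"
        using piece_Int_flip(3)[OF S 1(1) that] by blast+
      have "(\<exists>v. (t, v) \<in> hom_line p \<and> transition S (fst v) * snd v = 1) \<longleftrightarrow> t = chi p (- ecoord S)" for t
      proof -
        have "(\<exists>v. (t, v) \<in> hom_line p \<and> transition S (fst v) * snd v = 1) \<longleftrightarrow> ?h * (t * \<beta>) = 1"
          unfolding av by auto
        also have "\<dots> \<longleftrightarrow> t * chi p (ecoord S) = 1" using 1(3) by (metis mult.left_commute)
        also have "\<dots> \<longleftrightarrow> t = chi p (- ecoord S)" unfolding i(2) using i(1) by (auto simp: field_simps)
        finally show ?thesis .
      qed
      then show ?thesis by simp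
    qed
    show ?thesis using v1 1(1,3) f ex the by auto
  next
    case 2
    have v1: "(1, v) \<notin> hom_line p" for v unfolding 2(3) in_line_iff by auto
    have av: "(a, v) \<in> hom_line p \<longleftrightarrow> a = 0 \<and> (\<exists>c. v = (proj p, c))" for a v unfolding 2(3) in_line_iff by auto
    have "transition S (proj p) * (1 / transition S (proj p)) = 1" using nz by simp
    then have "\<exists>c. transition S (proj p) * c = 1" by blast
    then have ex: "(\<exists>v. (t, v) \<in> hom_line p \<and> transition S (fst v) * snd v = 1) \<longleftrightarrow> t = 0" for t
      unfolding av by auto
    show ?thesis using v1 2(1,2,4) ex by auto
  qed
  then show "(\<exists>v. (1, v) \<in> hom_line p) \<longleftrightarrow> p \<in> piece S"
    and "p \<in> piece S \<Longrightarrow> (THE t. \<exists>v. (1, v) \<in> hom_line p \<and> transition S (fst v) * snd v = t) = chi p (ecoord S)"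
    and "(\<exists>a v. (a, v) \<in> hom_line p \<and> transition S (fst v) * snd v = 1) \<longleftrightarrow> p \<in> piece (flip S)"
    and "p \<in> piece (flip S) \<Longrightarrow>
      (THE t. \<exists>v. (t, v) \<in> hom_line p \<and> transition S (fst v) * snd v = 1) = chi p (- ecoord S)"
    by blast+
qed

lemma line_base_hom_line [simp]: "line_base axis_bundle (hom_line p) = proj p"
  by (simp add: hom_line_def)

abbreviation "PB \<equiv> projectivization Q.X axis_bundle"

lemma apex_coordinate_subset: "apex_coordinate y e A \<Longrightarrow> y \<in> B \<Longrightarrow> B \<subseteq> A \<Longrightarrow> apex_coordinate y e B"
  using subset_complex unfolding apex_coordinate_def by blast

text \<open>Lying over \<open>bar E\<close> removes from \<open>A\<close> all generators outside
  \<open>E\<close> except the apex \<open>y\<close>.\<close>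

lemma piece_over_link:
  assumes A: "A \<in> K" "y \<in> A" "y \<in> {x, - x}" and E: "E \<in> link" "E \<subseteq> A"
  shows "{p \<in> Points. proj p \<in> Q.piece (bar E) \<and> p \<in> piece A} = piece (insert y E)"
proof -
  have yE: "insert y E \<in> K" using A(3) linkD(4,5)[OF E(1)] by auto
  have bar_yE: "bar (insert y E) = bar E" using A(3) bar_insert by auto
  show ?thesis
  proof (intro subset_antisym subsetI)
    fix p assume p: "p \<in> {p \<in> Points. proj p \<in> Q.piece (bar E) \<and> p \<in> piece A}"
    then have "p \<in> piece (A \<inter> (E \<union> {x, - x}))"
      using A piece_from_proj[OF _ A(1) _ linkD(1)[OF E(1)]] by auto
    moreover have "A \<inter> (E \<union> {x, - x}) \<subseteq> insert y E"
      using A not_both_opposite[OF A(1), of x] by auto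
    ultimately show "p \<in> piece (insert y E)" using piece_mono[OF _ yE] by blast
  next
    fix p assume p: "p \<in> piece (insert y E)"
    then have "p \<in> piece A" using piece_mono[OF _ A(1)] A(2) E(2) by blast
    moreover have "p \<in> Points" using p yE Points_eq by blast
    moreover have "proj p \<in> Q.piece (bar E)" using proj_piece[OF p yE] bar_yE by simp
    ultimately show "p \<in> {p \<in> Points. proj p \<in> Q.piece (bar E) \<and> p \<in> piece A}" by blast
  qed
qed

text \<open>The base part of a chart domain is an intersection of two pieces, hence the piece of a
  link simplex \<open>E\<close>. Above it the two kinds of affine charts give the pieces of
  \<open>insert x E\<close> and \<open>insert (- x) E\<close>, where \<open>lift_gchart\<close>
  applies.\<close>

lemma chart_pullback:
  assumes "(V, \<psi>) \<in> atlas PB"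
  shows "gchart {p \<in> Points. hom_line p \<in> V} (\<psi> \<circ> hom_line)"
proof -
  let ?k = "dim quotient_lattice"
  have "\<exists>U \<phi> W \<tau>. (U, \<phi>) \<in> atlas Q.X \<and> (W, \<tau>) \<in> lb_triv axis_bundle \<and>
      ((V, \<psi>) = ({l. \<exists>b\<in>U \<inter> W. l \<in> fibre_lines axis_bundle b \<and> (\<exists>v. (1, v) \<in> l)},
         \<lambda>l. (\<phi> (line_base axis_bundle l))(?k := (THE t. \<exists>v. (1, v) \<in> l \<and> \<tau> v = t))) \<or>
      (V, \<psi>) = ({l. \<exists>b\<in>U \<inter> W. l \<in> fibre_lines axis_bundle b \<and> (\<exists>a v. (a, v) \<in> l \<and> \<tau> v = 1)},
         \<lambda>l. (\<phi> (line_base axis_bundle l))(?k := (THE t. \<exists>v. (t, v) \<in> l \<and> \<tau> v = 1))))"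
    using assms unfolding projectivization_def cmanifold.simps Q.mdim_X Un_iff mem_Collect_eq
    by (elim disjE exE conjE; intro exI conjI) (assumption | rule disjI1, assumption | rule disjI2, assumption)+
  then obtain U \<phi> W \<tau> where U0: "(U, \<phi>) \<in> atlas Q.X" and W0: "(W, \<tau>) \<in> lb_triv axis_bundle"
    and alt: "(V, \<psi>) = ({l. \<exists>b\<in>U \<inter> W. l \<in> fibre_lines axis_bundle b \<and> (\<exists>v. (1, v) \<in> l)},
         \<lambda>l. (\<phi> (line_base axis_bundle l))(?k := (THE t. \<exists>v. (1, v) \<in> l \<and> \<tau> v = t))) \<or>
      (V, \<psi>) = ({l. \<exists>b\<in>U \<inter> W. l \<in> fibre_lines axis_bundle b \<and> (\<exists>a v. (a, v) \<in> l \<and> \<tau> v = 1)},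
         \<lambda>l. (\<phi> (line_base axis_bundle l))(?k := (THE t. \<exists>v. (t, v) \<in> l \<and> \<tau> v = 1)))"
    by (elim exE conjE)
  obtain S where S: "S \<in> apex_bases" "W = Q.piece (bar S)" "\<tau> = (\<lambda>v. transition S (fst v) * snd v)" using W0 by auto
  have U: "Q.gchart U \<phi>" by (rule Q.atlas_gchart[OF U0])
  obtain u m J where f: "Q.frame u m" and J: "J \<subseteq> {..<?k}" "u ` J \<in> quotient_complex" and Ueq: "U = Q.piece (u ` J)"
    and \<phi>: "\<And>b. b \<in> U \<Longrightarrow> \<phi> b = Q.coords m b" using U unfolding Q.gchart_def by blast
  obtain D where D: "D \<in> link" "u ` J = bar D" using quotient_complexE[OF J(2)] by blast
  define E where "E = D \<inter> S"
  have E: "E \<in> link" "E \<subseteq> S" "bar E \<subseteq> u ` J"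
    using link_subset[OF D(1), of E] bar_mono[of E D] D(2) by (auto simp: E_def)
  have xE: "x \<notin> E" by (rule linkD(2)[OF E(1)])
  have UW: "U \<inter> W = Q.piece (bar E)"
    unfolding Ueq S(2) D(2) E_def by (rule Q_piece_bar_Int[OF linkD(1)[OF D(1)] apex_basesD(1)[OF S(1)]])
  have UWP: "U \<inter> W \<subseteq> Q.Points" unfolding UW using Q_piece_Points[OF linkD(1)[OF E(1)]] by blast
  have UWS: "b \<in> Q.piece (bar S)" if "b \<in> U \<inter> W" for b using that S(2) by simp
  have \<phi>E: "\<phi> b = Q.coords m b" if "b \<in> Q.piece (bar E)" for b using \<phi>[of b] that UW by blast
  have base: "(\<exists>b\<in>U \<inter> W. hom_line p \<in> fibre_lines axis_bundle b \<and> Z) \<longleftrightarrow> proj p \<in> U \<inter> W \<and> Z" if "p \<in> Points" for p Z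
    using hom_line_fibre[OF that] UWP by blast
  from alt show ?thesis
  proof
    assume "(V, \<psi>) = ({l. \<exists>b\<in>U \<inter> W. l \<in> fibre_lines axis_bundle b \<and> (\<exists>v. (1, v) \<in> l)},
         \<lambda>l. (\<phi> (line_base axis_bundle l))(?k := (THE t. \<exists>v. (1, v) \<in> l \<and> \<tau> v = t)))"
    then have V: "V = {l. \<exists>b\<in>U \<inter> W. l \<in> fibre_lines axis_bundle b \<and> (\<exists>v. (1, v) \<in> l)}"
      and \<psi>: "\<psi> = (\<lambda>l. (\<phi> (line_base axis_bundle l))(?k := (THE t. \<exists>v. (1, v) \<in> l \<and> \<tau> v = t)))" by simp_all
    have "{p \<in> Points. hom_line p \<in> V} = {p \<in> Points. proj p \<in> Q.piece (bar E) \<and> p \<in> piece S}"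
      unfolding V using base hom_line_affine(1)[OF S(1)] UWS UW by auto
    also have "\<dots> = piece (insert x E)"
      using S(1) E(1,2) apex_basesD by (intro piece_over_link) auto
    finally have dom: "{p \<in> Points. hom_line p \<in> V} = piece (insert x E)" .
    have "apex_coordinate x (ecoord S) (insert x E)"
      using apex_coordinate_subset[OF ecoord[OF S(1)]] E(2) apex_basesD(3)[OF S(1)] by blast
    from lift_gchart[OF this E(1) f J(1) E(3) \<phi>E]
    have "gchart (piece (insert x E)) (\<lambda>p. (\<phi> (proj p))(?k := chi p (ecoord S)))" by blast
    then show ?thesis
      unfolding dom
    proof (rule gchart_cong)
      fix p assume "p \<in> piece (insert x E)"
      then have p: "p \<in> Points" "proj p \<in> Q.piece (bar S)" "p \<in> piece S"
        using dom UWS UW piece_over_link[OF apex_basesD(1)[OF S(1)] apex_basesD(3)[OF S(1)] _ E(1,2)] by auto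
      show "(\<phi> (proj p))(?k := chi p (ecoord S)) = (\<psi> \<circ> hom_line) p"
        unfolding \<psi> S(3) using hom_line_affine(2)[OF S(1) p] by simp
    qed
  next
    assume "(V, \<psi>) = ({l. \<exists>b\<in>U \<inter> W. l \<in> fibre_lines axis_bundle b \<and> (\<exists>a v. (a, v) \<in> l \<and> \<tau> v = 1)},
         \<lambda>l. (\<phi> (line_base axis_bundle l))(?k := (THE t. \<exists>v. (t, v) \<in> l \<and> \<tau> v = 1)))"
    then have V: "V = {l. \<exists>b\<in>U \<inter> W. l \<in> fibre_lines axis_bundle b \<and> (\<exists>a v. (a, v) \<in> l \<and> \<tau> v = 1)}"
      and \<psi>: "\<psi> = (\<lambda>l. (\<phi> (line_base axis_bundle l))(?k := (THE t. \<exists>v. (t, v) \<in> l \<and> \<tau> v = 1)))" by simp_all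
    have Ef: "E \<subseteq> flip S" "- x \<in> flip S" using E(2) xE by (auto simp: flip_def)
    have "{p \<in> Points. hom_line p \<in> V} = {p \<in> Points. proj p \<in> Q.piece (bar E) \<and> p \<in> piece (flip S)}"
      unfolding V S(3) using base hom_line_affine(3)[OF S(1)] UWS UW by auto
    also have "\<dots> = piece (insert (- x) E)"
      using flip_complex[OF S(1)] Ef E(1) by (intro piece_over_link) auto
    finally have dom: "{p \<in> Points. hom_line p \<in> V} = piece (insert (- x) E)" .
    have "apex_coordinate (- x) (- ecoord S) (insert (- x) E)"
      using apex_coordinate_subset[OF flip_coordinate[OF S(1)]] Ef by blast
    from lift_gchart[OF this E(1) f J(1) E(3) \<phi>E]
    have "gchart (piece (insert (- x) E)) (\<lambda>p. (\<phi> (proj p))(?k := chi p (- ecoord S)))" by blast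
    then show ?thesis
      unfolding dom
    proof (rule gchart_cong)
      fix p assume "p \<in> piece (insert (- x) E)"
      then have p: "p \<in> Points" "proj p \<in> Q.piece (bar S)" "p \<in> piece (flip S)"
        using dom UWS UW piece_over_link[OF flip_complex[OF S(1)] Ef(2) _ E(1) Ef(1)] by auto
      show "(\<phi> (proj p))(?k := chi p (- ecoord S)) = (\<psi> \<circ> hom_line) p"
        unfolding \<psi> S(3) using hom_line_affine(4)[OF S(1) p] by simp
    qed
  qed
qed

lemma points_PB_I:
  assumes U: "(U, \<phi>) \<in> atlas Q.X" and W: "(W, \<tau>) \<in> lb_triv axis_bundle"
    and l: "b \<in> U \<inter> W" "l \<in> fibre_lines axis_bundle b"
    and alt: "(\<exists>v. (1, v) \<in> l) \<or> (\<exists>a v. (a, v) \<in> l \<and> \<tau> v = 1)"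
  shows "l \<in> points PB"
proof -
  have "({l. \<exists>b\<in>U \<inter> W. l \<in> fibre_lines axis_bundle b \<and> (\<exists>v. (1, v) \<in> l)},
         \<lambda>l. (\<phi> (line_base axis_bundle l))(mdim Q.X := (THE t. \<exists>v. (1, v) \<in> l \<and> \<tau> v = t))) \<in> atlas PB"
    unfolding projectivization_def cmanifold.simps
    by (rule UnI1, rule CollectI, intro exI conjI, rule refl, rule U, rule W)
  moreover have "({l. \<exists>b\<in>U \<inter> W. l \<in> fibre_lines axis_bundle b \<and> (\<exists>a v. (a, v) \<in> l \<and> \<tau> v = 1)},
         \<lambda>l. (\<phi> (line_base axis_bundle l))(mdim Q.X := (THE t. \<exists>v. (t, v) \<in> l \<and> \<tau> v = 1))) \<in> atlas PB"
    unfolding projectivization_def cmanifold.simps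
    by (rule UnI2, rule CollectI, intro exI conjI, rule refl, rule U, rule W)
  moreover have "l \<in> {l. \<exists>b\<in>U \<inter> W. l \<in> fibre_lines axis_bundle b \<and> (\<exists>v. (1, v) \<in> l)} \<or>
      l \<in> {l. \<exists>b\<in>U \<inter> W. l \<in> fibre_lines axis_bundle b \<and> (\<exists>a v. (a, v) \<in> l \<and> \<tau> v = 1)}"
    using l alt by blast
  ultimately show ?thesis unfolding points_def by (elim disjE) (rule UN_I, assumption, simp only: case_prod_conv)+
qed

lemma points_PB: "points PB = {line b \<alpha> \<beta> | b \<alpha> \<beta>. b \<in> Q.Points \<and> (\<alpha> \<noteq> 0 \<or> \<beta> \<noteq> 0)}"
proof (intro subset_antisym subsetI)
  fix l assume "l \<in> points PB"
  then obtain U \<phi> b where U: "(U, \<phi>) \<in> atlas Q.X" "b \<in> U" "l \<in> fibre_lines axis_bundle b"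
    unfolding points_def projectivization_def by auto
  have "b \<in> Q.Points" using Q.gchart_subset[OF Q.atlas_gchart[OF U(1)]] U(2) by blast
  then show "l \<in> {line b \<alpha> \<beta> | b \<alpha> \<beta>. b \<in> Q.Points \<and> (\<alpha> \<noteq> 0 \<or> \<beta> \<noteq> 0)}"
    using U(3) unfolding fibre_lines_bundle[OF \<open>b \<in> Q.Points\<close>] by blast
next
  fix l assume "l \<in> {line b \<alpha> \<beta> | b \<alpha> \<beta>. b \<in> Q.Points \<and> (\<alpha> \<noteq> 0 \<or> \<beta> \<noteq> 0)}"
  then obtain b \<alpha> \<beta> where l: "l = line b \<alpha> \<beta>" "b \<in> Q.Points" "\<alpha> \<noteq> 0 \<or> \<beta> \<noteq> 0" by blast
  have "b \<in> points Q.X" using l(2) Q.points_toric_manifold by simp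
  then obtain U \<phi> where U: "(U, \<phi>) \<in> atlas Q.X" "b \<in> U" by (auto simp: points_def)
  note R = ref[OF l(2)]
  let ?\<tau> = "\<lambda>v :: 'a toric_point \<times> complex. transition (ref b) (fst v) * snd v"
  have W: "(Q.piece (bar (ref b)), ?\<tau>) \<in> lb_triv axis_bundle" using R(1) by auto
  have fl: "l \<in> fibre_lines axis_bundle b" using l line_in_fibre_lines_iff[OF l(2)] by blast
  have nz: "transition (ref b) b \<noteq> 0" by (rule transition_nonzero[OF R])
  show "l \<in> points PB"
  proof (cases "\<alpha> = 0")
    case False
    have "(1, (b, \<beta> / \<alpha>)) \<in> l" unfolding l(1) in_line_iff using False by (intro exI[of _ "1 / \<alpha>"]) simp
    then show ?thesis using U(2) R(2) by (intro points_PB_I[OF U(1) W _ fl]) blast+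
  next
    case True
    then have "\<beta> \<noteq> 0" using l(3) by blast
    then have "(0, (b, 1 / transition (ref b) b)) \<in> l" unfolding l(1) in_line_iff True
      by (intro exI[of _ "1 / transition (ref b) b / \<beta>"]) simp
    moreover have "?\<tau> (b, 1 / transition (ref b) b) = 1" using nz by simp
    ultimately show ?thesis using U(2) R(2) by (intro points_PB_I[OF U(1) W _ fl]) blast+
  qed
qed

lemma hom_line_bij: "bij_betw hom_line Points (points PB)"
  unfolding bij_betw_def
proof
  show "inj_on hom_line Points"
  proof (rule inj_onI)
    fix p q assume p: "p \<in> Points" and q: "q \<in> Points" and eq: "hom_line p = hom_line q"
    have b: "proj p = proj q" using arg_cong[OF eq, of "line_base axis_bundle"] by simp
    note R = ref[OF proj_Points[OF p]]
    let ?S = "ref (proj p)"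
    have q2: "proj q \<in> Q.piece (bar ?S)" using R(2) b by simp
    have iff: "p \<in> piece ?S \<longleftrightarrow> q \<in> piece ?S" "p \<in> piece (flip ?S) \<longleftrightarrow> q \<in> piece (flip ?S)"
      using hom_line_affine(1,3)[OF R(1) p R(2)] hom_line_affine(1,3)[OF R(1) q q2] eq by simp_all
    show "p = q"
    proof (cases "p \<in> piece ?S")
      case True
      then have "chi p (ecoord ?S) = chi q (ecoord ?S)"
        using hom_line_affine(2)[OF R(1) p R(2)] hom_line_affine(2)[OF R(1) q q2] iff(1) eq by simp
      then show ?thesis using point_determined[OF ecoord[OF R(1)] True _ b] iff(1) True by blast
    next
      case False
      then have f: "p \<in> piece (flip ?S)" using piece_or_flip[OF R(1) p R(2)] by blast
      then have "chi p (- ecoord ?S) = chi q (- ecoord ?S)"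
        using hom_line_affine(4)[OF R(1) p R(2)] hom_line_affine(4)[OF R(1) q q2] iff(2) eq by simp
      then show ?thesis using point_determined[OF flip_coordinate[OF R(1)] f _ b] iff(2) f by blast
    qed
  qed
  show "hom_line ` Points = points PB"
  proof (intro subset_antisym subsetI)
    fix l assume "l \<in> hom_line ` Points"
    then obtain p where p: "p \<in> Points" "l = hom_line p" by blast
    have "\<exists>\<alpha> \<beta>. hom_line p = line (proj p) \<alpha> \<beta> \<and> (\<alpha> \<noteq> 0 \<or> \<beta> \<noteq> 0)"
      unfolding hom_line_def by (metis one_neq_zero)
    then show "l \<in> points PB" unfolding points_PB p(2) using proj_Points[OF p(1)] by blast
  next
    fix l assume "l \<in> points PB"
    then obtain b \<alpha> \<beta> where l: "l = line b \<alpha> \<beta>" "b \<in> Q.Points" "\<alpha> \<noteq> 0 \<or> \<beta> \<noteq> 0" unfolding points_PB by blast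
    note R = ref[OF l(2)]
    \<comment> \<open>A line depends only on the ratio of its entries, so it is spanned by
      \<open>(1, t)\<close> for some \<open>t\<close> or by \<open>(0, 1)\<close>.\<close>
    have scale: "line b \<alpha> \<beta> = line b (c * \<alpha>) (c * \<beta>)" if "c \<noteq> 0" for c
    proof (intro subset_antisym subsetI)
      fix z assume "z \<in> line b \<alpha> \<beta>"
      then obtain r where "z = (r * \<alpha>, (b, r * \<beta>))" by (auto simp: line_def)
      then have "z = (r / c * (c * \<alpha>), (b, r / c * (c * \<beta>)))" using that by simp
      then show "z \<in> line b (c * \<alpha>) (c * \<beta>)" unfolding line_def by blast
    next
      fix z assume "z \<in> line b (c * \<alpha>) (c * \<beta>)"
      then obtain r where "z = (r * (c * \<alpha>), (b, r * (c * \<beta>)))" by (auto simp: line_def)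
      then have "z = (r * c * \<alpha>, (b, r * c * \<beta>))" by (simp add: mult.assoc)
      then show "z \<in> line b \<alpha> \<beta>" unfolding line_def by blast
    qed
    show "l \<in> hom_line ` Points"
    proof (cases "\<alpha> = 0")
      case False
      obtain p where p: "p \<in> piece (ref b)" "proj p = b" "chi p (ecoord (ref b)) = \<beta> / \<alpha>"
        using exists_point_over[OF ecoord[OF R(1)] R(2), of "\<beta> / \<alpha>"] by blast
      then have "hom_line p = line b 1 (\<beta> / \<alpha>)" by (simp add: hom_line_def)
      moreover have "l = line b 1 (\<beta> / \<alpha>)" using scale[of "1 / \<alpha>"] False l(1) by simp
      moreover have "p \<in> Points" using p(1) apex_basesD(1)[OF R(1)] Points_eq by blast
      ultimately show ?thesis by blast
    next
      case True
      then have "\<beta> \<noteq> 0" using l(3) by blast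
      then have l01: "l = line b 0 1" using scale[of "1 / \<beta>"] True l(1) by simp
      have bf: "b \<in> Q.piece (bar (flip (ref b)))" using R(2) bar_flip[OF R(1)] by simp
      \<comment> \<open>The point at infinity over \<open>b\<close> is the zero of the coordinate on
        the opposite piece.\<close>
      obtain p where p: "p \<in> piece (flip (ref b))" "proj p = b" "chi p (- ecoord (ref b)) = 0"
        using exists_point_over[OF flip_coordinate[OF R(1)] bf, of 0] by blast
      have "p \<notin> piece (ref b)"
        using piece_Int_flip(3)[OF R(1) _ p(1)] p(3) by auto
      then have "hom_line p = line b 0 1" using p(2) by (simp add: hom_line_def)
      moreover have "p \<in> Points" using p(1) flip_complex[OF R(1)] Points_eq by blast
      ultimately show ?thesis using l01 by blast
    qed
  qed
qed

lemma biholomorphic_PB: "biholomorphic X PB"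
  by (rule biholomorphicI[OF _ hom_line_bij chart_pullback]) (simp add: projectivization_def Q.mdim_X quotient_dim)

end

subsection \<open>Bott towers\<close>

text \<open>In the final proof a complex is chosen for each level separately. Since smooth cones
  determine their generators, it agrees with the quotient of the complex chosen one level
  above.\<close>

lemma simplicial_fan_unique:
  assumes "simplicial_fan L K" "simplicial_fan L K'"
    and eq: "(\<lambda>A. convex_cone hull A) ` K = (\<lambda>A. convex_cone hull A) ` K'"
  shows "K = K'"
proof -
  have *: "K \<subseteq> K'" if K: "simplicial_fan L K" and K': "simplicial_fan L K'"
    and eq: "(\<lambda>A. convex_cone hull A) ` K = (\<lambda>A. convex_cone hull A) ` K'" for K K' :: "'a set set"
  proof
    fix A assume A: "A \<in> K"
    then have "convex_cone hull A \<in> (\<lambda>A. convex_cone hull A) ` K'" using eq by blast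
    then obtain A' where A': "A' \<in> K'" "convex_cone hull A' = convex_cone hull A" by auto
    obtain B where B: "A \<subseteq> B" "lattice_basis L B" using simplicial_fan.extends_to_basis[OF K A] by blast
    obtain B' where B': "A' \<subseteq> B'" "lattice_basis L B'" using simplicial_fan.extends_to_basis[OF K' A'(1)] by blast
    have "A = A'"
      using lattice_cone_generators_subset[OF B(2,1) B'(2,1) A'(2)]
        lattice_cone_generators_subset[OF B'(2,1) B(2,1) A'(2)[symmetric]] by (rule subset_antisym)
    then show "A \<in> K'" using A'(1) by simp
  qed
  show ?thesis using *[OF assms] *[OF assms(2,1) eq[symmetric]] by (rule subset_antisym)
qed

lemma quotient_step:
  assumes K: "crosspolytope_fan L K"
    and x: "ray_generator L ((\<lambda>A. convex_cone hull A) ` K) x" "ray_generator L ((\<lambda>A. convex_cone hull A) ` K) (- x)"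
  shows "fan_suspension L K x"
proof -
  interpret crosspolytope_fan L K by fact
  show ?thesis using fan_suspensionI ray_generator_vertex[OF x(1)] ray_generator_vertex[OF x(2)] .
qed

lemma (in simplicial_fan) zero_dimensional:
  assumes "dim L = 0"
  shows "K = {{}}" "exchange" "Points = piece {}" "\<exists>p. Points = {p}"
proof -
  have empty: "A = {}" if "A \<in> K" for A
  proof -
    obtain B where B: "A \<subseteq> B" "lattice_basis L B" using extends_to_basis[OF \<open>A \<in> K\<close>] by blast
    have "card B = 0" using lattice_basis_dim[OF B(2)] assms by simp
    then show ?thesis using lattice_basis_finite[OF B(2)] B(1) by simp
  qed
  then show K: "K = {{}}" using empty_complex by blast
  show exchange unfolding exchange_def by (simp add: K)
  show P: "Points = piece {}" using Points_eq empty empty_complex by auto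
  \<comment> \<open>The dual lattice is zero, so the trivial character is the only one and leaves
    room for a single point.\<close>
  have "dual_lattice L \<subseteq> {0}" using assms dim_eq_0[of L] span_mono[of L "{0}"] by (auto simp: dual_lattice_def)
  then have mon: "mon {} = {0}" using mon_0[of "{}"] by (auto simp: mon_def)
  have "restrict (\<lambda>_. 1) (mon {}) \<in> homs {}" by (simp add: homs_iff mon)
  then obtain p where p: "p \<in> piece {}" using point_exists[OF empty_complex] by metis
  have "q = p" if "q \<in> piece {}" for q
  proof (rule point_eqI[OF that p empty_complex])
    fix m assume "m \<in> mon {}"
    then show "chi q m = chi p m" using chi_0[OF that empty_complex] chi_0[OF p empty_complex] by (simp add: mon)
  qed
  then have "piece {} = {p}" using p by blast
  then show "\<exists>p. Points = {p}" using P by simp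
qed

text \<open>Over a point one of the trivialisations is already global, so inserting it changes
  nothing.\<close>

lemma (in fan_suspension) trivial_bundle:
  assumes "dim quotient_lattice = 0"
  shows "trivial_line_bundle Q.X axis_bundle"
proof -
  obtain b where "b \<in> Q.Points" using Q.zero_dimensional(4)[OF assms] by blast
  note R = ref[OF this]
  have "bar (ref b) = {}" using bar_complex[OF apex_basesD(1)[OF R(1)]] Q.zero_dimensional(1)[OF assms] by blast
  then have eq: "Q.piece (bar (ref b)) = points Q.X"
    unfolding Q.points_toric_manifold Q.zero_dimensional(3)[OF assms] by simp
  have "(Q.piece (bar (ref b)), \<lambda>v. transition (ref b) (fst v) * snd v) \<in> lb_triv axis_bundle"
    using R(1) by auto
  then have ins: "insert (points Q.X, \<lambda>v. transition (ref b) (fst v) * snd v) (lb_triv axis_bundle) = lb_triv axis_bundle"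
    unfolding eq by (rule insert_absorb)
  have upd: "r\<lparr>lb_triv := lb_triv r\<rparr> = r" for r :: "('a toric_point, 'a toric_point \<times> complex) line_bundle" by simp
  have "holomorphic_line_bundle Q.X
      (axis_bundle\<lparr>lb_triv := insert (points Q.X, \<lambda>v. transition (ref b) (fst v) * snd v) (lb_triv axis_bundle)\<rparr>)"
    unfolding ins upd by (rule holomorphic_bundle)
  then show ?thesis unfolding trivial_line_bundle_def
    by (intro conjI holomorphic_bundle exI[of _ "\<lambda>v. transition (ref b) (fst v) * snd v"])
qed

theorem theorem4p10:
  fixes P :: "(real ^ 'n) set"
    and L :: "nat \<Rightarrow> (real ^ 'n) set"
    and \<Sigma> :: "nat \<Rightarrow> (real ^ 'n) set set"
    and x :: "nat \<Rightarrow> real ^ 'n"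
  assumes "crosspolytope CARD('n) P"
    and "0 \<in> interior P"
    and "\<Sigma> CARD('n) = spanned_fan P"
    and "L CARD('n) = {v. \<forall>i. v $ i \<in> \<int>}"
    and "fan (L CARD('n)) (\<Sigma> CARD('n))"
    and "smooth_fan (L CARD('n)) (\<Sigma> CARD('n))"
    and "projective_fan (L CARD('n)) (\<Sigma> CARD('n))"
    and "quotient_fan_sequence CARD('n) L \<Sigma> x"
  shows "bott_tower CARD('n) (\<lambda>k. toric_manifold (L k) (\<Sigma> k))"
proof -
  let ?n = "CARD('n)"
  have seq: "ray_generator (L (Suc k)) (\<Sigma> (Suc k)) (x (Suc k))"
    "ray_generator (L (Suc k)) (\<Sigma> (Suc k)) (- x (Suc k))"
    "\<Sigma> k = {perp_proj (x (Suc k)) ` \<sigma> | \<sigma>. \<sigma> \<in> \<Sigma> (Suc k) \<and> conic hull {x (Suc k)} face_of \<sigma>}"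
    "L k = perp_proj (x (Suc k)) ` L (Suc k)" if "k < ?n" for k
    using assms(8) that unfolding quotient_fan_sequence_def by blast+
  let ?R = "\<lambda>k K. crosspolytope_fan (L k) K \<and> \<Sigma> k = (\<lambda>A. convex_cone hull A) ` K \<and> dim (L k) = k"
  have down: "fan_suspension (L (Suc k)) K (x (Suc k))"
    "fan_suspension.quotient_lattice (L (Suc k)) (x (Suc k)) = L k"
    "?R k (fan_suspension.quotient_complex K (x (Suc k)))" if k: "k < ?n" and R: "?R (Suc k) K" for k K
  proof -
    show susp: "fan_suspension (L (Suc k)) K (x (Suc k))"
      using quotient_step[of "L (Suc k)" K "x (Suc k)"] R seq(1,2)[OF k] by simp
    interpret fan_suspension "L (Suc k)" K "x (Suc k)" by (rule susp)
    show L: "quotient_lattice = L k" unfolding quotient_lattice_def using seq(4)[OF k] by simp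
    have "crosspolytope_fan (L k) quotient_complex"
      using crosspolytope_fan_quotient[OF _ susp] R by (simp add: L)
    moreover have "\<Sigma> k = (\<lambda>A. convex_cone hull A) ` quotient_complex"
      using seq(3)[OF k] quotient_fan R by simp
    moreover have "dim (L k) = k" using quotient_dim R by (simp add: L)
    ultimately show "?R k quotient_complex" by blast
  qed
  have top: "\<exists>K. ?R ?n K"
  proof -
    have "crosspolytope DIM(real ^ 'n) P" "smooth_fan (L ?n) (spanned_fan P)" using assms(1,3,6) by simp_all
    then obtain K where "crosspolytope_fan (L ?n) K" "spanned_fan P = (\<lambda>A. convex_cone hull A) ` K"
      "dim (L ?n) = DIM(real ^ 'n)" using crosspolytope_complex[OF _ assms(2)] by metis
    then show ?thesis using assms(3) by auto
  qed
  \<comment> \<open>The induction runs downward from the fan of the polytope, as each fan is a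
    quotient of the next higher one.\<close>
  have "\<exists>K. ?R k K" if "k \<le> ?n" for k
    using that
  proof (induction rule: inc_induct)
    case base
    show ?case by (rule top)
  next
    case (step k)
    then obtain K where "?R (Suc k) K" by blast
    then show ?case using down(3)[OF step(2)] by blast
  qed
  then obtain K where K: "\<And>k. k \<le> ?n \<Longrightarrow> ?R k (K k)" by metis
  have fanK: "simplicial_fan (L k) (K k)" if "k \<le> ?n" for k
    using K[OF that] by (simp add: crosspolytope_fan_def)
  have \<Sigma>: "simplicial_fan.fan_of (K k) = \<Sigma> k" if "k \<le> ?n" for k
    using K[OF that] simplicial_fan.fan_of_def[OF fanK[OF that]] by simp
  have susp: "fan_suspension (L (Suc k)) (K (Suc k)) (x (Suc k))"
    "fan_suspension.quotient_lattice (L (Suc k)) (x (Suc k)) = L k"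
    "fan_suspension.quotient_complex (K (Suc k)) (x (Suc k)) = K k" if k: "k < ?n" for k
  proof -
    have R: "?R (Suc k) (K (Suc k))" using K k by simp
    note s = down[OF k R]
    show "fan_suspension (L (Suc k)) (K (Suc k)) (x (Suc k))"
      "fan_suspension.quotient_lattice (L (Suc k)) (x (Suc k)) = L k" by (rule s)+
    show "fan_suspension.quotient_complex (K (Suc k)) (x (Suc k)) = K k"
    proof (rule simplicial_fan_unique)
      show "simplicial_fan (L k) (fan_suspension.quotient_complex (K (Suc k)) (x (Suc k)))"
        using s(3) by (simp add: crosspolytope_fan_def)
      show "simplicial_fan (L k) (K k)" using fanK[of k] k by simp
      have "k \<le> ?n" using k by simp
      from conjunct1[OF conjunct2[OF K[OF this]]] conjunct1[OF conjunct2[OF s(3)]]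
      show "(\<lambda>A. convex_cone hull A) ` fan_suspension.quotient_complex (K (Suc k)) (x (Suc k)) =
          (\<lambda>A. convex_cone hull A) ` K k" by (simp only:)
    qed
  qed
  \<comment> \<open>The exchange property travels in the opposite direction, up from dimension
    0.\<close>
  have exch: "simplicial_fan.exchange (L k) (K k)" if "k \<le> ?n" for k
    using that
  proof (induction k)
    case 0
    then show ?case using simplicial_fan.zero_dimensional(2)[OF fanK] K[of 0] by simp
  next
    case (Suc k)
    then have k: "k < ?n" by simp
    show ?case using fan_suspension.exchange_lift[OF susp(1)[OF k]] Suc susp(2,3)[OF k] by simp
  qed
  define \<xi> where "\<xi> k = fan_suspension.axis_bundle (L (Suc k)) (K (Suc k)) (x (Suc k))" for k
  show ?thesis
    unfolding bott_tower_def
  proof (intro conjI exI[of _ \<xi>] allI impI)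
    show "complex_manifold (toric_manifold (L k) (\<Sigma> k))" if "k \<le> ?n" for k
      using simplicial_fan.complex_manifold_toric[OF fanK[OF that] exch[OF that]] \<Sigma>[OF that] by simp
    show "mdim (toric_manifold (L 0) (\<Sigma> 0)) = 0" using K[of 0] by (simp add: toric_manifold_def)
    show "\<exists>p. points (toric_manifold (L 0) (\<Sigma> 0)) = {p}"
      using simplicial_fan.zero_dimensional(4)[OF fanK[of 0]] simplicial_fan.points_toric_manifold[OF fanK[of 0]]
        K[of 0] \<Sigma>[of 0] by simp
    have n: "0 < ?n" by simp
    show "trivial_line_bundle (toric_manifold (L 0) (\<Sigma> 0)) (\<xi> 0)"
      using fan_suspension.trivial_bundle[OF susp(1)[OF n]] K[of 0] \<Sigma>[of 0] susp(2,3)[OF n] by (simp add: \<xi>_def)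
    fix k assume k: "k < ?n"
    show "holomorphic_line_bundle (toric_manifold (L k) (\<Sigma> k)) (\<xi> k)"
      using fan_suspension.holomorphic_bundle[OF susp(1)[OF k]] \<Sigma>[of k] susp(2,3)[OF k] k by (simp add: \<xi>_def)
    show "biholomorphic (toric_manifold (L (Suc k)) (\<Sigma> (Suc k))) (projectivization (toric_manifold (L k) (\<Sigma> k)) (\<xi> k))"
      using fan_suspension.biholomorphic_PB[OF susp(1)[OF k]] \<Sigma>[of k] \<Sigma>[of "Suc k"] susp(2,3)[OF k] k
      by (simp add: \<xi>_def)
  qed
qed

end
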